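(* Let $h>1$, $k>1$ and $n\ge hk$ be integers. If $n=hk$, then $$\pi_2(\mathcal{F}_h^{hk}(k,hk))\cong\mathbb{Z}^{h-1},$$ while if $hk<n$, then $$\pi_2(\mathcal{F}_h^{hk}(k,n))\cong\mathbb{Z}^h .$$
   Context: For $0<k<n$, $Gr(k,n)$ denotes the Grassmannian manifold of $k$-dimensional complex linear subspaces of $\mathbb{C}^n$. For $h\ge 1$, $\mathcal{F}_h^i(k,n)$ is the space of all ordered $h$-tuples $(H_1,\ldots,H_h)$ of pairwise distinct points of $Gr(k,n)$ such that $\dim(H_1+\cdots+H_h)=i$, topologized as a subspace of $Gr(k,n)^h$. When $i=hk$ the subspaces $H_1,\ldots,H_h$ are in direct sum. *)

theory Defs
  imports
    "HOL-Analysis.Analysis"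
    "HOL-Algebra.Product_Groups"
    "HOL-Library.Set_Algebras"
begin

section \<open>The second homotopy group of a pointed topological space\<close>

abbreviation unit_square :: "(real \<times> real) topology"
  where "unit_square \<equiv> top_of_set ({0..1} \<times> {0..1})"

definition const_on_boundary :: "'a \<Rightarrow> (real \<times> real \<Rightarrow> 'a) \<Rightarrow> bool"
  where "const_on_boundary a p \<longleftrightarrow> (\<forall>z \<in> frontier ({0..1} \<times> {0..1}). p z = a)"

definition spheroids :: "'a topology \<Rightarrow> 'a \<Rightarrow> (real \<times> real \<Rightarrow> 'a) set"
  where "spheroids X a = {p. continuous_map unit_square X p \<and> const_on_boundary a p}"

text \<open>Homotopy relative to the boundary of the square.  The values of \<open>p\<close> and \<open>q\<close> outside the
  square are irrelevant: maps agreeing on the square are related.\<close>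

definition spheroid_homotopic :: "'a topology \<Rightarrow> 'a \<Rightarrow> (real \<times> real \<Rightarrow> 'a) rel"
  where "spheroid_homotopic X a =
    {(p, q). homotopic_with (const_on_boundary a) unit_square X p q}"

definition spheroid_concat ::
    "(real \<times> real \<Rightarrow> 'a) \<Rightarrow> (real \<times> real \<Rightarrow> 'a) \<Rightarrow> (real \<times> real \<Rightarrow> 'a)"
  where "spheroid_concat p q =
    (\<lambda>(s, t). if s \<le> 1/2 then p (2 * s, t) else q (2 * s - 1, t))"

definition second_homotopy_group :: "'a topology \<Rightarrow> 'a \<Rightarrow> (real \<times> real \<Rightarrow> 'a) set monoid"
  where "second_homotopy_group X a =
    \<lparr>carrier = spheroids X a // spheroid_homotopic X a,
     monoid.mult = (\<lambda>A B. \<Union>p\<in>A. \<Union>q\<in>B. spheroid_homotopic X a `` {spheroid_concat p q}),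
     one = spheroid_homotopic X a `` {\<lambda>_. a}\<rparr>"

lemma frontier_unit_square:
  "frontier ({0..1} \<times> {0..1::real}) =
    {(s::real, t). s \<in> {0..1} \<and> t \<in> {0..1} \<and> (s \<in> {0, 1} \<or> t \<in> {0, 1::real})}"
  by (auto simp: frontier_def closure_Times interior_Times)

lemma const_on_boundary_iff:
  "const_on_boundary a p \<longleftrightarrow>
    (\<forall>s\<in>{0..1}. p (s, 0) = a \<and> p (s, 1) = a) \<and> (\<forall>t\<in>{0..1}. p (0, t) = a \<and> p (1, t) = a)"
  unfolding const_on_boundary_def frontier_unit_square by auto

lemma equiv_spheroid_homotopic: "equiv (spheroids X a) (spheroid_homotopic X a)"
proof (rule equivI)
  show "spheroid_homotopic X a \<subseteq> spheroids X a \<times> spheroids X a"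
    by (auto simp: spheroid_homotopic_def spheroids_def
        dest: homotopic_with_imp_continuous_maps homotopic_with_imp_property)
  show "refl_on (spheroids X a) (spheroid_homotopic X a)"
    by (auto simp: refl_on_def spheroid_homotopic_def spheroids_def)
  show "sym (spheroid_homotopic X a)"
    by (auto simp: sym_def spheroid_homotopic_def homotopic_with_symD)
  show "trans (spheroid_homotopic X a)"
    by (auto simp: trans_def spheroid_homotopic_def intro: homotopic_with_trans)
qed

lemma continuous_map_unit_square_into:
  assumes "continuous_on T f" "f ` T \<subseteq> {0..1} \<times> {0..1}"
  shows "continuous_map (top_of_set T) unit_square f"
  using assms by (auto simp: continuous_map_in_subtopology)

lemma prod_interval_unit_square:
  "prod_topology (top_of_set {0..1::real}) unit_square = top_of_set ({0..1} \<times> {0..1} \<times> {0..1})"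
  by (metis prod_topology_subtopology_eu)

lemma continuous_map_concat_homotopies:
  fixes f g :: "real \<times> real \<times> real \<Rightarrow> 'a"
  defines "D \<equiv> {0..1} \<times> {0..1} \<times> {0..1::real}"
  assumes f: "continuous_map (top_of_set D) X f"
    and g: "continuous_map (top_of_set D) X g"
    and eq: "\<And>u t. u \<in> {0..1} \<Longrightarrow> t \<in> {0..1} \<Longrightarrow> f (u, 1, t) = g (u, 0, t)"
  shows "continuous_map (top_of_set D) X
    (\<lambda>x. if fst (snd x) \<le> 1/2 then f (fst x, 2 * fst (snd x), snd (snd x))
         else g (fst x, 2 * fst (snd x) - 1, snd (snd x)))"
proof (rule continuous_map_cases_le)
  show "continuous_map (top_of_set D) euclideanreal (\<lambda>x. fst (snd x))"
    by (simp add: continuous_intros)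
  show "continuous_map (top_of_set D) euclideanreal (\<lambda>x. 1/2)"
    by simp
  have "continuous_map (subtopology (top_of_set D) {x \<in> topspace (top_of_set D). fst (snd x) \<le> 1/2})
      (top_of_set D) (\<lambda>x. (fst x, 2 * fst (snd x), snd (snd x)))"
    by (auto simp: continuous_map_in_subtopology subtopology_subtopology D_def
        intro!: continuous_intros)
  from continuous_map_compose[OF this f]
  show "continuous_map (subtopology (top_of_set D) {x \<in> topspace (top_of_set D). fst (snd x) \<le> 1/2}) X
      (\<lambda>x. f (fst x, 2 * fst (snd x), snd (snd x)))"
    by (simp add: o_def)
  have "continuous_map (subtopology (top_of_set D) {x \<in> topspace (top_of_set D). 1/2 \<le> fst (snd x)})
      (top_of_set D) (\<lambda>x. (fst x, 2 * fst (snd x) - 1, snd (snd x)))"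
    by (auto simp: continuous_map_in_subtopology subtopology_subtopology D_def
        intro!: continuous_intros)
  from continuous_map_compose[OF this g]
  show "continuous_map (subtopology (top_of_set D) {x \<in> topspace (top_of_set D). 1/2 \<le> fst (snd x)}) X
      (\<lambda>x. g (fst x, 2 * fst (snd x) - 1, snd (snd x)))"
    by (simp add: o_def)
  fix x
  assume "x \<in> topspace (top_of_set D)" "fst (snd x) = 1/2"
  then have "2 * fst (snd x) = 1" "2 * fst (snd x) - 1 = 0" "fst x \<in> {0..1}" "snd (snd x) \<in> {0..1}"
    by (auto simp: D_def)
  then show "f (fst x, 2 * fst (snd x), snd (snd x)) = g (fst x, 2 * fst (snd x) - 1, snd (snd x))"
    using eq by metis
qed

lemma spheroid_concat_homotopic:
  assumes "(p, p') \<in> spheroid_homotopic X a" "(q, q') \<in> spheroid_homotopic X a"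
  shows "(spheroid_concat p q, spheroid_concat p' q') \<in> spheroid_homotopic X a"
proof -
  obtain f where "continuous_map (top_of_set ({0..1} \<times> {0..1} \<times> {0..1})) X f \<and>
      (\<forall>x. f (0, x) = p x) \<and> (\<forall>x. f (1, x) = p' x) \<and>
      (\<forall>u\<in>{0..1::real}. const_on_boundary a (\<lambda>x. f (u, x)))"
    using assms(1) unfolding spheroid_homotopic_def homotopic_with_def prod_interval_unit_square
      mem_Collect_eq case_prod_conv by blast
  then have f: "continuous_map (top_of_set ({0..1} \<times> {0..1} \<times> {0..1})) X f"
    "\<And>x. f (0, x) = p x" "\<And>x. f (1, x) = p' x"
    "\<And>u. u \<in> {0..1} \<Longrightarrow> const_on_boundary a (\<lambda>x. f (u, x))"
    by blast+
  obtain g where "continuous_map (top_of_set ({0..1} \<times> {0..1} \<times> {0..1})) X g \<and>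
      (\<forall>x. g (0, x) = q x) \<and> (\<forall>x. g (1, x) = q' x) \<and>
      (\<forall>u\<in>{0..1::real}. const_on_boundary a (\<lambda>x. g (u, x)))"
    using assms(2) unfolding spheroid_homotopic_def homotopic_with_def prod_interval_unit_square
      mem_Collect_eq case_prod_conv by blast
  then have g: "continuous_map (top_of_set ({0..1} \<times> {0..1} \<times> {0..1})) X g"
    "\<And>x. g (0, x) = q x" "\<And>x. g (1, x) = q' x"
    "\<And>u. u \<in> {0..1} \<Longrightarrow> const_on_boundary a (\<lambda>x. g (u, x))"
    by blast+
  have eq: "f (u, 1, t) = g (u, 0, t)" if "u \<in> {0..1}" "t \<in> {0..1}" for u t
    using f(4)[OF that(1)] g(4)[OF that(1)] that(2) by (simp add: const_on_boundary_iff)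
  show ?thesis
    unfolding spheroid_homotopic_def homotopic_with_def prod_interval_unit_square mem_Collect_eq
      case_prod_conv
  proof (intro exI conjI ballI)
    let ?h = "\<lambda>x. if fst (snd x) \<le> 1/2 then f (fst x, 2 * fst (snd x), snd (snd x))
         else g (fst x, 2 * fst (snd x) - 1, snd (snd x))"
    show "continuous_map (top_of_set ({0..1} \<times> {0..1} \<times> {0..1})) X ?h"
      by (rule continuous_map_concat_homotopies[OF f(1) g(1) eq])
    show "\<forall>x. ?h (0, x) = spheroid_concat p q x" "\<forall>x. ?h (1, x) = spheroid_concat p' q' x"
      by (auto simp: spheroid_concat_def f g)
    fix u :: real assume u: "u \<in> {0..1}"
    show "const_on_boundary a (\<lambda>x. ?h (u, x))"
      using f(4)[OF u] g(4)[OF u] by (auto simp: const_on_boundary_iff)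
  qed
qed

lemma spheroid_concat_in:
  assumes "p \<in> spheroids X a" "q \<in> spheroids X a"
  shows "spheroid_concat p q \<in> spheroids X a"
  using spheroid_concat_homotopic[of p p X a q q] assms equiv_spheroid_homotopic[of X a]
  by (auto simp: equiv_def refl_on_def)

lemma spheroid_reparametrize:
  fixes \<phi> \<psi> :: "real \<Rightarrow> real"
  assumes p: "p \<in> spheroids X a"
    and \<phi>: "continuous_on {0..1} \<phi>" "\<phi> ` {0..1} \<subseteq> {0..1}"
    and \<psi>: "continuous_on {0..1} \<psi>" "\<psi> ` {0..1} \<subseteq> {0..1}"
    and ends: "\<phi> 0 = \<psi> 0" "\<phi> 1 = \<psi> 1" "\<phi> 0 \<in> {0, 1}" "\<phi> 1 \<in> {0, 1}"
    and r: "\<And>s t. s \<in> {0..1} \<Longrightarrow> t \<in> {0..1} \<Longrightarrow> r (s, t) = p (\<phi> s, t)"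
    and r': "\<And>s t. s \<in> {0..1} \<Longrightarrow> t \<in> {0..1} \<Longrightarrow> r' (s, t) = p (\<psi> s, t)"
  shows "(r, r') \<in> spheroid_homotopic X a"
proof -
  let ?D = "{0..1} \<times> {0..1} \<times> {0..1::real} :: (real \<times> real \<times> real) set"
  let ?k = "\<lambda>x::real \<times> real \<times> real.
    ((1 - fst x) * \<phi> (fst (snd x)) + fst x * \<psi> (fst (snd x)), snd (snd x))"
  let ?h = "\<lambda>x. p (?k x)"
  have in01: "(1 - u) * \<phi> s + u * \<psi> s \<in> {0..1}" if "u \<in> {0..1}" "s \<in> {0..1}" for u s
    using convexD_alt[of "{0..1::real}" "\<phi> s" "\<psi> s" u] \<phi>(2) \<psi>(2) that
    by (auto simp: image_subset_iff)
  have "continuous_on ?D (\<lambda>x. \<phi> (fst (snd x)))" "continuous_on ?D (\<lambda>x. \<psi> (fst (snd x)))"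
    by (rule continuous_on_compose2[OF \<phi>(1)] continuous_on_compose2[OF \<psi>(1)];
        auto intro!: continuous_intros)+
  then have "continuous_on ?D ?k"
    by (intro continuous_intros)
  then have "continuous_map (top_of_set ?D) unit_square ?k"
    using in01 by (intro continuous_map_unit_square_into) auto
  then have cont: "continuous_map (top_of_set ?D) X ?h"
    using p continuous_map_compose[of _ unit_square ?k X p] by (auto simp: spheroids_def o_def)
  have b: "const_on_boundary a p"
    using p by (simp add: spheroids_def)
  have "homotopic_with (const_on_boundary a) unit_square X r r'"
  proof (subst homotopic_with, goal_cases)
    case (1 h k)
    then show ?case by (auto simp: const_on_boundary_iff)
  next
    case 2
    show ?case
      unfolding prod_interval_unit_square
    proof (intro exI[of _ ?h] conjI ballI)
      show "continuous_map (top_of_set ?D) X ?h" by (rule cont)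
      show "?h (0, x) = r x" "?h (1, x) = r' x" if "x \<in> topspace unit_square" for x
        using that r[of "fst x" "snd x"] r'[of "fst x" "snd x"] by (auto simp: mem_Times_iff)
      fix u :: real assume u: "u \<in> {0..1}"
      have "p ((1 - u) * \<phi> s + u * \<psi> s, t) = a" if "s \<in> {0, 1}" "t \<in> {0..1}" for s t
      proof -
        have "(1 - u) * \<phi> s + u * \<psi> s = \<phi> s" "\<phi> s \<in> {0, 1}"
          using that ends by (auto simp: algebra_simps)
        then show ?thesis
          using b that by (auto simp: const_on_boundary_iff)
      qed
      then show "const_on_boundary a (\<lambda>x. ?h (u, x))"
        using b in01[OF u] by (auto simp: const_on_boundary_iff)
    qed
  qed
  then show ?thesis by (simp add: spheroid_homotopic_def)
qed

lemma mult_second_homotopy_group: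
  assumes "p \<in> spheroids X a" "q \<in> spheroids X a"
  shows "spheroid_homotopic X a `` {p} \<otimes>\<^bsub>second_homotopy_group X a\<^esub> spheroid_homotopic X a `` {q}
    = spheroid_homotopic X a `` {spheroid_concat p q}"
proof -
  note E = equiv_spheroid_homotopic[of X a]
  have "congruent2 (spheroid_homotopic X a) (spheroid_homotopic X a)
      (\<lambda>p q. spheroid_homotopic X a `` {spheroid_concat p q})"
    by (intro congruent2I' equiv_class_eq[OF E] spheroid_concat_homotopic)
  from UN_equiv_class2[OF E E this assms] show ?thesis
    by (simp add: second_homotopy_group_def)
qed

lemma group_second_homotopy_group:
  assumes a: "a \<in> topspace X"
  shows "group (second_homotopy_group X a)"
proof -
  let ?G = "second_homotopy_group X a"
  let ?R = "spheroid_homotopic X a"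
  let ?cl = "\<lambda>p. ?R `` {p}"
  note E = equiv_spheroid_homotopic[of X a]
  have car: "\<exists>p \<in> spheroids X a. A = ?cl p" if "A \<in> carrier ?G" for A
    using that by (auto simp: second_homotopy_group_def quotient_def)
  have cl: "?cl p \<in> carrier ?G" if "p \<in> spheroids X a" for p
    using that by (auto simp: second_homotopy_group_def quotient_def)
  have one: "\<one>\<^bsub>?G\<^esub> = ?cl (\<lambda>_. a)"
    by (simp add: second_homotopy_group_def)
  have const: "(\<lambda>_. a) \<in> spheroids X a"
    using a by (simp add: spheroids_def const_on_boundary_def)
  have bd: "p (0, t) = a" "p (1, t) = a" if "p \<in> spheroids X a" "0 \<le> t" "t \<le> 1" for p t
    using that by (auto simp: spheroids_def const_on_boundary_iff)
  show ?thesis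
  proof (rule groupI)
    show "A \<otimes>\<^bsub>?G\<^esub> B \<in> carrier ?G" if "A \<in> carrier ?G" "B \<in> carrier ?G" for A B
      using car[OF that(1)] car[OF that(2)] cl spheroid_concat_in
      by (metis mult_second_homotopy_group)
    show "\<one>\<^bsub>?G\<^esub> \<in> carrier ?G"
      using one cl const by simp
  next
    fix A B C assume "A \<in> carrier ?G" "B \<in> carrier ?G" "C \<in> carrier ?G"
    then obtain p q r where pqr: "p \<in> spheroids X a" "q \<in> spheroids X a" "r \<in> spheroids X a"
      and ABC: "A = ?cl p" "B = ?cl q" "C = ?cl r"
      by (metis car)
    have "(spheroid_concat (spheroid_concat p q) r, spheroid_concat p (spheroid_concat q r)) \<in> ?R"
    proof (rule spheroid_reparametrize)
      show "spheroid_concat p (spheroid_concat q r) \<in> spheroids X a"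
        by (intro spheroid_concat_in pqr)
      let ?\<phi> = "\<lambda>s::real. min (2 * s) (min (s + 1/4) (s / 2 + 1/2)) :: real"
      show "continuous_on {0..1} ?\<phi>" "continuous_on {0..1} (\<lambda>s::real. s)"
        by (auto intro!: continuous_intros)
      show "?\<phi> ` {0..1} \<subseteq> {0..1}" "(\<lambda>s::real. s) ` {0..1} \<subseteq> {0..1}"
        by auto
      show "spheroid_concat (spheroid_concat p q) r (s, t)
          = spheroid_concat p (spheroid_concat q r) (?\<phi> s, t)"
        if "s \<in> {0..1}" "t \<in> {0..1}" for s t :: real
      proof -
        consider "s \<le> 1/4" | "1/4 < s" "s \<le> 1/2" | "1/2 < s" by linarith
        then show ?thesis
        proof cases
          case 1
          then have "?\<phi> s = 2 * s" by auto
          then show ?thesis using 1 by (auto simp: spheroid_concat_def)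
        next
          case 2
          then have "?\<phi> s = s + 1/4" by auto
          then show ?thesis using 2 by (auto simp: spheroid_concat_def algebra_simps)
        next
          case 3
          then have "?\<phi> s = s / 2 + 1/2" by auto
          then show ?thesis using 3 by (auto simp: spheroid_concat_def algebra_simps)
        qed
      qed
    qed auto
    from equiv_class_eq[OF E this]
    show "A \<otimes>\<^bsub>?G\<^esub> B \<otimes>\<^bsub>?G\<^esub> C = A \<otimes>\<^bsub>?G\<^esub> (B \<otimes>\<^bsub>?G\<^esub> C)"
      unfolding ABC using pqr
      by (simp add: mult_second_homotopy_group spheroid_concat_in)
  next
    fix A assume "A \<in> carrier ?G"
    then obtain p where p: "p \<in> spheroids X a" "A = ?cl p"
      by (metis car)
    have "(spheroid_concat (\<lambda>_. a) p, p) \<in> ?R"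
    proof (rule spheroid_reparametrize[OF p(1)])
      let ?\<phi> = "\<lambda>s::real. max 0 (2 * s - 1) :: real"
      show "continuous_on {0..1} ?\<phi>" "continuous_on {0..1} (\<lambda>s::real. s)"
        by (auto intro!: continuous_intros)
      show "spheroid_concat (\<lambda>_. a) p (s, t) = p (?\<phi> s, t)"
        if "s \<in> {0..1}" "t \<in> {0..1}" for s t
      proof -
        have "p (2 * s - 1, t) = a" if "s = 1/2"
        proof -
          have "2 * s - 1 = 0" using that by simp
          then show ?thesis using bd(1)[OF p(1), of t] \<open>t \<in> {0..1}\<close> by simp
        qed
        then show ?thesis
          using that bd[OF p(1)] by (auto simp: spheroid_concat_def max_def not_le less_le)
      qed
    qed auto
    from equiv_class_eq[OF E this]
    show "\<one>\<^bsub>?G\<^esub> \<otimes>\<^bsub>?G\<^esub> A = A"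
      using p const one by (simp add: mult_second_homotopy_group)
    let ?q = "\<lambda>(s, t). p (1 - s, t)"
    have "continuous_map unit_square unit_square (\<lambda>x. (1 - fst x, snd x))"
      by (intro continuous_map_unit_square_into) (auto intro!: continuous_intros)
    then have "continuous_map unit_square X (p \<circ> (\<lambda>x. (1 - fst x, snd x)))"
      using p by (intro continuous_map_compose) (auto simp: spheroids_def)
    then have q: "?q \<in> spheroids X a"
      using p by (auto simp: spheroids_def o_def case_prod_unfold const_on_boundary_iff)
    have "(spheroid_concat ?q p, \<lambda>_. a) \<in> ?R"
    proof (rule spheroid_reparametrize[OF p(1)])
      let ?\<phi> = "\<lambda>s::real. \<bar>2 * s - 1\<bar> :: real"
      show "continuous_on {0..1} ?\<phi>" "continuous_on {0..1} (\<lambda>s::real. 1::real)"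
        by (auto intro!: continuous_intros)
      show "spheroid_concat ?q p (s, t) = p (?\<phi> s, t)"
        if "s \<in> {0..1}" "t \<in> {0..1}" for s t
      proof (cases "s \<le> 1/2")
        case True
        then have "\<bar>2 * s - 1\<bar> = 1 - 2 * s" by simp
        then show ?thesis using True by (simp add: spheroid_concat_def)
      qed (simp add: spheroid_concat_def)
    qed (auto simp: bd[OF p(1)])
    from equiv_class_eq[OF E this]
    have "?cl ?q \<otimes>\<^bsub>?G\<^esub> A = \<one>\<^bsub>?G\<^esub>"
      using p q one by (simp add: mult_second_homotopy_group)
    then show "\<exists>B\<in>carrier ?G. B \<otimes>\<^bsub>?G\<^esub> A = \<one>\<^bsub>?G\<^esub>"
      using cl[OF q] by blast
  qed
qed

section \<open>Grassmannians and configurations of subspaces\<close>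

definition grassmannian :: "nat \<Rightarrow> (complex ^ 'n) set set"
  where "grassmannian k = {V. vec.subspace V \<and> vec.dim V = k}"

text \<open>A \<open>k\<close>-frame is a linearly independent \<open>k\<close>-tuple, indexed by \<open>{..<k}\<close>.  The Grassmannian
  carries the quotient topology with respect to taking the span of a frame.\<close>

definition frames :: "nat \<Rightarrow> (nat \<Rightarrow> complex ^ 'n) set"
  where "frames k = {f \<in> {..<k} \<rightarrow>\<^sub>E UNIV. inj_on f {..<k} \<and> vec.independent (f ` {..<k})}"

definition frame_topology :: "nat \<Rightarrow> (nat \<Rightarrow> complex ^ 'n) topology"
  where "frame_topology k = subtopology (product_topology (\<lambda>_. euclidean) {..<k}) (frames k)"

definition grassmannian_topology :: "nat \<Rightarrow> (complex ^ 'n) set topology"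
  where "grassmannian_topology k = topology (\<lambda>U. U \<subseteq> grassmannian k \<and>
    openin (frame_topology k) {f \<in> frames k. vec.span (f ` {..<k}) \<in> U})"

text \<open>In the following definition, \<open>\<Sum>j<h. H j\<close> is the pointwise sum of sets of vectors.\<close>

definition subspace_configurations :: "nat \<Rightarrow> nat \<Rightarrow> nat \<Rightarrow> (nat \<Rightarrow> (complex ^ 'n) set) topology"
  where "subspace_configurations h i k =
    subtopology (product_topology (\<lambda>_. grassmannian_topology k) {..<h})
      {H. inj_on H {..<h} \<and> vec.dim (\<Sum>j<h. H j) = i}"

lemma topspace_frame_topology: "topspace (frame_topology k) = frames k"
  by (auto simp: frame_topology_def frames_def)

lemma openin_grassmannian_topology:
  fixes U :: "(complex ^ 'n) set set"
  shows "openin (grassmannian_topology k) U \<longleftrightarrow> U \<subseteq> grassmannian k \<and>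
    openin (frame_topology k) {f \<in> frames k. vec.span (f ` {..<k}) \<in> U}"
proof -
  let ?pre = "\<lambda>U :: (complex ^ 'n) set set. {f \<in> frames k. vec.span (f ` {..<k}) \<in> U}"
  have "istopology (\<lambda>U. U \<subseteq> grassmannian k \<and> openin (frame_topology k) (?pre U))"
    unfolding istopology_def
  proof (intro conjI allI impI)
    fix S T :: "(complex ^ 'n) set set"
    assume S: "S \<subseteq> grassmannian k \<and> openin (frame_topology k) (?pre S)"
      and T: "T \<subseteq> grassmannian k \<and> openin (frame_topology k) (?pre T)"
    have "?pre (S \<inter> T) = ?pre S \<inter> ?pre T" by auto
    then show "openin (frame_topology k) (?pre (S \<inter> T))"
      using S T by (simp only: openin_Int)
    show "S \<inter> T \<subseteq> grassmannian k" using S by auto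
  next
    fix K :: "(complex ^ 'n) set set set"
    assume K: "\<forall>S\<in>K. S \<subseteq> grassmannian k \<and> openin (frame_topology k) (?pre S)"
    have "?pre (\<Union>K) = (\<Union>S\<in>K. ?pre S)" by auto
    then show "openin (frame_topology k) (?pre (\<Union>K))"
      using K by (metis (mono_tags, lifting) openin_Union image_iff)
    show "\<Union>K \<subseteq> grassmannian k" using K by auto
  qed
  then show ?thesis
    unfolding grassmannian_topology_def by (subst topology_inverse') (assumption, rule refl)
qed

lemma span_frame_in_grassmannian:
  assumes "f \<in> frames k"
  shows "vec.span (f ` {..<k}) \<in> grassmannian k"
proof -
  have "inj_on f {..<k}" "vec.independent (f ` {..<k})"
    using assms by (simp_all add: frames_def)
  then have "vec.dim (vec.span (f ` {..<k})) = k"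
    by (metis vec.dim_span_eq_card_independent card_image card_lessThan)
  then show ?thesis
    by (simp only: grassmannian_def vec.subspace_span mem_Collect_eq simp_thms)
qed

lemma grassmannian_eq_span_frames:
  "(\<lambda>f. vec.span (f ` {..<k})) ` frames k = (grassmannian k :: (complex ^ 'n) set set)"
proof
  show "(\<lambda>f. vec.span (f ` {..<k})) ` frames k \<subseteq> (grassmannian k :: (complex ^ 'n) set set)"
    using span_frame_in_grassmannian by blast
  show "(grassmannian k :: (complex ^ 'n) set set) \<subseteq> (\<lambda>f. vec.span (f ` {..<k})) ` frames k"
  proof
    fix V :: "(complex ^ 'n) set" assume V: "V \<in> grassmannian k"
    obtain B where B: "B \<subseteq> V" "vec.independent B" "V \<subseteq> vec.span B" "card B = vec.dim V"
      using vec.basis_exists by blast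
    then have fin: "finite B" and card: "card B = k"
      using V by (auto simp: grassmannian_def vec.finiteI_independent)
    then obtain f where f: "bij_betw f {..<k} B"
      by (metis ex_bij_betw_nat_finite atLeast0LessThan)
    let ?f = "restrict f {..<k}"
    have im: "?f ` {..<k} = B" using f by (auto simp: bij_betw_def)
    have "inj_on ?f {..<k}"
      using f by (simp add: bij_betw_def)
    then have "?f \<in> frames k"
      using B(2) unfolding frames_def im[symmetric] by simp
    moreover have "vec.span B = V"
      by (rule vec.span_subspace) (use B V in \<open>auto simp: grassmannian_def\<close>)
    ultimately show "V \<in> (\<lambda>f. vec.span (f ` {..<k})) ` frames k"
      using im by (intro image_eqI[of _ _ ?f]) auto
  qed
qed

lemma topspace_grassmannian_topology:
  "topspace (grassmannian_topology k) = (grassmannian k :: (complex ^ 'n) set set)"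
proof
  have "{f \<in> frames k. vec.span (f ` {..<k}) \<in> (grassmannian k :: (complex ^ 'n) set set)}
      = topspace (frame_topology k)"
    unfolding topspace_frame_topology using span_frame_in_grassmannian by blast
  then have "openin (grassmannian_topology k) (grassmannian k :: (complex ^ 'n) set set)"
    unfolding openin_grassmannian_topology by simp
  then show "(grassmannian k :: (complex ^ 'n) set set) \<subseteq> topspace (grassmannian_topology k)"
    by (rule openin_subset)
  show "topspace (grassmannian_topology k) \<subseteq> (grassmannian k :: (complex ^ 'n) set set)"
    using openin_topspace[of "grassmannian_topology k :: (complex ^ 'n) set topology"]
    unfolding openin_grassmannian_topology by (rule conjunct1)
qed

lemma quotient_map_span_frames:
  "quotient_map (frame_topology k) (grassmannian_topology k) (\<lambda>f. vec.span (f ` {..<k}))"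
  unfolding quotient_map_def topspace_frame_topology topspace_grassmannian_topology
    openin_grassmannian_topology grassmannian_eq_span_frames
  by blast

lemma topspace_subspace_configurations:
  "topspace (subspace_configurations h i k) =
    {H \<in> {..<h} \<rightarrow>\<^sub>E grassmannian k. inj_on H {..<h} \<and> vec.dim (\<Sum>j<h. H j) = i}"
  by (auto simp: subspace_configurations_def topspace_grassmannian_topology)

lemma sum_span_eq_span_Union:
  fixes B :: "nat \<Rightarrow> (complex ^ 'n) set"
  shows "(\<Sum>j<m. vec.span (B j)) = vec.span (\<Union>j<m. B j)"
proof (induction m)
  case 0
  then show ?case by (simp add: set_zero)
next
  case (Suc m)
  have "(\<Union>j<Suc m. B j) = (\<Union>j<m. B j) \<union> B m"
    by (auto simp: lessThan_Suc)
  then show ?case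
    using Suc by (auto simp: vec.span_Un set_plus_def)
qed

lemma subspace_configurations_nonempty:
  assumes "k > 0" "h * k \<le> CARD('n::finite)"
  shows "topspace (subspace_configurations h (h * k) k :: (nat \<Rightarrow> (complex ^ 'n) set) topology) \<noteq> {}"
proof -
  obtain e :: "nat \<Rightarrow> 'n" where e: "inj_on e {..<h * k}"
    using assms(2) card_le_inj[of "{..<h * k}" "UNIV :: 'n set"] by auto
  let ?b = "\<lambda>j. axis (e j) (1::complex)"
  have b: "inj_on ?b {..<h * k}"
    using e by (auto simp: inj_on_def axis_eq_axis)
  have ind: "vec.independent (?b ` S)" for S
    by (rule vec.independent_mono[OF independent_cart_basis]) (auto simp: cart_basis_def)
  let ?S = "\<lambda>i. {i * k..<i * k + k}"
  have sub: "?S i \<subseteq> {..<h * k}" if "i < h" for i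
  proof -
    have "(i + 1) * k \<le> h * k" using that by (intro mult_right_mono) auto
    then show ?thesis by auto
  qed
  have un: "(\<Union>i<h. ?S i) = {..<h * k}"
  proof
    show "(\<Union>i<h. ?S i) \<subseteq> {..<h * k}" using sub by blast
    show "{..<h * k} \<subseteq> (\<Union>i<h. ?S i)"
    proof
      fix j assume "j \<in> {..<h * k}"
      then have "j div k < h" by (simp add: less_mult_imp_div_less)
      moreover have "j \<in> ?S (j div k)"
        using assms(1) by (metis add_less_cancel_left atLeastLessThan_iff div_mod_decomp
            le_add1 mod_less_divisor)
      ultimately show "j \<in> (\<Union>i<h. ?S i)" by blast
    qed
  qed
  let ?H = "restrict (\<lambda>i. vec.span (?b ` ?S i)) {..<h}"
  have "?H \<in> {..<h} \<rightarrow>\<^sub>E grassmannian k"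
  proof -
    have "card (?b ` ?S i) = k" if "i < h" for i
      using card_image[OF inj_on_subset[OF b sub[OF that]]] by simp
    then show ?thesis
      by (auto simp: grassmannian_def vec.subspace_span vec.dim_eq_card_independent[OF ind])
  qed
  moreover have "vec.dim (\<Sum>j<h. ?H j) = h * k"
  proof -
    have "(\<Sum>j<h. ?H j) = (\<Sum>j<h. vec.span (?b ` ?S j))" by simp
    also have "\<dots> = vec.span (?b ` {..<h * k})"
      unfolding sum_span_eq_span_Union un[symmetric] image_UN ..
    finally show ?thesis
      using card_image[OF b] by (simp only: vec.dim_span_eq_card_independent[OF ind]) simp
  qed
  moreover have "inj_on ?H {..<h}"
  proof (rule inj_onI, rule ccontr)
    fix i j assume ij: "i \<in> {..<h}" "j \<in> {..<h}" "?H i = ?H j" "i \<noteq> j"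
    have disj: "i * k \<notin> ?S j"
    proof
      assume "i * k \<in> ?S j"
      then have "(i * k) div k = j"
        using assms(1) by (intro div_nat_eqI) (auto simp: mult.commute)
      then show False using ij assms(1) by simp
    qed
    have "?b (i * k) \<in> vec.span (?b ` ?S j)"
    proof -
      have "?b (i * k) \<in> vec.span (?b ` ?S i)"
        using assms(1) by (intro vec.span_base) auto
      then show ?thesis using ij by simp
    qed
    moreover have "?b (i * k) \<notin> ?b ` ?S j"
    proof
      assume "?b (i * k) \<in> ?b ` ?S j"
      then obtain l where l: "l \<in> ?S j" "?b (i * k) = ?b l" by blast
      moreover have "i * k \<in> {..<h * k}" "l \<in> {..<h * k}"
        using sub[of i] sub[of j] ij l assms(1) by auto
      ultimately have "i * k = l" using inj_onD[OF b] by metis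
      then show False using l disj by blast
    qed
    moreover have "vec.independent (insert (?b (i * k)) (?b ` ?S j))"
      using ind[of "insert (i * k) (?S j)"] by simp
    ultimately show False
      by (simp add: vec.independent_insert)
  qed
  ultimately have "?H \<in>
      topspace (subspace_configurations h (h * k) k :: (nat \<Rightarrow> (complex ^ 'n) set) topology)"
    by (simp add: topspace_subspace_configurations)
  then show ?thesis by blast
qed

end

theory Submission
  imports Defs
begin

text \<open>
  Fix a base point and a basis of \<open>\<complex>\<^sup>n\<close> adapted to it.  The configuration space is the orbit of the base
  point under \<open>GL\<^sub>n(\<complex>)\<close>, with stabilizer \<open>S\<close>.  Transport by products of projections lifts maps from
  cubes to \<open>SL\<^sub>n(\<complex>)\<close>, which gives the connecting map from \<open>\<pi>\<^sub>2\<close> to loops in \<open>S\<close>.  Up to homotopy \<open>S\<close> is a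
  product of general linear groups of blocks: the \<open>h\<close> blocks of the configuration and, if \<open>hk < n\<close>,
  one complementary block.  Every map from a loop or a square into a special linear group is
  nullhomotopic relative to the boundary (by induction on the size: the first column can be moved to a
  basis vector, since the image of a surface is negligible).  Hence \<open>\<pi>\<^sub>2\<close> is identified, by the degrees of
  the block determinants, with the integer vectors indexed by the blocks whose entries sum to zero,
  and the degree on the last block is redundant.
\<close>

section \<open>Continuity of matrix operations\<close>

text \<open>Determinants are normalized to 1 because \<open>SL\<close> has trivial first and second
  homotopy groups, whereas in \<open>GL\<close> a loop carries the degree of its determinant; the
  normalization is what forces the degrees of the blocks to sum to zero. Null-homotopies are needed
  for loops (to realize prescribed degrees) and for squares (to show that degree zero means
  trivial), so domains of dimension at most two suffice. A homotopy of spheroids has a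
  three-dimensional domain, but it only has to be lifted, not contracted. The bound two is what the
  contraction of a column allows: a straight homotopy to a basis vector is obstructed in real
  codimension three. Lifts have to be the identity on three sides of the square. This shapes the
  transport: it is the identity along every line on which the configuration stays at the base point.
  If \<open>hk < n\<close>, the stabilizer is block triangular rather than block diagonal; scaling
  its off-diagonal entries to zero removes the difference.\<close>

lemma continuous_on_matrix_mult [continuous_intros]:
  fixes f g :: "'a::topological_space \<Rightarrow> complex^'n^'n"
  assumes "continuous_on S f" "continuous_on S g"
  shows "continuous_on S (\<lambda>x. f x ** g x)"
  unfolding matrix_matrix_mult_def by (intro continuous_intros assms)

lemma continuous_on_matrix_vector_mult' [continuous_intros]:
  fixes f :: "'a::topological_space \<Rightarrow> complex^'n^'n"
  assumes "continuous_on S f" "continuous_on S g"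
  shows "continuous_on S (\<lambda>x. f x *v g x)"
  unfolding matrix_vector_mult_def by (intro continuous_intros assms)

lemma continuous_on_det [continuous_intros]:
  fixes f :: "'a::topological_space \<Rightarrow> complex^'n^'n"
  assumes "continuous_on S f"
  shows "continuous_on S (\<lambda>x. det (f x))"
  unfolding det_def by (intro continuous_intros assms)

text \<open>Cramer's formula, one column for each \<open>j\<close>: an explicit quotient of
  determinants, so that continuity of inversion follows from continuity of
  \<open>det\<close>.\<close>

definition minv :: "complex^'n^'n \<Rightarrow> complex^'n^'n"
  where "minv A = (\<chi> i j. det (\<chi> a b. if b = i then axis j 1 $ a else A $ a $ b) / det A)"

lemma matrix_minv_right:
  assumes "det A \<noteq> 0" shows "A ** minv A = mat 1"
proof -
  have "A *v (\<chi> i. minv A $ i $ j) = axis j 1" for j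
    using cramer[OF assms, of "\<chi> i. minv A $ i $ j" "axis j 1"] by (simp add: minv_def)
  then have "(A ** minv A) $ a $ j = mat 1 $ a $ j" for a j
    by (simp add: vec_eq_iff matrix_vector_mult_def matrix_matrix_mult_def axis_def mat_def)
  then show ?thesis by (simp add: vec_eq_iff)
qed

lemma matrix_minv_left: "det A \<noteq> 0 \<Longrightarrow> minv A ** A = mat 1"
  using matrix_minv_right matrix_left_right_inverse by blast

lemma matrix_minv_cancel:
  assumes "det A \<noteq> 0"
  shows "A ** (minv A ** B) = B" "minv A ** (A ** B) = B"
    "A *v (minv A *v v) = v" "minv A *v (A *v v) = v"
  by (simp_all add: matrix_mul_assoc matrix_vector_mul_assoc matrix_minv_left matrix_minv_right assms)

lemma det_minv: "det A \<noteq> 0 \<Longrightarrow> det (minv A) = inverse (det A)"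
  using matrix_minv_right[of A] by (metis det_I det_mul inverse_unique)

lemma minv_mat_1 [simp]: "minv (mat 1) = mat 1"
  using matrix_minv_left[of "mat 1"] by simp

lemma continuous_on_minv [continuous_intros]:
  fixes f :: "'a::topological_space \<Rightarrow> complex^'n^'n"
  assumes f: "continuous_on S f" and "\<And>x. x \<in> S \<Longrightarrow> det (f x) \<noteq> 0"
  shows "continuous_on S (\<lambda>x. minv (f x))"
proof -
  have "continuous_on S (\<lambda>x. if b = i then axis j 1 $ a else f x $ a $ b)" for a b i j
    using f by (cases "b = i") (auto intro: continuous_intros)
  then show ?thesis
    unfolding minv_def using assms by (intro continuous_intros) auto
qed

lemma det_nonzero_iff_inj: "det A \<noteq> 0 \<longleftrightarrow> (\<forall>v. A *v v = 0 \<longrightarrow> v = 0)"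
  for A :: "complex^'n^'n"
  by (metis invertible_det_nz invertible_left_inverse matrix_left_invertible_ker)

section \<open>Homotopies relative to a subset\<close>

abbreviation homotopic_rel ::
    "'a::topological_space set \<Rightarrow> 'b \<Rightarrow> 'a set \<Rightarrow> 'b::topological_space set \<Rightarrow> ('a \<Rightarrow> 'b) \<Rightarrow> ('a \<Rightarrow> 'b) \<Rightarrow> bool"
  where "homotopic_rel B e \<equiv> homotopic_with_canon (\<lambda>f. \<forall>x\<in>B. f x = e)"

lemma homotopic_relI:
  assumes "continuous_on ({0..1::real} \<times> K) H"
    and "\<And>u x. u \<in> {0..1} \<Longrightarrow> x \<in> K \<Longrightarrow> H (u, x) \<in> Z"
    and "\<And>x. x \<in> K \<Longrightarrow> H (0, x) = f x" "\<And>x. x \<in> K \<Longrightarrow> H (1, x) = g x"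
    and "\<And>u x. u \<in> {0..1} \<Longrightarrow> x \<in> B \<Longrightarrow> H (u, x) = e"
    and "B \<subseteq> K"
  shows "homotopic_rel B e K Z f g"
proof -
  have *: "prod_topology (top_of_set {0..1}) (top_of_set K) = top_of_set ({0..1::real} \<times> K)"
    by simp
  show ?thesis
    \<comment> \<open>The property in \<open>homotopic_with\<close> must depend only on the values
      on \<open>K\<close>; this is where \<open>B \<subseteq> K\<close> enters.\<close>
    apply (subst homotopic_with)
    subgoal using \<open>B \<subseteq> K\<close> by (metis subsetD topspace_euclidean_subtopology)
    unfolding * using assms by (intro exI[of _ H]) (auto simp: continuous_map_in_subtopology)
qed

lemma homotopic_relD:
  assumes "homotopic_rel B e K Z f g"
  shows "\<exists>H. continuous_on ({0..1::real} \<times> K) H \<and> (\<forall>u\<in>{0..1}. \<forall>x\<in>K. H (u, x) \<in> Z) \<and>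
    (\<forall>x. H (0, x) = f x) \<and> (\<forall>x. H (1, x) = g x) \<and> (\<forall>u\<in>{0..1}. \<forall>x\<in>B. H (u, x) = e)"
proof -
  obtain H where H: "continuous_map (prod_topology (top_of_set {0..1::real}) (top_of_set K)) (top_of_set Z) H"
    "\<forall>x. H (0, x) = f x" "\<forall>x. H (1, x) = g x" "\<forall>t\<in>{0..1}. \<forall>x\<in>B. H (t, x) = e"
    using assms unfolding homotopic_with_def by blast
  show ?thesis
    by (rule exI[of _ H]) (use H in \<open>auto simp: continuous_map_in_subtopology image_subset_iff\<close>)
qed

lemma homotopic_rel_segment:
  fixes f g :: "'a::topological_space \<Rightarrow> 'b::real_normed_vector"
  assumes "continuous_on K f" "continuous_on K g" "B \<subseteq> K"
    and "\<And>x. x \<in> B \<Longrightarrow> f x = e" "\<And>x. x \<in> B \<Longrightarrow> g x = e"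
    and "\<And>u x. u \<in> {0..1} \<Longrightarrow> x \<in> K \<Longrightarrow> (1 - u) *\<^sub>R f x + u *\<^sub>R g x \<in> Z"
  shows "homotopic_rel B e K Z f g"
proof (rule homotopic_relI)
  have "continuous_on ({0..1} \<times> K) (\<lambda>z. f (snd z))" "continuous_on ({0..1} \<times> K) (\<lambda>z. g (snd z))"
    by (auto intro!: continuous_on_compose2[OF assms(1)] continuous_on_compose2[OF assms(2)] continuous_intros)
  then show "continuous_on ({0..1} \<times> K) (\<lambda>(u, x). (1 - u) *\<^sub>R f x + u *\<^sub>R g x)"
    unfolding case_prod_unfold by (intro continuous_intros)
qed (use assms in \<open>auto simp: scaleR_left_distrib[symmetric]\<close>)

section \<open>Parallel transport\<close>

text \<open>Transport from parameter 0 to parameter u is the product of \<open>R s s'\<close> over a fine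
  subdivision of \<open>[0, u]\<close>.  The number of factors does not depend on u, so that no
  gluing of continuous functions is necessary.\<close>

lemma transport:
  fixes R :: "real \<Rightarrow> real \<Rightarrow> 'a::metric_space \<Rightarrow> complex^'n^'n"
  assumes K: "compact K"
    and cont: "continuous_on ({0..1} \<times> {0..1} \<times> K) (\<lambda>z. R (fst z) (fst (snd z)) (snd (snd z)))"
    and refl: "\<And>s x. s \<in> {0..1} \<Longrightarrow> x \<in> K \<Longrightarrow> R s s x = mat 1"
  obtains G where "continuous_on ({0..1::real} \<times> K) G"
    "\<And>u x. u \<in> {0..1} \<Longrightarrow> x \<in> K \<Longrightarrow> det (G (u, x)) \<noteq> 0"
    "\<And>x. x \<in> K \<Longrightarrow> G (0, x) = mat 1"
    "\<And>Q u x. u \<in> {0..1} \<Longrightarrow> x \<in> K \<Longrightarrow> Q 0 (mat 1) \<Longrightarrow>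
      (\<And>s s' g. s \<in> {0..1} \<Longrightarrow> s' \<in> {0..1} \<Longrightarrow> det (R s s' x) \<noteq> 0 \<Longrightarrow> Q s' g \<Longrightarrow> Q s (R s s' x ** g))
      \<Longrightarrow> Q u (G (u, x))"
proof -
  let ?D = "\<lambda>z. det (R (fst z) (fst (snd z)) (snd (snd z)))"
  \<comment> \<open>\<open>R s s x\<close> has determinant 1, so a variation of less than 1 keeps
    the determinant of \<open>R s s' x\<close> nonzero; compactness makes the required closeness of
    \<open>s\<close> and \<open>s'\<close> uniform in \<open>x\<close>.\<close>
  have "uniformly_continuous_on ({0..1} \<times> {0..1} \<times> K) ?D"
    by (intro compact_uniformly_continuous continuous_intros cont compact_Times compact_Icc K)
  then obtain d where "d > 0" and d: "\<And>z z'. z \<in> {0..1} \<times> {0..1} \<times> K \<Longrightarrow> z' \<in> {0..1} \<times> {0..1} \<times> K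
      \<Longrightarrow> dist z z' < d \<Longrightarrow> dist (?D z) (?D z') < 1"
    unfolding uniformly_continuous_on_def by (metis dist_commute zero_less_one)
  obtain N :: nat where "1 / d < real N" using reals_Archimedean2 by blast
  then have "N > 0" using \<open>d > 0\<close> by (auto intro!: gr0I simp: field_simps)
  with \<open>1 / d < real N\<close> have N: "N > 0" "1 / real N < d"
    using \<open>d > 0\<close> by (simp_all add: field_simps)
  have near: "det (R s s' x) \<noteq> 0" if "s \<in> {0..1}" "s' \<in> {0..1}" "x \<in> K" "\<bar>s - s'\<bar> < d" for s s' x
    using d[of "(s, s', x)" "(s', s', x)"] refl[of s' x] that
    by (auto simp: dist_Pair_Pair dist_real_def)
  \<comment> \<open>The \<open>q\<close>-th point of the subdivision of \<open>[0, u]\<close> into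
    \<open>N\<close> equal parts; consecutive points differ by at most \<open>1 / N\<close>.\<close>
  define p where "p q u = real q * u / real N" for q u
  have p01: "p q u \<in> {0..1}" if "q \<le> N" "u \<in> {0..1}" for q u
    using N that mult_mono[of "real q" "real N" u 1] by (auto simp: p_def)
  have pnear: "\<bar>p (Suc q) u - p q u\<bar> < d" if "u \<in> {0..1}" for q u
  proof -
    have "p (Suc q) u - p q u = u / real N" by (simp add: p_def distrib_right add_divide_distrib)
    moreover have "u / real N \<le> 1 / real N" using that N by (auto simp: divide_right_mono)
    ultimately show ?thesis using N that by simp
  qed
  define G where "G = rec_nat (\<lambda>z. mat 1)
    (\<lambda>q F z. R (p (Suc q) (fst z)) (p q (fst z)) (snd z :: 'a) ** F z)"
  have G0: "G 0 z = mat 1" and GS: "G (Suc q) z = R (p (Suc q) (fst z)) (p q (fst z)) (snd z) ** G q z" for q z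
    by (simp_all add: G_def)
  have contG: "continuous_on ({0..1} \<times> K) (G q)" if "q \<le> N" for q
    using that
  proof (induction q)
    case 0
    then show ?case by (simp add: G_def)
  next
    case (Suc q)
    have pc: "continuous_on ({0..1} \<times> K) (\<lambda>z. p q (fst z))" for q
      using N unfolding p_def by (intro continuous_intros) auto
    have c: "continuous_on ({0..1} \<times> K) (\<lambda>z. (p (Suc q) (fst z), p q (fst z), snd z))"
      by (intro continuous_intros pc)
    have "(\<lambda>z. (p (Suc q) (fst z), p q (fst z), snd z)) ` ({0..1} \<times> K) \<subseteq> {0..1} \<times> {0..1} \<times> K"
      using Suc.prems p01[of "Suc q"] p01[of q] by auto
    from continuous_on_compose2[OF cont c this]
    have "continuous_on ({0..1} \<times> K) (\<lambda>z. R (p (Suc q) (fst z)) (p q (fst z)) (snd z))"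
      by (simp only: fst_conv snd_conv)
    then show ?case
      unfolding GS using Suc by (intro continuous_intros) auto
  qed
  \<comment> \<open>An induction principle for the product. Each invariant of the transport used
    later (invertibility, block support, intertwining of projections, constancy) is an instance of
    \<open>Q\<close>.\<close>
  have inv: "Q (p q u) (G q (u, x))"
    if "q \<le> N" "u \<in> {0..1}" "x \<in> K" "Q 0 (mat 1)" and
      step: "\<And>s s' g. s \<in> {0..1} \<Longrightarrow> s' \<in> {0..1} \<Longrightarrow> det (R s s' x) \<noteq> 0 \<Longrightarrow> Q s' g \<Longrightarrow> Q s (R s s' x ** g)"
    for q u x Q
    using that(1)
  proof (induction q)
    case 0
    then show ?case using that by (simp add: p_def G_def)
  next
    case (Suc q)
    then show ?case
      unfolding GS fst_conv snd_conv using p01 that pnear by (intro step near) auto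
  qed
  have inv': "Q u (G N (u, x))"
    if "u \<in> {0..1}" "x \<in> K" "Q 0 (mat 1)" and
      step: "\<And>s s' g. s \<in> {0..1} \<Longrightarrow> s' \<in> {0..1} \<Longrightarrow> det (R s s' x) \<noteq> 0 \<Longrightarrow> Q s' g \<Longrightarrow> Q s (R s s' x ** g)"
    for u x Q
    using inv[of N u x Q] that N by (simp add: p_def)
  show ?thesis
  proof (rule that[of "G N"])
    show "continuous_on ({0..1} \<times> K) (G N)" by (rule contG) simp
    show "det (G N (u, x)) \<noteq> 0" if "u \<in> {0..1}" "x \<in> K" for u x
      by (rule inv'[where Q = "\<lambda>_ g. det g \<noteq> 0"]) (use that in \<open>auto simp: det_mul\<close>)
    show "G N (0, x) = mat 1" if "x \<in> K" for x
    proof -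
      have "G q (0, x) = mat 1" if "q \<le> N" for q
        using that \<open>x \<in> K\<close> by (induction q) (simp_all add: G0 GS p_def refl)
      then show ?thesis by simp
    qed
  qed (rule inv')
qed

section \<open>Maps from surfaces into complex space minus the origin\<close>

text \<open>A smooth image of a surface in three-dimensional space is negligible, so a small translation
  moves it away from the origin.\<close>

lemma perturb_avoiding_zero:
  fixes f :: "'a::euclidean_space \<Rightarrow> real \<times> complex"
  assumes dim: "DIM('a) \<le> 2" and K: "compact K" and f: "continuous_on K f" and e: "e > 0"
  obtains q where "continuous_on K q" "\<And>x. x \<in> K \<Longrightarrow> norm (q x - f x) < e" "\<And>x. x \<in> K \<Longrightarrow> q x \<noteq> 0"
proof -
  \<comment> \<open>A merely continuous image of a surface may fill an open set, hence the
    polynomial. Half of \<open>e\<close> is spent on the approximation and half on the translation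
    \<open>w\<close>.\<close>
  obtain r where r: "polynomial_function r" "\<And>x. x \<in> K \<Longrightarrow> norm (f x - r x) < e / 2"
    using Stone_Weierstrass_polynomial_function[OF K f, of "e / 2"] e by auto
  have "negligible (r ` K)"
    by (rule negligible_differentiable_image_lowdim)
      (use dim r in \<open>auto simp: differentiable_on_polynomial_function\<close>)
  then have "\<not> ball 0 (e / 2) \<subseteq> r ` K"
    using e by (meson negligible_subset open_ball open_not_negligible ball_eq_empty not_less half_gt_zero)
  then obtain w where w: "norm w < e / 2" "w \<notin> r ` K"
    unfolding subset_iff mem_ball_0 by blast
  show ?thesis
  proof (rule that[of "\<lambda>x. r x - w"])
    show "continuous_on K (\<lambda>x. r x - w)"
      using r by (intro continuous_intros continuous_on_polymonial_function)
    show "norm (r x - w - f x) < e" if "x \<in> K" for x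
    proof -
      have "norm (r x - w - f x) \<le> norm (f x - r x) + norm w"
        using norm_triangle_ineq4[of "r x - f x" w] by (simp add: algebra_simps norm_minus_commute)
      then show ?thesis using r(2)[OF that] w by simp
    qed
    show "r x - w \<noteq> 0" if "x \<in> K" for x using w that by auto
  qed
qed

lemma norm_axis_eq: "norm (axis i z :: complex^'n) = norm z"
proof -
  have "(\<Sum>a\<in>UNIV. (norm ((axis i z :: complex^'n) $ a))\<^sup>2) = (\<Sum>a\<in>UNIV. if a = i then (norm z)\<^sup>2 else 0)"
    by (intro sum.cong) (auto simp: axis_def)
  then show ?thesis by (simp add: norm_vec_def L2_set_def)
qed

lemma continuous_on_axis [continuous_intros]:
  fixes f :: "'a::topological_space \<Rightarrow> complex"
  assumes "continuous_on S f" shows "continuous_on S (\<lambda>x. axis i (f x) :: complex^'n)"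
proof -
  have "continuous_on S (\<lambda>x. if a = i then f x else 0)" for a :: 'n
    using assms by (cases "a = i") auto
  then show ?thesis unfolding axis_def by (intro continuous_intros)
qed

text \<open>A segment from \<open>v\<close> to the basis vector at \<open>i\<close> meets the origin
  only if \<open>v $ j = 0\<close> and \<open>v $ i\<close> is a nonpositive real. The pair of
  \<open>Im (v $ i)\<close> and \<open>v $ j\<close> lives in real three-space, so on a domain of
  dimension at most two a small perturbation keeps it away from zero; afterwards the straight
  homotopy works.\<close>

lemma column_nullhomotopic:
  fixes c :: "'a::euclidean_space \<Rightarrow> complex^'n"
  defines "Z \<equiv> \<lambda>b. {v::complex^'n. v \<noteq> 0 \<and> (\<forall>a. a \<notin> b \<longrightarrow> v $ a = 0)}"
  assumes dim: "DIM('a) \<le> 2" and K: "compact K" and "B \<subseteq> K" and c: "continuous_on K c"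
    and cZ: "\<And>x. x \<in> K \<Longrightarrow> c x \<in> Z b" and cB: "\<And>x. x \<in> B \<Longrightarrow> c x = axis i 1"
    and ij: "i \<in> b" "j \<in> b" "i \<noteq> j"
  shows "homotopic_rel B (axis i 1) K (Z b) c (\<lambda>_. axis i 1)"
proof -
  have clo: "closed (c ` K)" by (intro compact_imp_closed compact_continuous_image c K)
  have nz: "0 \<notin> c ` K" using cZ unfolding Z_def by force
  obtain \<delta> where "\<delta> > 0" and "\<forall>y\<in>c ` K. \<delta> \<le> dist 0 y"
    using separate_point_closed[OF clo nz] by (elim exE conjE)
  then have \<delta>: "\<delta> \<le> norm (c x)" if "x \<in> K" for x using that by auto
  define f where "f x = (Im (c x $ i), c x $ j)" for x
  have "continuous_on K f"
    unfolding f_def by (intro continuous_intros c)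
  then obtain q where q: "continuous_on K q" "\<And>x. x \<in> K \<Longrightarrow> norm (q x - f x) < \<delta> / 2"
    "\<And>x. x \<in> K \<Longrightarrow> q x \<noteq> 0"
    using perturb_avoiding_zero[OF dim K, of f "\<delta> / 2"] \<open>\<delta> > 0\<close> by auto
  \<comment> \<open>The vector that replaces the three real coordinates in \<open>f\<close> by those
    of \<open>q\<close>.\<close>
  define w :: "'a \<Rightarrow> complex^'n" where "w x = axis i (\<i> * complex_of_real (fst (q x) - Im (c x $ i)))
    + axis j (snd (q x) - c x $ j)" for x
  \<comment> \<open>A cutoff: the perturbation is complete where the real part at \<open>i\<close>
    is nonpositive, the only place where the segment can fail, and absent where it is at least 1, in
    particular on \<open>B\<close>.\<close>
  define \<phi> where "\<phi> x = max 0 (min 1 (1 - Re (c x $ i)))" for x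
  define c' where "c' x = c x + \<phi> x *\<^sub>R w x" for x
  \<comment> \<open>Both components of \<open>q - f\<close> are bounded by its norm, which explains
    the tolerance \<open>\<delta> / 2\<close>. Being shorter than \<open>c x\<close>, the vector
    \<open>w x\<close> cannot cancel it.\<close>
  have wn: "norm (w x) < \<delta>" if "x \<in> K" for x
  proof -
    have "norm (w x) \<le> \<bar>fst (q x - f x)\<bar> + norm (snd (q x - f x))"
      unfolding w_def by (rule order_trans[OF norm_triangle_ineq])
        (simp add: norm_axis_eq f_def norm_mult del: of_real_diff)
    also have "\<dots> \<le> norm (q x - f x) + norm (q x - f x)"
      by (intro add_mono) (metis norm_fst_le real_norm_def surjective_pairing,
          metis norm_snd_le surjective_pairing)
    finally show ?thesis using q(2)[OF that] by simp
  qed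
  have cw: "continuous_on K w"
    unfolding w_def using q(1) c by (intro continuous_intros)
  have c\<phi>: "continuous_on K \<phi>" unfolding \<phi>_def by (intro continuous_intros c)
  have wb: "w x $ a = 0" if "a \<notin> b" for x a
    using that ij by (auto simp: w_def axis_def)
  have cb: "c x $ a = 0" if "a \<notin> b" "x \<in> K" for x a
    using cZ that by (auto simp: Z_def)
  have \<phi>01: "\<phi> x \<in> {0..1}" for x by (auto simp: \<phi>_def)
  have c'B: "c' x = axis i 1" if "x \<in> B" for x
    using cB[OF that] by (simp add: c'_def \<phi>_def)
  have "homotopic_rel B (axis i 1) K (Z b) c c'"
  proof (rule homotopic_rel_segment)
    show "continuous_on K c'" unfolding c'_def by (intro continuous_intros c cw c\<phi>)
    fix u x assume u: "u \<in> {0..1::real}" and x: "x \<in> K"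
    have eq: "(1 - u) *\<^sub>R c x + u *\<^sub>R c' x = c x + (u * \<phi> x) *\<^sub>R w x"
      by (simp add: c'_def algebra_simps)
    have "norm ((u * \<phi> x) *\<^sub>R w x) \<le> norm (w x)"
      using u \<phi>01[of x] mult_le_one[of u "\<phi> x"] by (auto simp: mult_left_le_one_le)
    then have "c x + (u * \<phi> x) *\<^sub>R w x \<noteq> 0"
      using wn[OF x] \<delta>[OF x] norm_minus_cancel[of "c x"] by (metis add_eq_0_iff leD order.strict_trans2 order.trans)
    then show "(1 - u) *\<^sub>R c x + u *\<^sub>R c' x \<in> Z b"
      unfolding eq using wb cb x by (auto simp: Z_def)
  qed (use c \<open>B \<subseteq> K\<close> cB c'B in auto)
  moreover have "homotopic_rel B (axis i 1) K (Z b) c' (\<lambda>_. axis i 1)"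
  proof (rule homotopic_rel_segment)
    show "continuous_on K c'" unfolding c'_def by (intro continuous_intros c cw c\<phi>)
    fix u x assume u: "u \<in> {0..1::real}" and x: "x \<in> K"
    let ?v = "(1 - u) *\<^sub>R c' x + u *\<^sub>R axis i (1::complex)"
    have "?v \<noteq> 0"
    proof
      assume v: "?v = 0"
      then have "?v $ i = 0" "?v $ j = 0" by simp_all
      then have vi: "(1 - u) *\<^sub>R (c' x $ i) + complex_of_real u = 0" and vj: "(1 - u) *\<^sub>R (c' x $ j) = 0"
        using ij unfolding vector_add_component vector_scaleR_component
        by (simp_all add: axis_def scaleR_conv_of_real)
      have "u \<noteq> 1" using v by (auto simp: axis_eq_0_iff)
      with u have u1: "u < 1" by simp
      have Ri: "(1 - u) * Re (c' x $ i) + u = 0" and Ii: "Im (c' x $ i) = 0"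
        using vi u1 by (auto simp: complex_eq_iff)
      have "Re (c' x $ i) \<le> 0"
        using Ri u1 u by (smt (verit) atLeastAtMost_iff mult_pos_pos)
      \<comment> \<open>The perturbation at \<open>i\<close> is purely imaginary, so it does not
        move the coordinate that controls the cutoff.\<close>
      moreover have "Re (c' x $ i) = Re (c x $ i)"
        using ij by (simp add: c'_def w_def axis_def)
      ultimately have "\<phi> x = 1" by (simp add: \<phi>_def)
      then have "Im (c' x $ i) = fst (q x)" "c' x $ j = snd (q x)"
        using ij by (auto simp: c'_def w_def axis_def)
      then show False using q(3)[OF x] Ii vj u1 by (auto simp: prod_eq_iff)
    qed
    then show "?v \<in> Z b"
      using wb cb x ij by (auto simp: Z_def c'_def axis_def)
  qed (use \<open>B \<subseteq> K\<close> c'B in auto)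
  ultimately show ?thesis by (rule homotopic_with_trans)
qed

section \<open>Special linear groups of coordinate blocks\<close>

text \<open>Matrices of smaller size are encoded as full matrices extended by the identity, so that
  an induction on the size of a block stays within one matrix type.\<close>

definition block_supported :: "'n set \<Rightarrow> complex^'n^'n \<Rightarrow> bool"
  where "block_supported b g \<longleftrightarrow> (\<forall>a c. a \<notin> b \<or> c \<notin> b \<longrightarrow> g $ a $ c = (if a = c then 1 else 0))"

definition block_SL :: "'n set \<Rightarrow> (complex^'n^'n) set"
  where "block_SL b = {g. det g = 1 \<and> block_supported b g}"

definition diag_at :: "'n \<Rightarrow> complex \<Rightarrow> complex^'n^'n"
  where "diag_at i z = (\<chi> a c. if a = c then if a = i then z else 1 else 0)"

text \<open>Scales the off-diagonal part that maps the complement of \<open>T\<close> into the span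
  of \<open>T\<close>. If the opposite part vanishes, this is a deformation of a block triangular
  matrix to its block diagonal part. With \<open>T = {i}\<close> it clears row \<open>i\<close>;
  with \<open>T\<close> the indices of the configuration it removes the unipotent part of a
  stabilizer element.\<close>

definition shrink :: "'n set \<Rightarrow> complex \<Rightarrow> complex^'n^'n \<Rightarrow> complex^'n^'n"
  where "shrink T u g = (\<chi> a c. if a \<in> T \<and> c \<notin> T then u * g $ a $ c else g $ a $ c)"

lemma block_supported_one [simp]: "block_supported b (mat 1)"
  by (simp add: block_supported_def mat_def)

lemma block_supported_mult:
  assumes "block_supported b g" "block_supported b g'"
  shows "block_supported b (g ** g')"
  unfolding block_supported_def
proof (intro allI impI)
  fix a c assume ac: "a \<notin> b \<or> c \<notin> b"
  show "(g ** g') $ a $ c = (if a = c then 1 else 0)"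
  proof (cases "a \<in> b")
    case False
    then have "g $ a $ d * g' $ d $ c = (if d = a then (if a = c then 1 else 0) else 0)" for d
      using assms by (auto simp: block_supported_def)
    then show ?thesis by (simp add: matrix_matrix_mult_def)
  next
    case True
    with ac have "g $ a $ d * g' $ d $ c = (if d = c then (if a = c then 1 else 0) else 0)" for d
      using assms by (auto simp: block_supported_def)
    then show ?thesis by (simp add: matrix_matrix_mult_def)
  qed
qed

lemma block_supported_mono: "block_supported b g \<Longrightarrow> b \<subseteq> b' \<Longrightarrow> block_supported b' g"
  unfolding block_supported_def by (meson subsetD)

lemma block_supportedD:
  "block_supported b g \<Longrightarrow> a \<notin> b \<or> c \<notin> b \<Longrightarrow> g $ a $ c = (if a = c then 1 else 0)"
  unfolding block_supported_def by blast

lemma det_diag_at [simp]: "det (diag_at i z) = z"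
  by (subst det_diagonal) (auto simp: diag_at_def)

lemma diag_at_one [simp]: "diag_at i 1 = mat 1"
  by (auto simp: diag_at_def mat_def vec_eq_iff)

lemma matrix_mult_diag_at: "(g ** diag_at i z) $ a $ c = (if c = i then g $ a $ c * z else g $ a $ c)"
proof -
  have "g $ a $ d * diag_at i z $ d $ c = (if d = c then (if c = i then g $ a $ c * z else g $ a $ c) else 0)" for d
    by (auto simp: diag_at_def)
  then show ?thesis by (simp add: matrix_matrix_mult_def)
qed

lemma diag_at_block_supported: "i \<in> b \<Longrightarrow> block_supported b (diag_at i z)"
  by (auto simp: block_supported_def diag_at_def)

lemma continuous_on_diag_at [continuous_intros]:
  assumes "continuous_on S f" shows "continuous_on S (\<lambda>x. diag_at i (f x))"
proof -
  have "continuous_on S (\<lambda>x. if a = c then if a = i then f x else 1 else 0)" for a c :: 'b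
    using assms by (cases "a = c"; cases "a = i") auto
  then show ?thesis unfolding diag_at_def by (intro continuous_intros)
qed

lemma continuous_on_shrink [continuous_intros]:
  assumes "continuous_on S u" "continuous_on S g"
  shows "continuous_on S (\<lambda>x. shrink T (u x) (g x))"
proof -
  have "continuous_on S (\<lambda>x. if a \<in> T \<and> c \<notin> T then u x * g x $ a $ c else g x $ a $ c)" for a c
    using assms by (cases "a \<in> T \<and> c \<notin> T") (auto intro!: continuous_intros)
  then show ?thesis unfolding shrink_def by (intro continuous_intros)
qed

lemma shrink_one [simp]: "shrink T 1 g = g" "shrink T u (mat 1) = mat 1"
  by (auto simp: shrink_def vec_eq_iff mat_def)

lemma block_supported_shrink:
  assumes "block_supported b g" shows "block_supported b (shrink T u g)"
  unfolding block_supported_def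
proof (intro allI impI)
  fix a c assume "a \<notin> b \<or> c \<notin> b"
  from block_supportedD[OF assms this]
  show "shrink T u g $ a $ c = (if a = c then 1 else 0)" by (auto simp: shrink_def)
qed

lemma block_supported_shrink_column:
  assumes "block_supported b g" and col: "\<And>a. g $ a $ i = (if a = i then 1 else 0)"
  shows "block_supported (b - {i}) (shrink {i} 0 g)"
  unfolding block_supported_def
proof (intro allI impI)
  fix a c assume "a \<notin> b - {i} \<or> c \<notin> b - {i}"
  then show "shrink {i} 0 g $ a $ c = (if a = c then 1 else 0)"
    using block_supportedD[OF assms(1), of a c] col[of a] by (auto simp: shrink_def)
qed

text \<open>A permutation that maps a point of T outside T maps some point outside T into T, so its
  term in the Leibniz formula vanishes.\<close>

lemma det_shrink:
  assumes "\<And>a c. a \<notin> T \<Longrightarrow> c \<in> T \<Longrightarrow> g $ a $ c = 0"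
  shows "det (shrink T u g) = det g"
  unfolding det_def
proof (rule sum.cong)
  fix p assume "p \<in> {p. p permutes (UNIV :: 'a set)}"
  then have p: "bij p" by (simp add: permutes_bij)
  have "(\<Prod>i\<in>UNIV. shrink T u g $ i $ p i) = (\<Prod>i\<in>UNIV. g $ i $ p i)"
  proof (cases "p ` T \<subseteq> T")
    case True
    then show ?thesis by (intro prod.cong) (auto simp: shrink_def)
  next
    case False
    have "\<not> T \<subseteq> p ` T"
    proof
      assume "T \<subseteq> p ` T"
      moreover have "card (p ` T) = card T"
        using p by (simp add: card_image bij_is_inj inj_on_subset[OF bij_is_inj])
      ultimately show False using False by (metis card_subset_eq finite_imageI finite order_refl)
    qed
    then obtain a where a: "p a \<in> T" "a \<notin> T"
      using p by (metis bij_pointE image_eqI subsetI)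
    then have "g $ a $ p a = 0" "shrink T u g $ a $ p a = 0"
      using assms by (auto simp: shrink_def)
    then have "(\<Prod>i\<in>UNIV. g $ i $ p i) = 0" "(\<Prod>i\<in>UNIV. shrink T u g $ i $ p i) = 0"
      by (auto intro!: prod_zero)
    then show ?thesis by (simp only:)
  qed
  then show "of_int (sign p) * (\<Prod>i\<in>UNIV. shrink T u g $ i $ p i) = of_int (sign p) * (\<Prod>i\<in>UNIV. g $ i $ p i)"
    by simp
qed simp

section \<open>Hermitian form and rank-one matrices\<close>

definition herm :: "complex^'n \<Rightarrow> complex^'n \<Rightarrow> complex"
  where "herm v w = (\<Sum>a\<in>UNIV. cnj (v $ a) * w $ a)"

lemma herm_self: "herm w w = complex_of_real ((norm w)\<^sup>2)"
proof -
  have "(norm w)\<^sup>2 = (\<Sum>d\<in>UNIV. (norm (w $ d))\<^sup>2)"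
    by (simp add: norm_vec_def L2_set_def sum_nonneg)
  then have "complex_of_real ((norm w)\<^sup>2) = (\<Sum>d\<in>UNIV. complex_of_real ((norm (w $ d))\<^sup>2))"
    by (simp only: of_real_sum)
  also have "\<dots> = herm w w"
    unfolding herm_def by (rule sum.cong[OF refl], subst complex_norm_square, rule mult.commute)
  finally show ?thesis by simp
qed

lemma rank_one_update_apply:
  fixes w p :: "complex^'n"
  assumes "w \<noteq> 0"
  shows "(\<chi> a d. p $ a * cnj (w $ d) / complex_of_real ((norm w)\<^sup>2)) *v w = p"
proof -
  have *: "(\<Sum>d\<in>UNIV. cnj (w $ d) * w $ d) = complex_of_real ((norm w)\<^sup>2)"
    using herm_self[of w] by (simp add: herm_def)
  have "(\<Sum>d\<in>UNIV. p $ a * cnj (w $ d) / complex_of_real ((norm w)\<^sup>2) * w $ d) = p $ a" for a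
  proof -
    have "(\<Sum>d\<in>UNIV. p $ a * cnj (w $ d) / complex_of_real ((norm w)\<^sup>2) * w $ d)
      = p $ a / complex_of_real ((norm w)\<^sup>2) * (\<Sum>d\<in>UNIV. cnj (w $ d) * w $ d)"
      by (simp add: sum_distrib_left mult_ac sum_divide_distrib)
    then show ?thesis using * assms by simp
  qed
  then show ?thesis by (simp add: matrix_vector_mult_def vec_eq_iff)
qed

lemma matrix_vector_mult_axis: "(A *v axis i 1) = (\<chi> a. A $ a $ i)" for A :: "complex^'n^'n"
  by (simp add: matrix_vector_mult_def axis_def vec_eq_iff if_distrib cong: if_cong)

lemma homotopic_rel_mono:
  assumes "homotopic_rel B e K Z f g" "Z \<subseteq> Z'" shows "homotopic_rel B e K Z' f g"
  using assms by (rule homotopic_with_subset_right)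

text \<open>The homotopy of column \<open>i\<close> to a basis vector is covered by a homotopy in
  the group, because transport along it multiplies by matrices that carry each intermediate column
  to the next. Once the column is the basis vector, row \<open>i\<close> can be scaled away, which
  leaves the smaller block \<open>b - {i}\<close>.\<close>

lemma block_SL_nullhomotopic:
  fixes g :: "'a::euclidean_space \<Rightarrow> complex^'n^'n"
  assumes dim: "DIM('a) \<le> 2" and K: "compact K" and BK: "B \<subseteq> K" and "continuous_on K g"
    and "\<And>x. x \<in> K \<Longrightarrow> g x \<in> block_SL b" and "\<And>x. x \<in> B \<Longrightarrow> g x = mat 1"
  shows "homotopic_rel B (mat 1) K (block_SL b) g (\<lambda>_. mat 1)"
  using assms(4-)
proof (induction "card b" arbitrary: b g rule: less_induct)
  case less
  note g = less.prems(1) and gb = less.prems(2) and gB = less.prems(3)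
  show ?case
  proof (cases "\<exists>i\<in>b. \<exists>j\<in>b. i \<noteq> j")
    \<comment> \<open>A block with at most one index admits only the identity with determinant
      1.\<close>
    case False
    have "g x = mat 1" if "x \<in> K" for x
    proof -
      have s: "block_supported b (g x)" and d: "det (g x) = 1"
        using gb[OF that] by (auto simp: block_SL_def)
      have off: "g x $ a $ c = 0" if "a \<noteq> c" for a c
        using block_supportedD[OF s, of a c] that False by auto
      show ?thesis
      proof (cases "b = {}")
        case True
        then show ?thesis using block_supportedD[OF s] by (auto simp: mat_def vec_eq_iff)
      next
        case nb: False
        then obtain i where i: "b = {i}" using False by blast
        have "det (g x) = (\<Prod>a\<in>UNIV. g x $ a $ a)" by (rule det_diagonal) (rule off)
        also have "\<dots> = (\<Prod>a\<in>UNIV. if a = i then g x $ i $ i else 1)"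
          using i by (intro prod.cong) (auto simp: block_supportedD[OF s])
        finally have "g x $ i $ i = 1" using d by simp
        then have "g x $ a $ c = mat 1 $ a $ c" for a c
          using off[of a c] block_supportedD[OF s, of a c] i by (cases "a = i") (auto simp: mat_def)
        then show ?thesis by (simp add: vec_eq_iff)
      qed
    qed
    then show ?thesis
      using g BK gb by (intro homotopic_with_equal) (auto simp: image_subset_iff)
  next
    case True
    then obtain i j where ij: "i \<in> b" "j \<in> b" "i \<noteq> j" by blast
    define Z where "Z = {v::complex^'n. v \<noteq> 0 \<and> (\<forall>a. a \<notin> b \<longrightarrow> v $ a = 0)}"
    define c where "c x = g x *v axis i 1" for x
    have cZ: "c x \<in> Z" if "x \<in> K" for x
    proof -
      have s: "block_supported b (g x)" and d: "det (g x) = 1"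
        using gb[OF that] by (auto simp: block_SL_def)
      have "c x \<noteq> 0"
        unfolding c_def using det_nonzero_iff_inj[of "g x"] d by (metis axis_eq_0_iff zero_neq_one)
      then show ?thesis
        using ij block_supportedD[OF s] unfolding Z_def c_def matrix_vector_mult_axis by auto
    qed
    have "homotopic_rel B (axis i 1) K Z c (\<lambda>_. axis i 1)"
      unfolding Z_def
    proof (rule column_nullhomotopic[OF dim K BK _ _ _ ij])
      show "continuous_on K c" unfolding c_def by (intro continuous_intros g)
      show "c x \<in> {v. v \<noteq> 0 \<and> (\<forall>a. a \<notin> b \<longrightarrow> v $ a = 0)}" if "x \<in> K" for x
        using cZ[OF that] by (simp add: Z_def)
    qed (simp add: c_def gB)
    from homotopic_relD[OF this] obtain C where C': "continuous_on ({0..1::real} \<times> K) C"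
      "\<forall>u\<in>{0..1}. \<forall>x\<in>K. C (u, x) \<in> Z" "\<forall>x. C (0, x) = c x" "\<forall>x. C (1, x) = axis i 1"
      "\<forall>u\<in>{0..1}. \<forall>x\<in>B. C (u, x) = axis i 1"
      by blast
    note C = C'[rule_format]
    \<comment> \<open>the matrix \<open>1 + (v - w) w\<^sup>* / |w|\<^sup>2\<close> maps \<open>w = C (s', x)\<close> to \<open>v = C (s, x)\<close>\<close>
    define R :: "real \<Rightarrow> real \<Rightarrow> 'a \<Rightarrow> complex^'n^'n" where "R s s' x = mat 1 + (\<chi> a d. (C (s, x) - C (s', x)) $ a * cnj (C (s', x) $ d)
      / complex_of_real ((norm (C (s', x)))\<^sup>2))" for s s' x
    have Rc: "R s s' x *v C (s', x) = C (s, x)" if "s' \<in> {0..1}" "x \<in> K" for s s' x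
      using C(2)[OF that] unfolding R_def matrix_vector_mult_add_rdistrib
      by (subst rank_one_update_apply) (auto simp: Z_def)
    have Rb: "block_supported b (R s s' x)" if "s \<in> {0..1}" "s' \<in> {0..1}" "x \<in> K" for s s' x
      using C(2)[OF that(1,3)] C(2)[OF that(2,3)]
      by (auto simp: R_def block_supported_def Z_def mat_def)
    have cR: "continuous_on ({0..1} \<times> {0..1} \<times> K) (\<lambda>z. R (fst z) (fst (snd z)) (snd (snd z)))"
    proof -
      have 1: "continuous_on ({0..1} \<times> {0..1} \<times> K) (\<lambda>z. C (fst z, snd (snd z)))"
        "continuous_on ({0..1} \<times> {0..1} \<times> K) (\<lambda>z. C (fst (snd z), snd (snd z)))"
        by (auto intro!: continuous_on_compose2[OF C(1)] continuous_intros)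
      have "C (u, x) \<noteq> 0" if "0 \<le> u" "u \<le> 1" "x \<in> K" for u x
        using C(2)[of u x] that by (auto simp: Z_def)
      then show ?thesis
        unfolding R_def by (intro continuous_intros 1) auto
    qed
    have RI: "R s s x = mat 1" for s x
      unfolding R_def by (simp add: vec_eq_iff)
    obtain G where G: "continuous_on ({0..1::real} \<times> K) G"
      "\<And>u x. u \<in> {0..1} \<Longrightarrow> x \<in> K \<Longrightarrow> det (G (u, x)) \<noteq> 0"
      "\<And>x. x \<in> K \<Longrightarrow> G (0, x) = mat 1"
      "\<And>Q u x. u \<in> {0..1} \<Longrightarrow> x \<in> K \<Longrightarrow> Q 0 (mat 1) \<Longrightarrow>
        (\<And>s s' g. s \<in> {0..1} \<Longrightarrow> s' \<in> {0..1} \<Longrightarrow> det (R s s' x) \<noteq> 0 \<Longrightarrow> Q s' g \<Longrightarrow> Q s (R s s' x ** g))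
        \<Longrightarrow> Q u (G (u, x))"
      using transport[OF K cR RI] by metis
    have Gb: "block_supported b (G (u, x))" if "u \<in> {0..1}" "x \<in> K" for u x
      by (rule G(4)[where Q = "\<lambda>_. block_supported b"]) (use that Rb in \<open>auto intro: block_supported_mult\<close>)
    have GB: "G (u, x) = mat 1" if "u \<in> {0..1}" "x \<in> B" for u x
    proof (rule G(4)[where Q = "\<lambda>_ g. g = mat 1"])
      fix s s' :: real and g :: "complex^'n^'n" assume "s \<in> {0..1}" "s' \<in> {0..1}" "g = mat 1"
      moreover have "R s s' x = mat 1"
        using calculation C(5)[OF _ that(2)] by (simp add: R_def) (simp add: vec_eq_iff)
      ultimately show "R s s' x ** g = mat 1" by simp
    qed (use that BK in auto)
    have Gc: "G (u, x) *v c x = C (u, x)" if "u \<in> {0..1}" "x \<in> K" for u x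
      by (rule G(4)[where Q = "\<lambda>s g. g *v c x = C (s, x)"])
        (use that Rc C(3) in \<open>auto simp flip: matrix_vector_mul_assoc\<close>)
    \<comment> \<open>The transport may have any nonzero determinant; it is compensated in column
      \<open>j\<close>, which leaves column \<open>i\<close> untouched.\<close>
    define H where "H z = G z ** g (snd z) ** diag_at j (1 / det (G z))" for z
    have H: "continuous_on ({0..1} \<times> K) H"
      unfolding H_def using G(1,2)
      by (intro continuous_intros continuous_on_compose2[OF g]) auto
    have Hb: "H (u, x) \<in> block_SL b" if "u \<in> {0..1}" "x \<in> K" for u x
      using gb[OF that(2)] G(2)[OF that] Gb[OF that] ij
      by (auto simp: H_def block_SL_def det_mul intro!: block_supported_mult diag_at_block_supported)
    have HB: "H (u, x) = mat 1" if "u \<in> {0..1}" "x \<in> B" for u x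
      using GB[OF that] gB that by (simp add: H_def)
    let ?g1 = "\<lambda>x. H (1, x)"
    have g1: "continuous_on K ?g1"
      by (intro continuous_on_compose2[OF H] continuous_intros) auto
    have hom1: "homotopic_rel B (mat 1) K (block_SL b) g ?g1"
      by (rule homotopic_relI[OF H Hb]) (use G(3) HB BK in \<open>auto simp: H_def\<close>)
    have col: "?g1 x $ a $ i = (if a = i then 1 else 0)" if "x \<in> K" for x a
    proof -
      have "(G (1, x) ** g x) *v axis i 1 = axis i 1"
        using Gc[of 1 x] that C(4) by (simp add: c_def matrix_vector_mul_assoc)
      then have "(G (1, x) ** g x) $ a $ i = axis i 1 $ a"
        by (metis matrix_vector_mult_axis vec_lambda_beta)
      then show ?thesis
        using ij by (simp add: H_def matrix_mult_diag_at axis_def)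
    qed
    let ?g2 = "\<lambda>x. shrink {i} 0 (?g1 x)"
    have dets: "det (shrink {i} u (?g1 x)) = 1" if "x \<in> K" for u x
      using Hb[of 1 x] that col[OF that] by (subst det_shrink) (auto simp: block_SL_def)
    have hom2: "homotopic_rel B (mat 1) K (block_SL b) ?g1 ?g2"
    proof (rule homotopic_relI[where H = "\<lambda>z. shrink {i} (complex_of_real (1 - fst z)) (?g1 (snd z))"])
      show "continuous_on ({0..1} \<times> K) (\<lambda>z. shrink {i} (complex_of_real (1 - fst z)) (?g1 (snd z)))"
        by (intro continuous_intros continuous_on_compose2[OF g1]) auto
      show "shrink {i} (complex_of_real (1 - fst (u, x))) (?g1 (snd (u, x))) \<in> block_SL b" if "x \<in> K" for u x
        using Hb[of 1 x] that dets[OF that] by (simp add: block_SL_def block_supported_shrink)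
    qed (use BK HB in auto)
    have "homotopic_rel B (mat 1) K (block_SL (b - {i})) ?g2 (\<lambda>_. mat 1)"
    proof (rule less.hyps)
      show "card (b - {i}) < card b" using ij by (intro psubset_card_mono) auto
      show "continuous_on K ?g2" by (intro continuous_intros g1)
      show "?g2 x \<in> block_SL (b - {i})" if "x \<in> K" for x
        using Hb[of 1 x] that dets[OF that, of 0] block_supported_shrink_column[OF _ col[OF that], of b]
        by (simp add: block_SL_def)
    qed (simp add: HB)
    then have "homotopic_rel B (mat 1) K (block_SL b) ?g2 (\<lambda>_. mat 1)"
      by (rule homotopic_rel_mono) (auto simp: block_SL_def intro: block_supported_mono)
    with hom1 hom2 show ?thesis by (meson homotopic_with_trans)
  qed
qed

section \<open>Orthogonal projections\<close>

definition adj :: "complex^'n^'n \<Rightarrow> complex^'n^'n"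
  where "adj A = (\<chi> a b. cnj (A $ b $ a))"

definition coord :: "'n set \<Rightarrow> (complex^'n) set"
  where "coord T = {v. \<forall>a. a \<notin> T \<longrightarrow> v $ a = 0}"

definition coord_proj :: "'n set \<Rightarrow> complex^'n^'n"
  where "coord_proj T = (\<chi> a b. if a = b \<and> a \<in> T then 1 else 0)"

text \<open>The columns of M outside T are zero; the added projection makes the Gram matrix invertible.  In
  this way frames of any length are handled by square matrices over the index type.\<close>

definition gram :: "'n set \<Rightarrow> complex^'n^'n \<Rightarrow> complex^'n^'n"
  where "gram T M = adj M ** M + coord_proj (- T)"

text \<open>The formula M (M^H M)^(-1) M^H for the orthogonal projection onto the column space,
  meant for \<open>M\<close> whose columns in \<open>T\<close> are independent and whose other
  columns vanish.\<close>

definition column_proj :: "'n set \<Rightarrow> complex^'n^'n \<Rightarrow> complex^'n^'n"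
  where "column_proj T M = M ** minv (gram T M) ** adj M"

lemma adj_mult: "adj (A ** B) = adj B ** adj A"
  by (simp add: adj_def matrix_matrix_mult_def vec_eq_iff mult.commute)

lemma adj_adj [simp]: "adj (adj A) = A"
  by (simp add: adj_def vec_eq_iff)

lemma adj_one [simp]: "adj (mat 1) = mat 1"
  by (simp add: adj_def vec_eq_iff mat_def)

lemma continuous_on_adj [continuous_intros]:
  "continuous_on S f \<Longrightarrow> continuous_on S (\<lambda>x. adj (f x))"
  unfolding adj_def by (intro continuous_intros)

lemma herm_adj: "herm v (adj A *v w) = herm (A *v v) w"
proof -
  have "herm v (adj A *v w) = (\<Sum>a\<in>UNIV. \<Sum>b\<in>UNIV. cnj (v $ a) * (cnj (A $ b $ a) * w $ b))"
    by (simp add: herm_def adj_def matrix_vector_mult_def sum_distrib_left)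
  also have "\<dots> = (\<Sum>b\<in>UNIV. \<Sum>a\<in>UNIV. cnj (v $ a) * (cnj (A $ b $ a) * w $ b))"
    by (rule sum.swap)
  also have "\<dots> = herm (A *v v) w"
    by (simp add: herm_def matrix_vector_mult_def sum_distrib_left sum_distrib_right mult_ac)
  finally show ?thesis .
qed

lemma coord_proj_apply: "(coord_proj T *v v) $ a = (if a \<in> T then v $ a else 0)"
proof -
  have "coord_proj T $ a $ b * v $ b = (if b = a then (if a \<in> T then v $ a else 0) else 0)" for b
    by (auto simp: coord_proj_def)
  then show ?thesis by (simp add: matrix_vector_mult_def)
qed

lemma matrix_mult_coord_proj: "(M ** coord_proj T) $ a $ c = (if c \<in> T then M $ a $ c else 0)"
proof -
  have "M $ a $ b * coord_proj T $ b $ c = (if b = c then (if c \<in> T then M $ a $ c else 0) else 0)" for b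
    by (auto simp: coord_proj_def)
  then show ?thesis by (simp add: matrix_matrix_mult_def)
qed

lemma matrix_add_sub_distribs:
  fixes A B C :: "complex^'n^'n"
  shows matrix_add_rdistrib': "(A + B) ** C = A ** C + B ** C"
    and matrix_sub_ldistrib': "A ** (B - C) = A ** B - A ** C"
    and matrix_sub_rdistrib': "(A - B) ** C = A ** C - B ** C"
  by (simp_all add: matrix_matrix_mult_def vec_eq_iff algebra_simps sum.distrib sum_subtractf)

lemma column_proj_properties:
  assumes col: "\<And>a c. c \<notin> T \<Longrightarrow> M $ a $ c = 0"
    and inj: "\<And>v. v \<in> coord T \<Longrightarrow> M *v v = 0 \<Longrightarrow> v = 0"
  shows det_gram_nonzero: "det (gram T M) \<noteq> 0"
    and column_proj_fixes: "column_proj T M ** M = M"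
    and column_proj_idem: "column_proj T M ** column_proj T M = column_proj T M"
    and adj_column_proj: "adj (column_proj T M) = column_proj T M"
    and range_column_proj: "{v. column_proj T M *v v = v} = range ((*v) M)"
proof -
  let ?N = "gram T M" and ?P = "column_proj T M"
  show det: "det ?N \<noteq> 0"
    unfolding det_nonzero_iff_inj
  proof (intro allI impI)
    fix v assume v: "?N *v v = 0"
    \<comment> \<open>Pairing \<open>?N *v v = 0\<close> with \<open>v\<close> gives |w|^2 + |r|^2 =
      0: the vector \<open>v\<close> is supported on \<open>T\<close> and killed by
      \<open>M\<close>.\<close>
    define w r where "w = M *v v" and "r = coord_proj (- T) *v v"
    have "herm v (adj M *v w) = herm w w"
      by (simp add: herm_adj w_def)
    moreover have "herm v r = herm r r"
      unfolding herm_def r_def coord_proj_apply by (rule sum.cong) auto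
    moreover have "herm v (?N *v v) = herm v (adj M *v w) + herm v r"
      unfolding gram_def w_def r_def
      by (simp add: herm_def matrix_vector_mult_add_rdistrib matrix_vector_mul_assoc distrib_left sum.distrib)
    ultimately have "herm w w + herm r r = 0"
      using v by (simp add: herm_def)
    then have "complex_of_real ((norm w)\<^sup>2 + (norm r)\<^sup>2) = 0"
      unfolding herm_self of_real_add .
    then have "(norm w)\<^sup>2 + (norm r)\<^sup>2 = 0" unfolding of_real_eq_0_iff .
    then have "w = 0" "r = 0" by (simp_all add: sum_power2_eq_zero_iff)
    have "v \<in> coord T"
      unfolding coord_def
    proof (intro CollectI allI impI)
      fix a assume "a \<notin> T"
      then have "v $ a = r $ a" by (simp add: r_def coord_proj_apply)
      then show "v $ a = 0" using \<open>r = 0\<close> by simp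
    qed
    then show "v = 0" using inj \<open>w = 0\<close> by (simp add: w_def)
  qed
  have ME: "M ** coord_proj (- T) = 0"
    using col by (simp add: vec_eq_iff matrix_mult_coord_proj)
  have "coord_proj (- T) ** coord_proj (- T) = coord_proj (- T)"
    by (auto simp: vec_eq_iff matrix_mult_coord_proj) (auto simp: coord_proj_def)
  then have "?N ** coord_proj (- T) = coord_proj (- T)"
    by (simp add: gram_def matrix_add_rdistrib' ME flip: matrix_mul_assoc)
  \<comment> \<open>The inverse fixes the added projection, and \<open>M\<close> kills it by
    \<open>ME\<close>, so the correction term disappears from \<open>column_proj\<close>.\<close>
  then have NE: "minv ?N ** coord_proj (- T) = coord_proj (- T)"
    by (metis det matrix_minv_cancel(2))
  have "?P ** M = M ** (minv ?N ** (adj M ** M))"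
    by (simp add: column_proj_def matrix_mul_assoc)
  also have "adj M ** M = ?N - coord_proj (- T)" by (simp add: gram_def)
  also have "M ** (minv ?N ** (?N - coord_proj (- T))) = M - M ** coord_proj (- T)"
    by (simp add: matrix_sub_ldistrib' NE matrix_minv_left det)
  finally show PM: "?P ** M = M" by (simp add: ME)
  then show "?P ** ?P = ?P"
    by (metis column_proj_def matrix_mul_assoc)
  have "adj (coord_proj (- T)) = coord_proj (- T)"
    by (auto simp: adj_def coord_proj_def vec_eq_iff)
  then have N: "adj ?N = ?N"
  proof -
    have "adj (A + B) = adj A + adj B" for A B :: "complex^'a^'a"
      by (simp add: adj_def vec_eq_iff)
    then show ?thesis
      using \<open>adj (coord_proj (- T)) = coord_proj (- T)\<close> by (simp add: gram_def adj_mult)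
  qed
  have "adj (minv ?N) ** ?N = mat 1"
    by (metis N adj_mult adj_one det matrix_minv_right)
  then have "adj (minv ?N) = minv ?N"
    by (metis det matrix_minv_right matrix_mul_assoc matrix_mul_lid matrix_mul_rid)
  then show "adj ?P = ?P"
    by (simp add: column_proj_def adj_mult matrix_mul_assoc)
  show "{v. ?P *v v = v} = range ((*v) M)"
  proof (intro equalityI subsetI)
    fix v assume "v \<in> {v. ?P *v v = v}"
    then have "v = M *v (minv ?N *v (adj M *v v))"
      by (simp add: column_proj_def matrix_vector_mul_assoc matrix_mul_assoc)
    then show "v \<in> range ((*v) M)" by blast
  next
    fix v assume "v \<in> range ((*v) M)"
    then show "v \<in> {v. ?P *v v = v}"
      by (auto simp: matrix_vector_mul_assoc PM)
  qed
qed

lemma continuous_on_column_proj: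
  fixes M :: "'a::topological_space \<Rightarrow> complex^'n^'n"
  assumes "continuous_on S M"
    and "\<And>x a c. x \<in> S \<Longrightarrow> c \<notin> T \<Longrightarrow> M x $ a $ c = 0"
    and "\<And>x v. x \<in> S \<Longrightarrow> v \<in> coord T \<Longrightarrow> M x *v v = 0 \<Longrightarrow> v = 0"
  shows "continuous_on S (\<lambda>x. column_proj T (M x))"
proof -
  have "det (gram T (M x)) \<noteq> 0" if "x \<in> S" for x
    using assms(2,3)[OF that] by (rule det_gram_nonzero)
  moreover have "continuous_on S (\<lambda>x. gram T (M x))"
    unfolding gram_def by (intro continuous_intros assms(1))
  ultimately show ?thesis
    unfolding column_proj_def by (intro continuous_intros assms(1)) auto
qed

definition is_orth_proj :: "(complex^'n) set \<Rightarrow> complex^'n^'n \<Rightarrow> bool"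
  where "is_orth_proj V P \<longleftrightarrow> P ** P = P \<and> adj P = P \<and> {v. P *v v = v} = V"

text \<open>Among all projections onto \<open>V\<close> the orthogonal one depends on
  \<open>V\<close> alone; this lets a formula in terms of frames descend to the quotient
  topology.\<close>

definition orth_proj :: "(complex^'n) set \<Rightarrow> complex^'n^'n"
  where "orth_proj V = (THE P. is_orth_proj V P)"

text \<open>Equal ranges give PQ = Q and QP = P; the adjoint of the first equation is QP =
  Q.\<close>

lemma is_orth_proj_unique:
  assumes "is_orth_proj V P" "is_orth_proj V Q" shows "P = Q"
proof -
  have "P ** Q = Q" if "is_orth_proj V P" "is_orth_proj V Q" for P Q
  proof -
    have "Q *v v \<in> V" for v
      using that(2) by (auto simp: is_orth_proj_def matrix_vector_mul_assoc)
    then have "P *v (Q *v v) = Q *v v" for v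
      using that(1) by (auto simp: is_orth_proj_def)
    then show ?thesis
      by (simp add: matrix_eq matrix_vector_mul_assoc)
  qed
  then have "P ** Q = Q" "Q ** P = P" using assms by blast+
  then show ?thesis
    using assms unfolding is_orth_proj_def by (metis adj_mult)
qed

lemma orth_proj_eq: "is_orth_proj V P \<Longrightarrow> orth_proj V = P"
  unfolding orth_proj_def by (blast intro: is_orth_proj_unique)

section \<open>Continuous maps into and out of the Grassmannian\<close>

text \<open>The index type carries no order, so a frame is written into the columns that an
  enumeration \<open>e\<close> selects; all other columns are zero.\<close>

definition frame_matrix :: "(nat \<Rightarrow> 'n) \<Rightarrow> nat \<Rightarrow> (nat \<Rightarrow> complex^'n) \<Rightarrow> complex^'n^'n"
  where "frame_matrix e k f = (\<Sum>i<k. \<chi> a c. if c = e i then f i $ a else 0)"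

lemma frame_matrix_apply: "frame_matrix e k f *v v = (\<Sum>i<k. v $ e i *s f i)"
proof -
  have "(\<Sum>c\<in>UNIV. (if c = e i then f i $ a else 0) * v $ c) = v $ e i * f i $ a" for i a
    by (simp add: if_distrib[where f = "\<lambda>x. x * _"] cong: if_cong)
  then have *: "(\<chi> a c. if c = e i then f i $ a else 0) *v v = v $ e i *s f i" for i
    by (simp add: matrix_vector_mult_def vec_eq_iff)
  have "(\<Sum>i\<in>I. B i) *v v = (\<Sum>i\<in>I. B i *v v)" if "finite I" for I :: "nat set" and B :: "nat \<Rightarrow> complex^'a^'a"
    using that by (induction I) (auto simp: matrix_vector_mult_add_rdistrib)
  then show ?thesis unfolding frame_matrix_def by (simp add: *)
qed

lemma frame_matrix_column:
  assumes "inj_on e {..<k}"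
  shows "c \<notin> e ` {..<k} \<Longrightarrow> frame_matrix e k f $ a $ c = 0"
    and "i < k \<Longrightarrow> frame_matrix e k f *v axis (e i) 1 = f i"
proof -
  show "frame_matrix e k f $ a $ c = 0" if "c \<notin> e ` {..<k}"
    using that by (auto simp: frame_matrix_def intro!: sum.neutral)
  assume "i < k"
  have "(\<Sum>j<k. axis (e i) 1 $ e j *s f j) = (\<Sum>j<k. if j = i then f i else 0)"
    using assms \<open>i < k\<close> by (intro sum.cong) (auto simp: axis_def inj_on_def)
  then show "frame_matrix e k f *v axis (e i) 1 = f i"
    using \<open>i < k\<close> by (simp add: frame_matrix_apply)
qed

lemma range_frame_matrix:
  assumes "inj_on e {..<k}"
  shows "range ((*v) (frame_matrix e k f)) = vec.span (f ` {..<k})"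
proof
  show "range ((*v) (frame_matrix e k f)) \<subseteq> vec.span (f ` {..<k})"
    unfolding frame_matrix_apply
    by (intro image_subsetI vec.span_sum vec.span_scale vec.span_base) auto
  show "vec.span (f ` {..<k}) \<subseteq> range ((*v) (frame_matrix e k f))"
  proof (rule vec.span_minimal)
    show "f ` {..<k} \<subseteq> range ((*v) (frame_matrix e k f))"
      using frame_matrix_column(2)[OF assms] by (metis (no_types, lifting) image_subset_iff lessThan_iff rangeI)
    show "vec.subspace (range ((*v) (frame_matrix e k f)))"
      by (intro vec.subspace_image vec.subspace_UNIV)
  qed
qed

lemma frame_matrix_inj:
  assumes e: "inj_on e {..<k}" and f: "f \<in> frames k" and v: "v \<in> coord (e ` {..<k})"
    and "frame_matrix e k f *v v = 0"
  shows "v = 0"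
proof -
  have inj: "inj_on f {..<k}" and ind: "vec.independent (f ` {..<k})"
    using f by (auto simp: frames_def)
  have "(\<Sum>w\<in>f ` {..<k}. v $ e (inv_into {..<k} f w) *s w) = (\<Sum>i<k. v $ e i *s f i)"
    by (subst sum.reindex[OF inj]) (simp add: inv_into_f_f[OF inj])
  also have "\<dots> = 0" using assms(4) by (simp add: frame_matrix_apply)
  finally have "v $ e (inv_into {..<k} f w) = 0" if "w \<in> f ` {..<k}" for w
    using vec.independentD[OF ind, of "f ` {..<k}" "\<lambda>w. v $ e (inv_into {..<k} f w)" w] that by auto
  then have "v $ e i = 0" if "i < k" for i
    using that inv_into_f_f[OF inj, of i] by force
  then have "v $ a = 0" for a
    using v by (cases "a \<in> e ` {..<k}") (auto simp: coord_def)
  then show ?thesis by (simp add: vec_eq_iff)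
qed

lemma is_orth_proj_frame:
  assumes e: "inj_on e {..<k}" and f: "f \<in> frames k"
  shows "is_orth_proj (vec.span (f ` {..<k})) (column_proj (e ` {..<k}) (frame_matrix e k f))"
proof -
  let ?T = "e ` {..<k}" and ?M = "frame_matrix e k f"
  have c: "\<And>a c. c \<notin> ?T \<Longrightarrow> ?M $ a $ c = 0" by (rule frame_matrix_column(1)[OF e])
  have i: "\<And>v. v \<in> coord ?T \<Longrightarrow> ?M *v v = 0 \<Longrightarrow> v = 0" by (rule frame_matrix_inj[OF e f])
  show ?thesis
    unfolding is_orth_proj_def range_frame_matrix[OF e, symmetric]
    using column_proj_idem[OF c i] adj_column_proj[OF c i] range_column_proj[OF c i] by blast
qed

lemma obtain_inj_nat:
  assumes "k \<le> CARD('n::finite)" obtains e :: "nat \<Rightarrow> 'n::finite" where "inj_on e {..<k}"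
  using assms card_le_inj[of "{..<k}" "UNIV :: 'n::finite set"] by auto

lemma is_orth_proj_grassmannian:
  assumes "V \<in> (grassmannian k :: (complex^'n) set set)"
  shows "is_orth_proj V (orth_proj V)"
proof -
  have "k \<le> CARD('n)"
    using assms dim_subset_UNIV_cart_gen[of V] by (simp add: grassmannian_def)
  then obtain e :: "nat \<Rightarrow> 'n" where e: "inj_on e {..<k}" by (rule obtain_inj_nat)
  obtain f where f: "f \<in> frames k" "V = vec.span (f ` {..<k})"
    using assms unfolding grassmannian_eq_span_frames[symmetric] by blast
  show ?thesis
    using is_orth_proj_frame[OF e f(1)] orth_proj_eq f(2) by metis
qed

text \<open>On frames the projection is \<open>column_proj\<close> of the frame matrix, a continuous
  expression; the universal property of the quotient map transfers this to subspaces. For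
  \<open>k\<close> above the dimension the Grassmannian is empty.\<close>

lemma continuous_map_orth_proj:
  "continuous_map (grassmannian_topology k :: (complex^'n) set topology) euclidean orth_proj"
proof (cases "k \<le> CARD('n)")
  case True
  then obtain e :: "nat \<Rightarrow> 'n" where e: "inj_on e {..<k}" by (rule obtain_inj_nat)
  let ?T = "e ` {..<k}"
  let ?S = "{M :: complex^'n^'n. (\<forall>a c. c \<notin> ?T \<longrightarrow> M $ a $ c = 0) \<and> (\<forall>v\<in>coord ?T. M *v v = 0 \<longrightarrow> v = 0)}"
  have "continuous_map (frame_topology k) euclidean (frame_matrix e k)"
    unfolding frame_matrix_def
  proof (intro continuous_map_sum)
    fix i assume "i \<in> {..<k}"
    then have "continuous_map (frame_topology k) euclidean (\<lambda>f. f i :: complex^'n)"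
      unfolding frame_topology_def
      by (intro continuous_map_from_subtopology) (rule continuous_map_product_projection)
    moreover have "continuous_on UNIV (\<lambda>w :: complex^'n. \<chi> a c. if c = e i then w $ a else 0)"
    proof -
      have "continuous_on UNIV (\<lambda>w :: complex^'n. if c = e i then w $ a else 0)" for a c
        by (cases "c = e i") (auto intro: continuous_intros)
      then show ?thesis by (intro continuous_intros)
    qed
    ultimately have "continuous_map (frame_topology k) euclidean
        ((\<lambda>w :: complex^'n. \<chi> a c. if c = e i then w $ a else 0) \<circ> (\<lambda>f. f i))"
      by (intro continuous_map_compose) auto
    then show "continuous_map (frame_topology k) euclidean (\<lambda>f :: nat \<Rightarrow> complex^'n. \<chi> a c. if c = e i then f i $ a else 0)"
      by (simp add: o_def)
  qed simp
  then have "continuous_map (frame_topology k) (top_of_set ?S) (frame_matrix e k)"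
    using frame_matrix_column(1)[OF e] frame_matrix_inj[OF e]
    by (auto simp: continuous_map_in_subtopology topspace_frame_topology)
  moreover have "continuous_map (top_of_set ?S) euclidean (column_proj ?T)"
    unfolding continuous_map_iff_continuous
    by (rule continuous_on_column_proj[where M = "\<lambda>M. M"]) (blast intro: continuous_on_id)+
  ultimately have c: "continuous_map (frame_topology k) euclidean (column_proj ?T \<circ> frame_matrix e k)"
    by (rule continuous_map_compose)
  have "continuous_map (frame_topology k) euclidean
      (orth_proj \<circ> (\<lambda>f :: nat \<Rightarrow> complex^'n. vec.span (f ` {..<k})))"
    by (rule continuous_map_eq[OF c])
      (auto simp: topspace_frame_topology orth_proj_eq[OF is_orth_proj_frame[OF e]])
  then show ?thesis
    using continuous_compose_quotient_map[OF quotient_map_span_frames] by blast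
next
  case False
  have "grassmannian k = ({} :: (complex^'n) set set)"
  proof -
    have "V \<notin> grassmannian k" for V :: "(complex^'n) set"
      using False dim_subset_UNIV_cart_gen[of V] by (auto simp: grassmannian_def)
    then show ?thesis by blast
  qed
  then show ?thesis
    by (simp add: continuous_map_def topspace_grassmannian_topology)
qed

lemma continuous_map_span_frame:
  fixes f :: "'a::topological_space \<Rightarrow> nat \<Rightarrow> complex^'n"
  assumes "\<And>i. i < k \<Longrightarrow> continuous_on S (\<lambda>x. f x i)" and "\<And>x. x \<in> S \<Longrightarrow> restrict (f x) {..<k} \<in> frames k"
  shows "continuous_map (top_of_set S) (grassmannian_topology k) (\<lambda>x. vec.span (f x ` {..<k}))"
proof -
  have "continuous_map (top_of_set S) (frame_topology k) (\<lambda>x. restrict (f x) {..<k})"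
    unfolding frame_topology_def continuous_map_in_subtopology continuous_map_componentwise
    using assms by (auto simp: continuous_map_iff_continuous cong: continuous_on_cong)
  from continuous_map_compose[OF this quotient_imp_continuous_map[OF quotient_map_span_frames]]
  show ?thesis by (simp add: o_def)
qed

section \<open>Transport along families of projections\<close>

text \<open>The matrix PP' + (1-P)(1-P') intertwines P' with P and is the identity if P = P'. Its
  transport therefore carries the range of \<open>P (0, x)\<close> to that of
  \<open>P (u, x)\<close>. The last property later keeps lifts trivial on the sides of a
  square.\<close>

lemma transport_projections:
  fixes P :: "real \<times> 'a::metric_space \<Rightarrow> complex^'n^'n"
  assumes K: "compact K" and P: "continuous_on ({0..1} \<times> K) P"
    and idem: "\<And>z. z \<in> {0..1} \<times> K \<Longrightarrow> P z ** P z = P z"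
  obtains G where "continuous_on ({0..1::real} \<times> K) G"
    "\<And>u x. u \<in> {0..1} \<Longrightarrow> x \<in> K \<Longrightarrow> det (G (u, x)) \<noteq> 0"
    "\<And>x. x \<in> K \<Longrightarrow> G (0, x) = mat 1"
    "\<And>u x. u \<in> {0..1} \<Longrightarrow> x \<in> K \<Longrightarrow> P (u, x) ** G (u, x) = G (u, x) ** P (0, x)"
    "\<And>u x. u \<in> {0..1} \<Longrightarrow> x \<in> K \<Longrightarrow> (\<And>s. s \<in> {0..1} \<Longrightarrow> P (s, x) = P (0, x)) \<Longrightarrow> G (u, x) = mat 1"
proof -
  define R where "R s s' x = P (s, x) ** P (s', x) + (mat 1 - P (s, x)) ** (mat 1 - P (s', x))" for s s' x
  have cR: "continuous_on ({0..1} \<times> {0..1} \<times> K) (\<lambda>z. R (fst z) (fst (snd z)) (snd (snd z)))"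
    unfolding R_def by (intro continuous_intros continuous_on_compose2[OF P]) auto
  have RI: "R s s x = mat 1" if "s \<in> {0..1}" "x \<in> K" for s x
    using idem[of "(s, x)"] that by (simp add: R_def matrix_sub_ldistrib' matrix_sub_rdistrib')
  have PR: "P (s, x) ** R s s' x = R s s' x ** P (s', x)"
    if "s \<in> {0..1}" "s' \<in> {0..1}" "x \<in> K" for s s' x
  proof -
    have i: "P (s, x) ** P (s, x) = P (s, x)" "P (s', x) ** P (s', x) = P (s', x)"
      using idem that by auto
    have q: "P (s, x) ** (mat 1 - P (s, x)) = 0" "(mat 1 - P (s', x)) ** P (s', x) = 0"
      by (simp_all add: matrix_sub_ldistrib' matrix_sub_rdistrib' i)
    have z: "0 ** A = 0" "A ** 0 = 0" for A :: "complex^'n^'n"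
      by (simp_all add: matrix_matrix_mult_def vec_eq_iff)
    have "P (s, x) ** R s s' x = P (s, x) ** P (s', x)"
      by (simp add: R_def matrix_add_ldistrib matrix_mul_assoc i q z)
    moreover have "R s s' x ** P (s', x) = P (s, x) ** P (s', x)"
      by (simp add: R_def matrix_add_rdistrib' i q z flip: matrix_mul_assoc)
    ultimately show ?thesis by simp
  qed
  show ?thesis
  proof (rule transport[OF K cR RI])
    fix G :: "real \<times> 'a \<Rightarrow> complex^'n^'n"
    assume G: "continuous_on ({0..1::real} \<times> K) G"
      "\<And>u x. u \<in> {0..1} \<Longrightarrow> x \<in> K \<Longrightarrow> det (G (u, x)) \<noteq> 0"
      "\<And>x. x \<in> K \<Longrightarrow> G (0, x) = mat 1"
      "\<And>Q u x. u \<in> {0..1} \<Longrightarrow> x \<in> K \<Longrightarrow> Q 0 (mat 1) \<Longrightarrow>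
        (\<And>s s' g. s \<in> {0..1} \<Longrightarrow> s' \<in> {0..1} \<Longrightarrow> det (R s s' x) \<noteq> 0 \<Longrightarrow> Q s' g \<Longrightarrow> Q s (R s s' x ** g))
        \<Longrightarrow> Q u (G (u, x))"
    show ?thesis
    proof (rule that[OF G(1-3)])
      fix u x assume ux: "u \<in> {0..1::real}" "x \<in> K"
      show "P (u, x) ** G (u, x) = G (u, x) ** P (0, x)"
      proof (rule G(4)[where Q = "\<lambda>s g. P (s, x) ** g = g ** P (0, x)"])
        fix s s' :: real and g :: "complex^'n^'n"
        assume s: "s \<in> {0..1}" "s' \<in> {0..1}" and g: "P (s', x) ** g = g ** P (0, x)"
        have "P (s, x) ** (R s s' x ** g) = R s s' x ** (P (s', x) ** g)"
          using PR[OF s ux(2)] by (metis matrix_mul_assoc)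
        then show "P (s, x) ** (R s s' x ** g) = (R s s' x ** g) ** P (0, x)"
          using g by (simp add: matrix_mul_assoc)
      qed (use ux in auto)
      show "G (u, x) = mat 1" if const: "\<And>s. s \<in> {0..1} \<Longrightarrow> P (s, x) = P (0, x)"
      proof (rule G(4)[where Q = "\<lambda>s g. g = mat 1"])
        fix s s' :: real and g :: "complex^'n^'n"
        assume s: "s \<in> {0..1}" "s' \<in> {0..1}" and "g = mat 1"
        moreover have "R s s' x = R s s x"
          using const[OF s(1)] const[OF s(2)] by (simp add: R_def)
        ultimately show "R s s' x ** g = mat 1"
          using RI ux by simp
      qed (use ux in auto)
    qed
  qed
qed

section \<open>Coordinate subspaces\<close>

lemma matrix_vector_mult_cong:
  fixes B C :: "complex^'n^'n"
  assumes "\<And>a c. B $ a $ c * v $ c = C $ a $ c * v $ c"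
  shows "B *v v = C *v v"
  unfolding matrix_vector_mult_def assms ..

lemma coord_eq_span: "(coord T :: (complex^'n) set) = vec.span ((\<lambda>a. axis a 1) ` T)"
proof
  show "coord T \<subseteq> vec.span ((\<lambda>a. axis a 1) ` T)"
  proof
    fix v :: "complex^'n" assume v: "v \<in> coord T"
    have "v = (\<Sum>a\<in>UNIV. v $ a *s axis a 1)" by (simp add: basis_expansion)
    also have "\<dots> = (\<Sum>a\<in>T. v $ a *s axis a 1)"
      using v by (intro sum.mono_neutral_right) (auto simp: coord_def)
    also have "\<dots> \<in> vec.span ((\<lambda>a. axis a 1) ` T)"
      by (intro vec.span_sum vec.span_scale vec.span_base imageI)
    finally show "v \<in> vec.span ((\<lambda>a. axis a 1) ` T)" .
  qed
  show "vec.span ((\<lambda>a. axis a 1) ` T) \<subseteq> coord T"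
    by (rule vec.span_minimal) (auto simp: coord_def axis_def vec.subspace_def)
qed

lemma subspace_coord [simp]: "vec.subspace (coord T)"
  unfolding coord_eq_span by (rule vec.subspace_span)

lemma independent_axes: "vec.independent ((\<lambda>a. axis a (1::complex)) ` T)"
  by (rule vec.independent_mono[OF independent_cart_basis]) (auto simp: cart_basis_def)

lemma inj_axis: "inj_on (\<lambda>a. axis a (1::complex)) T"
  by (auto simp: inj_on_def axis_eq_axis)

lemma dim_coord: "vec.dim (coord T) = card T"
  unfolding coord_eq_span vec.dim_span_eq_card_independent[OF independent_axes]
  by (rule card_image[OF inj_axis])

lemma axis_in_coord [simp]: "axis a 1 \<in> coord T \<longleftrightarrow> a \<in> T"
  by (auto simp: coord_def axis_def)

lemma coord_inter: "v \<in> coord T \<Longrightarrow> v \<in> coord U \<Longrightarrow> T \<inter> U = {} \<Longrightarrow> v = 0"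
  by (auto simp: coord_def vec_eq_iff disjoint_iff)

lemma inj_matrix: "det g \<noteq> 0 \<Longrightarrow> inj ((*v) g)" for g :: "complex^'n^'n"
  by (metis inj_on_inverseI matrix_minv_cancel(4))

text \<open>A kernel vector with nonzero entry at \<open>c\<close> makes the coordinate
  \<open>c\<close> redundant, so the image already comes from \<open>T - {c}\<close> and is too
  small.\<close>

lemma dim_image_inj_on_coord:
  fixes M :: "complex^'n^'n"
  assumes "vec.dim ((*v) M ` coord T) \<ge> card T" "v \<in> coord T" "M *v v = 0"
  shows "v = 0"
proof (rule ccontr)
  assume "v \<noteq> 0"
  then obtain c where c: "v $ c \<noteq> 0" by (auto simp: vec_eq_iff)
  then have "c \<in> T" using assms(2) by (auto simp: coord_def)
  have "(*v) M ` coord T \<subseteq> (*v) M ` coord (T - {c})"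
  proof (rule image_subsetI)
    fix w assume w: "w \<in> coord T"
    let ?u = "w - (w $ c / v $ c) *s v"
    have "M *v w = M *v ?u" using assms(3) by (simp add: vec.diff vec.scale)
    moreover have "?u \<in> coord (T - {c})"
      using w assms(2) c unfolding coord_def by auto
    ultimately show "M *v w \<in> (*v) M ` coord (T - {c})" by blast
  qed
  then have "vec.dim ((*v) M ` coord T) \<le> vec.dim (coord (T - {c}))"
    by (rule order_trans[OF vec.dim_subset vec.dim_image_le[OF matrix_vector_mul_linear_gen]])
  also have "\<dots> < card T"
    using \<open>c \<in> T\<close> unfolding dim_coord by (intro psubset_card_mono) auto
  finally show False using assms(1) by simp
qed

lemma sum_sets_subset_subspace:
  fixes X :: "nat \<Rightarrow> (complex^'n) set"
  assumes "vec.subspace U" "\<And>j. j < n \<Longrightarrow> X j \<subseteq> U"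
  shows "(\<Sum>j<n. X j) \<subseteq> U"
  using assms(2)
proof (induction n)
  case 0
  then show ?case using vec.subspace_0[OF assms(1)] by (simp add: set_zero)
next
  case (Suc n)
  have "(\<Sum>j<n. X j) \<subseteq> U" by (rule Suc.IH) (use Suc.prems in auto)
  moreover have "X n \<subseteq> U" using Suc.prems by auto
  ultimately show ?case
    by (auto simp: set_plus_def intro!: vec.subspace_add[OF assms(1)])
qed

section \<open>The configuration space as a homogeneous space\<close>

text \<open>Block j is the set of indices of the basis vectors (columns of A) that span the j-th subspace of the
  base configuration.  If these subspaces do not span the whole space, \<open>m = h\<close> and block h
  spans a complement, which the stabilizer need not preserve.\<close>

locale flag_blocks =
  fixes h k m :: nat and A :: "complex^'n^'n" and blk :: "'n \<Rightarrow> nat"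
  assumes k: "k > 0" and detA: "det A \<noteq> 0" and blk_le: "\<And>a. blk a \<le> m"
    and hm: "h = m \<or> h = Suc m"
    and card_blk: "\<And>j. j < h \<Longrightarrow> card {a. blk a = j} = k"
    and blk_surj: "\<And>j. j \<le> m \<Longrightarrow> \<exists>a. blk a = j"
begin

abbreviation block :: "nat \<Rightarrow> 'n set" where "block j \<equiv> {a. blk a = j}"

definition T where "T = {a. blk a < h}"

abbreviation F where "F \<equiv> subspace_configurations h (h * k) k :: (nat \<Rightarrow> (complex^'n) set) topology"

text \<open>The orbit map written in the basis \<open>A\<close>: it applies the conjugate A g A^(-1)
  to the base configuration. With \<open>A\<close> on the left, the fibres are cosets of a
  stabilizer described by vanishing matrix entries, independently of \<open>A\<close>.\<close>

definition act :: "complex^'n^'n \<Rightarrow> nat \<Rightarrow> (complex^'n) set"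
  where "act g = (\<lambda>j\<in>{..<h}. (*v) (A ** g) ` coord (block j))"

definition stab :: "(complex^'n^'n) set"
  where "stab = {g. det g \<noteq> 0 \<and> (\<forall>a b. blk b < h \<longrightarrow> blk a \<noteq> blk b \<longrightarrow> g $ a $ b = 0)}"

lemma T_UN: "T = (\<Union>j<h. block j)" by (auto simp: T_def)

lemma card_T: "card T = h * k"
proof -
  have "card T = (\<Sum>j<h. card (block j))"
    unfolding T_UN by (rule card_UN_disjoint) auto
  then show ?thesis by (simp add: card_blk)
qed

lemma obtain_block_enum:
  assumes "j < h" obtains e where "bij_betw e {..<k} (block j)"
  using assms card_blk ex_bij_betw_nat_finite[of "block j"] by (auto simp: atLeast0LessThan)

lemma image_coord_span:
  assumes "bij_betw e {..<k} (block j)"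
  shows "(*v) M ` coord (block j) = vec.span ((\<lambda>i. M *v axis (e i) 1) ` {..<k})"
proof -
  have "(\<lambda>i. M *v axis (e i) 1) ` {..<k} = (*v) M ` ((\<lambda>a. axis a 1) ` block j)"
    unfolding bij_betw_imp_surj_on[OF assms, symmetric] by (simp only: image_image)
  then show ?thesis
    by (simp only: coord_eq_span vec.span_image)
qed

lemma frame_image_coord:
  assumes e: "bij_betw e {..<k} (block j)" and M: "det M \<noteq> 0"
  shows "(\<lambda>i\<in>{..<k}. M *v axis (e i) 1) \<in> frames k"
proof -
  let ?f = "\<lambda>i. M *v axis (e i) 1"
  have "inj_on ?f {..<k}"
  proof (rule inj_onI)
    fix i i' assume "i \<in> {..<k}" "i' \<in> {..<k}" "?f i = ?f i'"
    then have "axis (e i) (1::complex) = axis (e i') 1" using inj_matrix[OF M] by (auto dest: injD)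
    then have "e i = e i'" by (simp add: axis_eq_axis)
    then show "i = i'" using e \<open>i \<in> _\<close> \<open>i' \<in> _\<close> by (auto simp: bij_betw_def inj_on_def)
  qed
  moreover have "?f ` {..<k} = (*v) M ` ((\<lambda>a. axis a 1) ` block j)"
    unfolding bij_betw_imp_surj_on[OF e, symmetric] by (simp only: image_image)
  moreover have "vec.independent ((*v) M ` ((\<lambda>a. axis a 1) ` block j))"
    by (rule vec.linear_independent_injective_image[OF matrix_vector_mul_linear_gen independent_axes])
      (use inj_matrix[OF M] in \<open>auto intro: inj_on_subset\<close>)
  ultimately show ?thesis
    by (simp add: frames_def)
qed

lemma act_in_topspace:
  assumes "det g \<noteq> 0"
  shows "inj_on (act g) {..<h}" "vec.dim (\<Sum>j<h. act g j) = h * k"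
proof -
  let ?M = "A ** g"
  have M: "det ?M \<noteq> 0" using assms detA by (simp add: det_mul)
  show "inj_on (act g) {..<h}"
  proof (rule inj_onI)
    fix i j assume ij: "i \<in> {..<h}" "j \<in> {..<h}" "act g i = act g j"
    then have "coord (block i) = coord (block j)"
      by (simp add: act_def inj_image_eq_iff[OF inj_matrix[OF M]])
    moreover obtain a where "a \<in> block i" using blk_surj[of i] ij hm by auto
    ultimately have "a \<in> block j" by (metis axis_in_coord)
    then show "i = j" using \<open>a \<in> block i\<close> by auto
  qed
  have "(\<Sum>j<h. act g j) = (\<Sum>j<h. vec.span ((*v) ?M ` (\<lambda>a. axis a 1) ` block j))"
    by (intro sum.cong refl) (simp add: act_def coord_eq_span vec.span_image)
  also have "\<dots> = vec.span (\<Union>j<h. (*v) ?M ` (\<lambda>a. axis a 1) ` block j)"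
    by (rule sum_span_eq_span_Union)
  also have "(\<Union>j<h. (*v) ?M ` (\<lambda>a. axis a 1) ` block j) = (*v) ?M ` (\<lambda>a. axis a 1) ` T"
    by (simp only: image_UN T_UN)
  also have "vec.span ((*v) ?M ` (\<lambda>a. axis a 1) ` T) = (*v) ?M ` coord T"
    by (simp only: coord_eq_span vec.span_image)
  finally have "vec.dim (\<Sum>j<h. act g j) = vec.dim ((*v) ?M ` coord T)" by (simp only:)
  also have "\<dots> = vec.dim (coord T)"
    by (rule vec.dim_image_eq[OF matrix_vector_mul_linear_gen]) (use inj_matrix[OF M] in \<open>auto intro: inj_on_subset\<close>)
  finally show "vec.dim (\<Sum>j<h. act g j) = h * k" by (simp only: dim_coord card_T)
qed

lemma continuous_map_act: "continuous_map (top_of_set {g. det g \<noteq> 0}) F act"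
proof -
  have "continuous_map (top_of_set {g. det g \<noteq> 0}) (grassmannian_topology k) (\<lambda>g. act g j)"
    if "j < h" for j
  proof -
    obtain e where e: "bij_betw e {..<k} (block j)" using obtain_block_enum[OF \<open>j < h\<close>] .
    have "continuous_map (top_of_set {g. det g \<noteq> 0}) (grassmannian_topology k)
        (\<lambda>g. vec.span ((\<lambda>i. (A ** g) *v axis (e i) 1) ` {..<k}))"
    proof (rule continuous_map_span_frame)
      show "(\<lambda>i\<in>{..<k}. (A ** g) *v axis (e i) 1) \<in> frames k" if "g \<in> {g. det g \<noteq> 0}" for g
        by (rule frame_image_coord[OF e]) (use that detA in \<open>simp add: det_mul\<close>)
    qed (intro continuous_intros)
    then show ?thesis
      using that by (simp add: act_def image_coord_span[OF e])
  qed
  then show ?thesis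
    unfolding subspace_configurations_def continuous_map_in_subtopology continuous_map_componentwise
    using act_in_topspace by (auto simp: act_def[abs_def])
qed

lemma stab_coord_image:
  assumes s: "s \<in> stab" and "j < h"
  shows "(*v) s ` coord (block j) = coord (block j)"
proof (rule vec.subspace_dim_equal)
  have ds: "det s \<noteq> 0" using s by (simp add: stab_def)
  show "vec.subspace ((*v) s ` coord (block j))"
    by (intro vec.subspace_image subspace_coord)
  show "(*v) s ` coord (block j) \<subseteq> coord (block j)"
  proof (rule image_subsetI)
    fix v assume v: "v \<in> coord (block j)"
    have "s $ a $ b * v $ b = 0" if "blk a \<noteq> j" for a b
      using v s that \<open>j < h\<close> by (cases "blk b = j") (auto simp: coord_def stab_def)
    then have "(s *v v) $ a = 0" if "blk a \<noteq> j" for a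
      unfolding matrix_vector_mult_def vec_lambda_beta using that by (intro sum.neutral) blast
    then show "s *v v \<in> coord (block j)" by (simp add: coord_def)
  qed
  have "vec.dim ((*v) s ` coord (block j)) = vec.dim (coord (block j))"
    by (rule vec.dim_image_eq[OF matrix_vector_mul_linear_gen]) (use inj_matrix[OF ds] in \<open>auto intro: inj_on_subset\<close>)
  then show "vec.dim (coord (block j)) \<le> vec.dim ((*v) s ` coord (block j))" by simp
qed simp

lemma image_matrix_mult: "(*v) (B ** C) ` X = (*v) B ` (*v) C ` X" for B C :: "complex^'n^'n"
  by (simp add: image_image matrix_vector_mul_assoc)

lemma act_stab: "s \<in> stab \<Longrightarrow> act (g ** s) = act g"
  unfolding act_def by (rule restrict_ext) (simp only: matrix_mul_assoc image_matrix_mult stab_coord_image lessThan_iff)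

lemma stab_of_act_eq:
  assumes "det g \<noteq> 0" "det g' \<noteq> 0" "act g = act g'"
  shows "minv g ** g' \<in> stab"
proof -
  have "(minv g ** g') $ a $ b = 0" if "blk b < h" "blk a \<noteq> blk b" for a b
  proof -
    let ?M = "A ** g"
    have M: "det ?M \<noteq> 0" using assms detA by (simp add: det_mul)
    have "(A ** g') *v axis b 1 \<in> act g' (blk b)"
      using that unfolding act_def by (simp add: imageI)
    also have "act g' (blk b) = (*v) (A ** g) ` coord (block (blk b))"
      unfolding assms(3)[symmetric] using that by (simp add: act_def)
    finally obtain v where v: "v \<in> coord (block (blk b))" "(A ** g') *v axis b 1 = (A ** g) *v v"
      by blast
    then have "g' *v axis b 1 = g *v v"
      by (metis detA matrix_minv_cancel(4) matrix_vector_mul_assoc)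
    then have "(minv g ** g') *v axis b 1 = v"
      by (metis assms(1) matrix_minv_cancel(4) matrix_vector_mul_assoc)
    then have "(minv g ** g') $ a $ b = v $ a"
      by (metis matrix_vector_mult_axis vec_lambda_beta)
    then show ?thesis using v that by (auto simp: coord_def)
  qed
  then show ?thesis
    using assms by (simp add: stab_def det_mul det_minv)
qed

lemma one_in_stab [simp]: "mat 1 \<in> stab"
  unfolding stab_def mem_Collect_eq det_I by (auto simp: mat_def)

lemma stab_of_act_one: "det g \<noteq> 0 \<Longrightarrow> act g = act (mat 1) \<Longrightarrow> g \<in> stab"
  using stab_of_act_eq[of "mat 1" g] by simp

lemma stab_mult: "s \<in> stab \<Longrightarrow> t \<in> stab \<Longrightarrow> s ** t \<in> stab"
  using act_stab[of s "mat 1"] act_stab[of t s] by (intro stab_of_act_one) (auto simp: det_mul stab_def)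

lemma stab_minv: "s \<in> stab \<Longrightarrow> minv s \<in> stab"
  using stab_of_act_eq[of s "mat 1"] act_stab[of s "mat 1"] by (simp add: stab_def)

lemma block_supported_stab: "block_supported (block j) g \<Longrightarrow> det g \<noteq> 0 \<Longrightarrow> g \<in> stab"
proof -
  assume g: "block_supported (block j) g" "det g \<noteq> 0"
  have "g $ a $ b = 0" if "blk a \<noteq> blk b" for a b
    using block_supportedD[OF g(1), of a b] that by (auto split: if_splits)
  then show ?thesis using g(2) by (simp add: stab_def)
qed

lemma diag_at_stab: "z \<noteq> 0 \<Longrightarrow> diag_at r z \<in> stab"
  by (rule block_supported_stab[where j = "blk r"]) (simp_all add: diag_at_block_supported)

section \<open>Lifting to the special linear group\<close>

text \<open>Each subspace is transported by its own orthogonal projections. The transported bases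
  stay independent because the sum keeps dimension \<open>h * k\<close>; transport along the
  projections onto that sum completes them by a moving complement. With \<open>L\<close> an interval
  this lifts spheroids, with \<open>L\<close> a square it lifts their homotopies.\<close>

lemma lift_configuration:
  fixes P :: "real \<times> 'a::metric_space \<Rightarrow> nat \<Rightarrow> (complex^'n) set"
  assumes L: "compact L" and P: "continuous_map (top_of_set ({0..1} \<times> L)) F P"
    and P0: "\<And>x. x \<in> L \<Longrightarrow> P (0, x) = act (mat 1)"
  shows "\<exists>g. continuous_on ({0..1} \<times> L) g \<and> (\<forall>z\<in>{0..1} \<times> L. det (g z) = 1 \<and> act (g z) = P z)
    \<and> (\<forall>x\<in>L. g (0, x) = mat 1)
    \<and> (\<forall>x\<in>L. (\<forall>s\<in>{0..1}. P (s, x) = act (mat 1)) \<longrightarrow> (\<forall>s\<in>{0..1}. g (s, x) = mat 1))"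
proof -
  let ?D = "{0..1::real} \<times> L"
  have Ptop: "P z \<in> topspace F" if "z \<in> ?D" for z
    using continuous_map_funspace[OF P] that by auto
  then have PGr: "P z j \<in> grassmannian k" if "z \<in> ?D" "j < h" for z j
    using that by (auto simp: topspace_subspace_configurations)
  have Pdim: "vec.dim (\<Sum>j<h. P z j) = h * k" if "z \<in> ?D" for z
    using Ptop[OF that] by (auto simp: topspace_subspace_configurations)
  define p where "p j z = orth_proj (P z j)" for j z
  have p: "p j z ** p j z = p j z" "{v. p j z *v v = v} = P z j" if "z \<in> ?D" "j < h" for j z
    using is_orth_proj_grassmannian[OF PGr[OF that]] by (auto simp: p_def is_orth_proj_def)
  have cp: "continuous_on ?D (p j)" if "j < h" for j
  proof -
    have "continuous_map (product_topology (\<lambda>_. grassmannian_topology k) {..<h})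
        (grassmannian_topology k :: (complex^'n) set topology) (\<lambda>H. H j)"
      using that by (intro continuous_map_product_projection) auto
    then have "continuous_map F (grassmannian_topology k) (\<lambda>H. H j)"
      unfolding subspace_configurations_def by (rule continuous_map_from_subtopology)
    from continuous_map_compose[OF continuous_map_compose[OF P this] continuous_map_orth_proj]
    show ?thesis by (simp add: o_def p_def[abs_def])
  qed
  define transports :: "(real \<times> 'a \<Rightarrow> complex^'n^'n) \<Rightarrow> (real \<times> 'a \<Rightarrow> complex^'n^'n) \<Rightarrow> bool"
    where "transports \<pi> G \<longleftrightarrow> continuous_on ?D G \<and> (\<forall>u\<in>{0..1}. \<forall>x\<in>L. det (G (u, x)) \<noteq> 0)
      \<and> (\<forall>x\<in>L. G (0, x) = mat 1)
      \<and> (\<forall>u\<in>{0..1}. \<forall>x\<in>L. \<pi> (u, x) ** G (u, x) = G (u, x) ** \<pi> (0, x))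
      \<and> (\<forall>u\<in>{0..1}. \<forall>x\<in>L. (\<forall>s\<in>{0..1}. \<pi> (s, x) = \<pi> (0, x)) \<longrightarrow> G (u, x) = mat 1)" for \<pi> G
  have transports: "\<exists>G. transports \<pi> G"
    if "continuous_on ?D \<pi>" "\<And>z. z \<in> ?D \<Longrightarrow> \<pi> z ** \<pi> z = \<pi> z" for \<pi>
    by (rule transport_projections[OF L that]) (assumption, unfold transports_def, blast)
  have "\<forall>j\<in>{..<h}. \<exists>G. transports (p j) G"
    by (intro ballI transports cp p(1)) (simp_all only: lessThan_iff)
  from bchoice[OF this] obtain G where G': "\<forall>j\<in>{..<h}. transports (p j) (G j)" by blast
  have G: "continuous_on ?D (G j) \<and> (\<forall>u\<in>{0..1}. \<forall>x\<in>L. det (G j (u, x)) \<noteq> 0)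
      \<and> (\<forall>x\<in>L. G j (0, x) = mat 1)
      \<and> (\<forall>u\<in>{0..1}. \<forall>x\<in>L. p j (u, x) ** G j (u, x) = G j (u, x) ** p j (0, x))
      \<and> (\<forall>u\<in>{0..1}. \<forall>x\<in>L. (\<forall>s\<in>{0..1}. p j (s, x) = p j (0, x)) \<longrightarrow> G j (u, x) = mat 1)"
    if "j < h" for j
  proof -
    have "transports (p j) (G j)" using G' that by blast
    then show ?thesis unfolding transports_def .
  qed
  have fixed: "w \<in> {v. Q' *v v = v} \<longleftrightarrow> g *v w \<in> {v. Q *v v = v}"
    if "det g \<noteq> 0" "Q ** g = g ** Q'" for g Q Q' :: "complex^'n^'n" and w
  proof -
    have "Q *v (g *v w) = g *v (Q' *v w)" using that(2) by (simp add: matrix_vector_mul_assoc)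
    then show ?thesis by (simp add: inj_eq[OF inj_matrix[OF that(1)]])
  qed
  \<comment> \<open>Each basis vector of the configuration is moved by the transport of its own
    subspace.\<close>
  define M where "M z = (\<chi> a c. if blk c < h then (G (blk c) z ** A) $ a $ c else 0)" for z
  have cM: "continuous_on ?D M"
  proof -
    have "continuous_on ?D (\<lambda>z. if blk c < h then (G (blk c) z ** A) $ a $ c else 0)" for a c
      using G by (cases "blk c < h") (auto intro!: continuous_intros)
    then show ?thesis unfolding M_def by (intro continuous_intros)
  qed
  have Mcol: "M z $ a $ c = 0" if "c \<notin> T" for z a c
    using that by (simp add: M_def T_def)
  have Mblock: "M z *v v = G j z *v (A *v v)" if "v \<in> coord (block j)" "j < h" for z v j
  proof -
    have "M z $ a $ c * v $ c = (G j z ** A) $ a $ c * v $ c" for a c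
      using that by (cases "blk c = j") (auto simp: coord_def M_def)
    then show ?thesis
      unfolding matrix_vector_mul_assoc by (rule matrix_vector_mult_cong)
  qed
  have Mimage: "(*v) (M z) ` coord (block j) = P z j" if z: "z \<in> ?D" and j: "j < h" for z j
  proof -
    obtain s x where sx: "z = (s, x)" "s \<in> {0..1}" "x \<in> L" using z by auto
    have "(*v) A ` coord (block j) = P (0, x) j"
      using P0[OF sx(3)] j by (simp add: act_def)
    also have "\<dots> = {v. p j (0, x) *v v = v}" using p(2)[of "(0, x)" j] sx j by auto
    finally have "(*v) A ` coord (block j) = {v. p j (0, x) *v v = v}" .
    moreover have "(*v) (M z) ` coord (block j) = (*v) (G j z) ` (*v) A ` coord (block j)"
      unfolding image_image by (rule image_cong[OF refl Mblock[OF _ j]])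
    ultimately have "(*v) (M z) ` coord (block j) = (*v) (G j z) ` {v. p j (0, x) *v v = v}"
      by (simp only:)
    also have "\<dots> = {v. p j z *v v = v}"
    proof -
      have d: "det (G j z) \<noteq> 0" and c: "p j z ** G j z = G j z ** p j (0, x)" using G[OF j] sx by auto
      show ?thesis
      proof (intro equalityI subsetI)
        fix v assume "v \<in> (*v) (G j z) ` {v. p j (0, x) *v v = v}"
        then show "v \<in> {v. p j z *v v = v}" using fixed[OF d c] by blast
      next
        fix v assume "v \<in> {v. p j z *v v = v}"
        then have "G j z *v (minv (G j z) *v v) \<in> {v. p j z *v v = v}"
          by (simp only: matrix_minv_cancel(3)[OF d])
        then have "minv (G j z) *v v \<in> {v. p j (0, x) *v v = v}" using fixed[OF d c] by blast
        then show "v \<in> (*v) (G j z) ` {v. p j (0, x) *v v = v}"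
          by (rule image_eqI[rotated]) (simp add: matrix_minv_cancel(3)[OF d])
      qed
    qed
    finally show ?thesis using p(2)[OF z j] by simp
  qed
  \<comment> \<open>The image of \<open>coord T\<close> contains the sum of the subspaces, whose
    dimension is \<open>card T\<close>, so \<open>M z\<close> has no kernel there.\<close>
  have Minj: "v = 0" if z: "z \<in> ?D" and v: "v \<in> coord T" "M z *v v = 0" for z v
  proof (rule dim_image_inj_on_coord[OF _ v])
    have "coord (block j) \<subseteq> coord T" if "j < h" for j
      using that by (auto simp: coord_def T_def)
    then have "(\<Sum>j<h. P z j) \<subseteq> (*v) (M z) ` coord T"
      using Mimage[OF z] by (intro sum_sets_subset_subspace vec.subspace_image subspace_coord) (metis image_mono)
    then show "card T \<le> vec.dim ((*v) (M z) ` coord T)"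
      using vec.dim_subset Pdim[OF z] card_T by metis
  qed
  define q where "q z = column_proj T (M z)" for z
  have cq: "continuous_on ?D q"
    unfolding q_def by (rule continuous_on_column_proj[OF cM Mcol Minj])
  have q: "q z ** q z = q z" "{v. q z *v v = v} = range ((*v) (M z))" if "z \<in> ?D" for z
    unfolding q_def using column_proj_idem[OF Mcol Minj[OF that]] range_column_proj[OF Mcol Minj[OF that]]
    by blast+
  have "\<exists>E. transports q E" by (rule transports[OF cq q(1)])
  then obtain E where E: "continuous_on ?D E" "\<And>u x. u \<in> {0..1} \<Longrightarrow> x \<in> L \<Longrightarrow> det (E (u, x)) \<noteq> 0"
      "\<And>x. x \<in> L \<Longrightarrow> E (0, x) = mat 1"
      "\<And>u x. u \<in> {0..1} \<Longrightarrow> x \<in> L \<Longrightarrow> q (u, x) ** E (u, x) = E (u, x) ** q (0, x)"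
      "\<And>u x. u \<in> {0..1} \<Longrightarrow> x \<in> L \<Longrightarrow> (\<forall>s\<in>{0..1}. q (s, x) = q (0, x)) \<Longrightarrow> E (u, x) = mat 1"
    unfolding transports_def by blast
  \<comment> \<open>The moving basis: configuration vectors from \<open>M\<close>, complementary
    vectors carried along by \<open>E\<close>.\<close>
  define W where "W z = (\<chi> a c. if blk c < h then M z $ a $ c else (E z ** A) $ a $ c)" for z
  have cW: "continuous_on ?D W"
  proof -
    have "continuous_on ?D (\<lambda>z. if blk c < h then M z $ a $ c else (E z ** A) $ a $ c)" for a c
      using cM E(1) by (cases "blk c < h") (auto intro!: continuous_intros)
    then show ?thesis unfolding W_def by (intro continuous_intros)
  qed
  have WT: "W z *v v = M z *v v" if "v \<in> coord T" for z v
  proof -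
    have "W z $ a $ c * v $ c = M z $ a $ c * v $ c" for a c
      using that by (cases "blk c < h") (auto simp: coord_def W_def T_def)
    then show ?thesis by (rule matrix_vector_mult_cong)
  qed
  have WT': "W z *v v = E z *v (A *v v)" if "v \<in> coord (- T)" for z v
  proof -
    have "W z $ a $ c * v $ c = (E z ** A) $ a $ c * v $ c" for a c
      using that by (cases "blk c < h") (auto simp: coord_def W_def T_def)
    then show ?thesis
      unfolding matrix_vector_mul_assoc by (rule matrix_vector_mult_cong)
  qed
  have M0: "M (0, x) *v v = A *v v" if "x \<in> L" "v \<in> coord T" for x v
  proof -
    have "M (0, x) $ a $ c * v $ c = A $ a $ c * v $ c" for a c
      using that G[of "blk c"] by (cases "blk c < h") (auto simp: coord_def M_def T_def)
    then show ?thesis by (rule matrix_vector_mult_cong)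
  qed
  have split: "v = coord_proj T *v v + coord_proj (- T) *v v" "coord_proj T *v v \<in> coord T"
    "coord_proj (- T) *v v \<in> coord (- T)" for v
    by (simp_all add: vec_eq_iff coord_proj_apply coord_def)
  have Mproj: "M z *v v = M z *v (coord_proj T *v v)" for z v
  proof -
    have "M z ** coord_proj T = M z"
      by (simp add: vec_eq_iff matrix_mult_coord_proj Mcol)
    then show ?thesis by (simp add: matrix_vector_mul_assoc)
  qed
  \<comment> \<open>A linear relation would put a moved complementary vector into the range of
    \<open>q z\<close>. Pulled back by \<open>E\<close>, it would put a complementary vector of the
    initial basis \<open>A\<close> into the span of the other basis vectors.\<close>
  have detW: "det (W z) \<noteq> 0" if z: "z \<in> ?D" for z
    unfolding det_nonzero_iff_inj
  proof (intro allI impI)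
    fix v assume Wv: "W z *v v = 0"
    obtain s x where sx: "z = (s, x)" "s \<in> {0..1}" "x \<in> L" using z by auto
    define v1 v2 where "v1 = coord_proj T *v v" and "v2 = coord_proj (- T) *v v"
    have v: "v = v1 + v2" "v1 \<in> coord T" "v2 \<in> coord (- T)"
      unfolding v1_def v2_def by (rule split)+
    have "M z *v v1 + E z *v (A *v v2) = 0"
      using Wv WT[OF v(2)] WT'[OF v(3)] v(1) by (simp add: vec.add)
    then have "E z *v (A *v v2) = M z *v (- v1)"
      by (simp add: vec.neg add_eq_0_iff)
    then have "E z *v (A *v v2) \<in> {v. q z *v v = v}" unfolding q(2)[OF z] by blast
    then have "A *v v2 \<in> {v. q (0, x) *v v = v}"
      using fixed[of "E z" "q z" "q (0, x)" "A *v v2"] E(2,4) sx by blast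
    then have "A *v v2 \<in> range ((*v) (M (0, x)))"
      using q(2)[of "(0, x)"] sx by auto
    then obtain u where "A *v v2 = M (0, x) *v u" by blast
    then have "A *v v2 = A *v (coord_proj T *v u)"
      using Mproj[of "(0, x)" u] M0[OF sx(3) split(2)] by simp
    then have "v2 = coord_proj T *v u"
      using inj_matrix[OF detA] by (auto dest: injD)
    then have "v2 = 0"
      using v(3) split(2)[of u] coord_inter[of v2 T "- T"] by auto
    moreover from this have "v1 = 0" using Minj[OF z v(2)] Wv WT[OF v(2)] v(1) by simp
    ultimately show "v = 0" using v(1) by simp
  qed
  obtain r where r: "blk r = m" using blk_surj by blast
  define g0 where "g0 z = minv A ** W z" for z
  have g0: "det (g0 z) \<noteq> 0" "A ** g0 z = W z" if "z \<in> ?D" for z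
    using detW[OF that] detA by (simp_all add: g0_def det_mul det_minv matrix_minv_cancel)
  \<comment> \<open>Right multiplication by a diagonal matrix lies in the stabilizer, so the
    determinant is normalized without changing the configuration.\<close>
  define g where "g z = g0 z ** diag_at r (1 / det (g0 z))" for z
  have cg: "continuous_on ?D g"
    unfolding g_def using g0(1) by (intro continuous_intros) (auto simp: g0_def intro!: continuous_intros cW)
  have W1: "g (s, x) = mat 1" if "W (s, x) = A" for s x
    using that by (simp add: g_def g0_def matrix_minv_left detA)
  have WA: "W (s, x) = A" if "\<And>c. blk c < h \<Longrightarrow> G (blk c) (s, x) = mat 1" "E (s, x) = mat 1" for s x
  proof -
    have "W (s, x) $ a $ c = A $ a $ c" for a c
      using that(1)[of c] that(2) by (cases "blk c < h") (simp_all add: W_def M_def)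
    then show ?thesis by (simp add: vec_eq_iff)
  qed
  have "act (g z) = P z" if z: "z \<in> ?D" for z
  proof -
    have "act (g z) = act (g0 z)"
      unfolding g_def using g0(1)[OF z] by (intro act_stab diag_at_stab) simp
    also have "\<dots> = (\<lambda>j\<in>{..<h}. P z j)"
      unfolding act_def
    proof (rule restrict_ext)
      fix j assume "j \<in> {..<h}"
      then have "coord (block j) \<subseteq> coord T" by (auto simp: coord_def T_def)
      then have "(*v) (W z) ` coord (block j) = (*v) (M z) ` coord (block j)"
        using WT by (intro image_cong refl) blast
      then show "(*v) (A ** g0 z) ` coord (block j) = P z j"
        using Mimage[OF z] \<open>j \<in> _\<close> g0(2)[OF z] by simp
    qed
    also have "\<dots> = P z"
      using Ptop[OF z] by (auto simp: topspace_subspace_configurations)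
    finally show ?thesis .
  qed
  moreover have "det (g z) = 1" if "z \<in> ?D" for z
    using g0(1)[OF that] by (simp add: g_def det_mul)
  moreover have "g (0, x) = mat 1" if "x \<in> L" for x
    using that G E(3) by (intro W1 WA) auto
  moreover have "g (s, x) = mat 1"
    if x: "x \<in> L" and const: "\<forall>s\<in>{0..1}. P (s, x) = act (mat 1)" and s: "s \<in> {0..1}" for x s
  proof (intro W1 WA)
    have "p j (s, x) = p j (0, x)" if "s \<in> {0..1}" for s j
      using const that by (simp add: p_def)
    then have G1: "G j (s, x) = mat 1" if "j < h" "s \<in> {0..1}" for j s
      using G[OF that(1)] that(2) x by blast
    then show "G (blk c) (s, x) = mat 1" if "blk c < h" for c
      using that s by simp
    have ME: "M (s, x) = M (0, x)" if "s \<in> {0..1}" for s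
    proof -
      have "M (s, x) $ a $ c = M (0, x) $ a $ c" for a c
        using G1[of "blk c"] that by (cases "blk c < h") (simp_all add: M_def)
      then show ?thesis by (simp add: vec_eq_iff)
    qed
    have "q (s, x) = q (0, x)" if "s \<in> {0..1}" for s
      unfolding q_def ME[OF that] ..
    then show "E (s, x) = mat 1" using x s by (intro E(5) ballI)
  qed
  ultimately show ?thesis using cg by blast
qed

end

section \<open>The degree of a loop of nonzero complex numbers\<close>

text \<open>The winding number, read off from a logarithm that starts at 0. As a relation it carries
  the information that the loop is nonvanishing and based at 1.\<close>

definition has_degree :: "(real \<Rightarrow> complex) \<Rightarrow> int \<Rightarrow> bool"
  where "has_degree \<phi> d \<longleftrightarrow> (\<exists>l. continuous_on {0..1} l \<and> (\<forall>t\<in>{0..1}. \<phi> t = exp (l t)) \<and>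
    l 0 = 0 \<and> l 1 = 2 * pi * \<i> * of_int d)"

lemma exp_eq_1_int: "exp z = 1 \<longleftrightarrow> (\<exists>n::int. z = 2 * pi * \<i> * of_int n)"
  unfolding exp_eq_1 by (auto simp: complex_eq_iff)

text \<open>The values lie in the integer multiples of 2 pi i, which are more than 1 apart, so a
  continuous function on a connected set cannot move between them.\<close>

lemma continuous_logarithm_of_one:
  fixes f :: "'a::topological_space \<Rightarrow> complex"
  assumes "connected S" "continuous_on S f" "\<And>x. x \<in> S \<Longrightarrow> exp (f x) = 1" "x \<in> S" "y \<in> S"
  shows "f x = f y"
proof -
  have "f constant_on S"
  proof (rule continuous_discrete_range_constant[OF assms(1,2)])
    fix x assume x: "x \<in> S"
    have "1 \<le> norm (f y - f x)" if "y \<in> S" "f y \<noteq> f x" for y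
    proof -
      have "exp (f y - f x) = 1" using assms(3) x that by (simp add: exp_diff)
      then obtain n :: int where n: "f y - f x = 2 * pi * \<i> * of_int n" using exp_eq_1_int by blast
      with that have "n \<noteq> 0" by auto
      then have "1 \<le> \<bar>real_of_int n\<bar>" by simp
      moreover have "norm (f y - f x) = 2 * pi * \<bar>real_of_int n\<bar>"
        unfolding n by (simp add: norm_mult)
      moreover have "1 \<le> 2 * pi" using pi_gt3 by simp
      ultimately show ?thesis using mult_mono[of 1 "2 * pi" 1 "\<bar>real_of_int n\<bar>"] by simp
    qed
    then show "\<exists>e>0. \<forall>y. y \<in> S \<and> f y \<noteq> f x \<longrightarrow> e \<le> norm (f y - f x)"
      by (intro exI[of _ 1]) auto
  qed
  then show ?thesis using assms(4,5) unfolding constant_on_def by metis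
qed

lemma has_degree_exists:
  assumes "continuous_on {0..1} \<phi>" "\<And>t. t \<in> {0..1} \<Longrightarrow> \<phi> t \<noteq> 0" "\<phi> 0 = 1" "\<phi> 1 = 1"
  shows "\<exists>d. has_degree \<phi> d"
proof -
  obtain L where L: "continuous_on {0..1} L" "\<And>t. t \<in> {0..1} \<Longrightarrow> \<phi> t = exp (L t)"
    using continuous_logarithm_on_contractible[OF assms(1) _ assms(2)]
    by (metis convex_imp_contractible convex_real_interval(5))
  have L01: "exp (L 0) = 1" "exp (L 1) = 1" using L(2)[of 0] L(2)[of 1] assms by auto
  then have "exp (L 1 - L 0) = 1" by (simp add: exp_diff)
  then obtain n :: int where n: "L 1 - L 0 = 2 * pi * \<i> * of_int n" using exp_eq_1_int by blast
  have "has_degree \<phi> n"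
    unfolding has_degree_def
    by (rule exI[of _ "\<lambda>t. L t - L 0"]) (use L L01 n in \<open>auto simp: exp_diff intro!: continuous_intros\<close>)
  then show ?thesis ..
qed

lemma has_degree_mult:
  assumes "has_degree \<phi> d" "has_degree \<psi> e" shows "has_degree (\<lambda>t. \<phi> t * \<psi> t) (d + e)"
proof -
  obtain l where l: "continuous_on {0..1} l" "\<forall>t\<in>{0..1}. \<phi> t = exp (l t)" "l 0 = 0"
    "l 1 = 2 * pi * \<i> * of_int d" using assms(1) unfolding has_degree_def by blast
  obtain l' where l': "continuous_on {0..1} l'" "\<forall>t\<in>{0..1}. \<psi> t = exp (l' t)" "l' 0 = 0"
    "l' 1 = 2 * pi * \<i> * of_int e" using assms(2) unfolding has_degree_def by blast
  show ?thesis
    unfolding has_degree_def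
    by (rule exI[of _ "\<lambda>t. l t + l' t"])
      (use l l' in \<open>auto simp: exp_add distrib_left intro!: continuous_intros\<close>)
qed

lemma has_degree_cong:
  "has_degree \<phi> d \<Longrightarrow> (\<And>t. t \<in> {0..1} \<Longrightarrow> \<psi> t = \<phi> t) \<Longrightarrow> has_degree \<psi> d"
  unfolding has_degree_def by metis

lemma has_degree_exp: "has_degree (\<lambda>t. exp (2 * pi * \<i> * of_int d * of_real t)) d"
  unfolding has_degree_def
  by (rule exI[of _ "\<lambda>t. 2 * pi * \<i> * of_int d * of_real t"]) (auto intro!: continuous_intros)

lemma logarithm_unique:
  fixes l l' :: "'a::topological_space \<Rightarrow> complex"
  assumes "connected S" "continuous_on S l" "continuous_on S l'" "\<And>t. t \<in> S \<Longrightarrow> exp (l t) = exp (l' t)"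
    "x \<in> S" "y \<in> S"
  shows "l y - l x = l' y - l' x"
proof -
  have "l x - l' x = l y - l' y"
    by (rule continuous_logarithm_of_one[OF assms(1), where f = "\<lambda>t. l t - l' t"])
      (use assms in \<open>auto simp: exp_diff intro!: continuous_intros\<close>)
  then show ?thesis by (simp add: algebra_simps)
qed

lemma has_degree_unique:
  assumes "has_degree \<phi> d" "has_degree \<phi> e" shows "d = e"
proof -
  obtain l where l: "continuous_on {0..1} l" "\<forall>t\<in>{0..1}. \<phi> t = exp (l t)" "l 0 = 0"
    "l 1 = 2 * pi * \<i> * of_int d" using assms(1) unfolding has_degree_def by blast
  obtain l' where l': "continuous_on {0..1} l'" "\<forall>t\<in>{0..1}. \<phi> t = exp (l' t)" "l' 0 = 0"
    "l' 1 = 2 * pi * \<i> * of_int e" using assms(2) unfolding has_degree_def by blast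
  have "l 1 - l 0 = l' 1 - l' 0"
    by (rule logarithm_unique[OF _ l(1) l'(1)]) (use l(2) l'(2) in auto)
  then show ?thesis using l l' by simp
qed

text \<open>For a logarithm \<open>L\<close> on the whole square, the increment
  \<open>L (s, 1) - L (s, 0)\<close> is continuous in \<open>s\<close> and takes values in the
  multiples of 2 pi i, hence is constant.\<close>

lemma has_degree_homotopic:
  fixes \<Phi> :: "real \<times> real \<Rightarrow> complex"
  assumes c: "continuous_on ({0..1} \<times> {0..1}) \<Phi>"
    and nz: "\<And>s t. s \<in> {0..1} \<Longrightarrow> t \<in> {0..1} \<Longrightarrow> \<Phi> (s, t) \<noteq> 0"
    and ends: "\<And>s. s \<in> {0..1} \<Longrightarrow> \<Phi> (s, 0) = 1" "\<And>s. s \<in> {0..1} \<Longrightarrow> \<Phi> (s, 1) = 1"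
    and d: "has_degree (\<lambda>t. \<Phi> (0, t)) d"
  shows "has_degree (\<lambda>t. \<Phi> (1, t)) d"
proof -
  let ?Q = "{0..1::real} \<times> {0..1::real}"
  have "contractible ?Q" by (intro convex_imp_contractible convex_Times) auto
  then obtain L where L: "continuous_on ?Q L" "\<And>z. z \<in> ?Q \<Longrightarrow> \<Phi> z = exp (L z)"
    using continuous_logarithm_on_contractible[OF c] nz by (metis mem_Sigma_iff surj_pair)
  have cL: "continuous_on {0..1} (\<lambda>t. L (s, t))" "continuous_on {0..1} (\<lambda>t. L (t, s))" if "s \<in> {0..1}" for s
    using that by (auto intro!: continuous_on_compose2[OF L(1)] continuous_intros)
  have e: "exp (L (s, 0)) = 1" "exp (L (s, 1)) = 1" if "s \<in> {0..1}" for s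
    using L(2)[of "(s, 0)"] L(2)[of "(s, 1)"] ends that by auto
  obtain l where l: "continuous_on {0..1} l" "\<forall>t\<in>{0..1}. \<Phi> (0, t) = exp (l t)" "l 0 = 0"
    "l 1 = 2 * pi * \<i> * of_int d" using d unfolding has_degree_def by blast
  have "L (0, 1) - L (0, 0) = l 1 - l 0"
    by (rule logarithm_unique[OF _ cL(1) l(1)]) (use L(2) l(2) in auto)
  moreover have "L (0, 1) - L (0, 0) = L (1, 1) - L (1, 0)"
    by (rule continuous_logarithm_of_one[where S = "{0..1::real}" and f = "\<lambda>s. L (s, 1) - L (s, 0)"])
      (use cL(2) e in \<open>auto simp: exp_diff intro!: continuous_intros\<close>)
  ultimately have "L (1, 1) - L (1, 0) = 2 * pi * \<i> * of_int d" using l by simp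
  then show ?thesis
    unfolding has_degree_def
    by (intro exI[of _ "\<lambda>t. L (1, t) - L (1, 0)"])
      (use cL(1)[of 1] e[of 1] L(2) in \<open>auto simp: exp_diff intro!: continuous_intros\<close>)
qed

section \<open>Loops in the stabilizer\<close>

lemma homotopic_rel_mult_right:
  fixes \<phi> :: "'a::topological_space \<Rightarrow> complex^'n^'n"
  assumes "homotopic_rel B (mat 1) K Z \<phi> \<psi>" "B \<subseteq> K" "continuous_on K \<theta>" "\<And>x. x \<in> B \<Longrightarrow> \<theta> x = mat 1"
    and "\<And>z x. z \<in> Z \<Longrightarrow> x \<in> K \<Longrightarrow> z ** \<theta> x \<in> Z'"
  shows "homotopic_rel B (mat 1) K Z' (\<lambda>x. \<phi> x ** \<theta> x) (\<lambda>x. \<psi> x ** \<theta> x)"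
proof -
  obtain H where H: "continuous_on ({0..1::real} \<times> K) H" "\<forall>u\<in>{0..1}. \<forall>x\<in>K. H (u, x) \<in> Z"
    "\<forall>x. H (0, x) = \<phi> x" "\<forall>x. H (1, x) = \<psi> x" "\<forall>u\<in>{0..1}. \<forall>x\<in>B. H (u, x) = mat 1"
    using homotopic_relD[OF assms(1)] by blast
  show ?thesis
  proof (rule homotopic_relI[where H = "\<lambda>z. H z ** \<theta> (snd z)"])
    show "continuous_on ({0..1} \<times> K) (\<lambda>z. H z ** \<theta> (snd z))"
      by (intro continuous_intros H continuous_on_compose2[OF assms(3)]) auto
  qed (use H assms in auto)
qed

context flag_blocks
begin

section \<open>Diagonal blocks of stabilizer matrices\<close>

definition blockpart :: "nat \<Rightarrow> complex^'n^'n \<Rightarrow> complex^'n^'n"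
  where "blockpart j g = (\<chi> a b. if blk a = j \<and> blk b = j then g $ a $ b else if a = b then 1 else 0)"

definition blockdet :: "nat \<Rightarrow> complex^'n^'n \<Rightarrow> complex"
  where "blockdet j g = det (blockpart j g)"

text \<open>Stages in the contraction of a stabilizer loop: stage 0 is the block diagonal part, each
  further stage replaces one more block by the identity, and stage \<open>Suc m\<close> is the
  identity.\<close>

definition trunc :: "nat \<Rightarrow> complex^'n^'n \<Rightarrow> complex^'n^'n"
  where "trunc j g = (\<chi> a b. if blk a = blk b \<and> j \<le> blk a then g $ a $ b else if a = b then 1 else 0)"

lemma continuous_on_blockpart [continuous_intros]:
  assumes "continuous_on S g" shows "continuous_on S (\<lambda>x. blockpart j (g x))"
proof -
  have "continuous_on S (\<lambda>x. if blk a = j \<and> blk b = j then g x $ a $ b else if a = b then 1 else 0)" for a b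
    using assms by (cases "blk a = j \<and> blk b = j") (auto intro!: continuous_intros)
  then show ?thesis unfolding blockpart_def by (intro continuous_intros)
qed

lemma continuous_on_blockdet [continuous_intros]:
  "continuous_on S g \<Longrightarrow> continuous_on S (\<lambda>x. blockdet j (g x))"
  unfolding blockdet_def by (intro continuous_intros)

lemma continuous_on_trunc [continuous_intros]:
  assumes "continuous_on S g" shows "continuous_on S (\<lambda>x. trunc j (g x))"
proof -
  have "continuous_on S (\<lambda>x. if blk a = blk b \<and> j \<le> blk a then g x $ a $ b else if a = b then 1 else 0)" for a b
    using assms by (cases "blk a = blk b"; cases "j \<le> blk a") (auto intro!: continuous_intros)
  then show ?thesis unfolding trunc_def by (intro continuous_intros)
qed

lemma blockpart_one [simp]: "blockpart j (mat 1) = mat 1"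
  by (simp add: blockpart_def vec_eq_iff mat_def)

lemma trunc_one [simp]: "trunc j (mat 1) = mat 1"
  by (simp add: trunc_def vec_eq_iff mat_def)

lemma blockdet_one [simp]: "blockdet j (mat 1) = 1"
  by (simp add: blockdet_def)

lemma blockpart_supported: "block_supported (block j) (blockpart j g)"
  by (auto simp: block_supported_def blockpart_def)

text \<open>A column of \<open>t\<close> in block \<open>j\<close> has all its nonzero entries in
  that block, so only entries inside the block enter the product. The bound \<open>j < h\<close>
  excludes a complementary block, whose columns may have entries elsewhere.\<close>

lemma blockpart_mult:
  assumes "t \<in> stab" "j < h"
  shows "blockpart j (s ** t) = blockpart j s ** blockpart j t"
proof -
  have "blockpart j (s ** t) $ a $ b = (blockpart j s ** blockpart j t) $ a $ b" for a b
  proof (cases "blk a = j \<and> blk b = j")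
    case True
    have "s $ a $ c * t $ c $ b = blockpart j s $ a $ c * blockpart j t $ c $ b" for c
      using True assms by (cases "blk c = j") (auto simp: blockpart_def stab_def)
    then have "(s ** t) $ a $ b = (blockpart j s ** blockpart j t) $ a $ b"
      by (simp add: matrix_matrix_mult_def)
    moreover have "blockpart j (s ** t) $ a $ b = (s ** t) $ a $ b"
      using True by (simp add: blockpart_def)
    ultimately show ?thesis by simp
  next
    case False
    then show ?thesis
      using block_supportedD[OF block_supported_mult[OF blockpart_supported blockpart_supported], of a j b s t]
        block_supportedD[OF blockpart_supported, of a j b "s ** t"]
      by auto
  qed
  then show ?thesis by (simp add: vec_eq_iff)
qed

lemma blockdet_mult: "t \<in> stab \<Longrightarrow> j < h \<Longrightarrow> blockdet j (s ** t) = blockdet j s * blockdet j t"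
  by (simp add: blockdet_def blockpart_mult det_mul)

lemma trunc_Suc: "trunc j g = blockpart j g ** trunc (Suc j) g"
proof -
  have "(blockpart j g ** trunc (Suc j) g) $ a $ b = trunc j g $ a $ b" for a b
  proof (cases "blk a = j")
    case True
    have "blockpart j g $ a $ c * trunc (Suc j) g $ c $ b
        = (if c = b then if blk b = j then g $ a $ b else 0 else 0)" for c
      using True by (auto simp: blockpart_def trunc_def)
    then show ?thesis using True by (auto simp: matrix_matrix_mult_def trunc_def)
  next
    case False
    have "blockpart j g $ a $ c * trunc (Suc j) g $ c $ b
        = (if c = a then trunc (Suc j) g $ a $ b else 0)" for c
      using False by (auto simp: blockpart_def)
    moreover have "trunc (Suc j) g $ a $ b = trunc j g $ a $ b"
      using False by (auto simp: trunc_def)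
    ultimately show ?thesis by (simp add: matrix_matrix_mult_def)
  qed
  then show ?thesis by (simp add: vec_eq_iff)
qed

lemma trunc_Suc_m: "trunc (Suc m) g = mat 1"
  using blk_le by (auto simp: trunc_def mat_def vec_eq_iff not_less_eq_eq[symmetric])

text \<open>Outside the diagonal blocks a stabilizer element is nonzero at most in rows of
  \<open>T\<close> and columns of the complementary block, exactly the part that is removed.\<close>

lemma shrink_zero_stab:
  assumes "g \<in> stab" shows "shrink T 0 g = trunc 0 g"
proof -
  have "blk a = h" if "\<not> blk a < h" for a
    using that blk_le[of a] hm by auto
  then have "shrink T 0 g $ a $ b = trunc 0 g $ a $ b" for a b
    using assms unfolding shrink_def trunc_def T_def stab_def
    by (cases "blk b < h"; cases "blk a < h"; cases "blk a = blk b"; cases "a = b") auto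
  then show ?thesis by (simp add: vec_eq_iff)
qed

lemma det_shrink_stab:
  assumes "g \<in> stab" shows "det (shrink T u g) = det g"
proof (rule det_shrink)
  fix a c assume "a \<notin> T" "c \<in> T"
  then have "blk c < h" "blk a \<noteq> blk c" by (auto simp: T_def)
  then show "g $ a $ c = 0" using assms by (simp add: stab_def)
qed

lemma det_trunc_Suc: "det (trunc j g) = blockdet j g * det (trunc (Suc j) g)"
  unfolding blockdet_def by (subst trunc_Suc) (rule det_mul)

lemma det_trunc_nonzero:
  assumes "g \<in> stab" shows "det (trunc j g) \<noteq> 0"
proof (induction j)
  case 0
  have "det (trunc 0 g) = det g"
    using det_shrink_stab[OF assms, of 0] shrink_zero_stab[OF assms] by simp
  then show ?case using assms by (simp add: stab_def)
next
  case (Suc j)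
  then show ?case using det_trunc_Suc[of j g] by auto
qed

lemma blockdet_nonzero: "g \<in> stab \<Longrightarrow> blockdet j g \<noteq> 0"
  using det_trunc_nonzero[of g j] det_trunc_Suc[of j g] by auto

lemma trunc_stab:
  assumes "g \<in> stab" shows "trunc j g \<in> stab"
  using det_trunc_nonzero[OF assms, of j] by (auto simp: stab_def trunc_def)

text \<open>Degree zero means that a logarithm \<open>l\<close> of the determinant is itself a loop
  at 0. Multiplying one diagonal entry by \<open>exp (- u * l t)\<close> deforms the loop into the
  special linear group, where it contracts.\<close>

lemma blockpart_nullhomotopic:
  fixes \<phi> :: "real \<Rightarrow> complex^'n^'n"
  assumes c: "continuous_on {0..1} \<phi>" and b: "\<And>t. t \<in> {0..1} \<Longrightarrow> block_supported (block j) (\<phi> t)"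
    and ends: "\<phi> 0 = mat 1" "\<phi> 1 = mat 1" and "j \<le> m" and deg: "has_degree (\<lambda>t. det (\<phi> t)) 0"
  shows "homotopic_rel {0, 1} (mat 1) {0..1} {g. block_supported (block j) g \<and> det g \<noteq> 0} \<phi> (\<lambda>_. mat 1)"
proof -
  obtain r where r: "blk r = j" using blk_surj[OF \<open>j \<le> m\<close>] by blast
  obtain l where l: "continuous_on {0..1} l" "\<forall>t\<in>{0..1}. det (\<phi> t) = exp (l t)" "l 0 = 0" "l 1 = 0"
    using deg unfolding has_degree_def by auto
  let ?\<psi> = "\<lambda>t. \<phi> t ** diag_at r (exp (- l t))"
  have supp: "block_supported (block j) (\<phi> t ** diag_at r z)" if "t \<in> {0..1}" for t z
    using b[OF that] r by (intro block_supported_mult diag_at_block_supported) auto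
  have "homotopic_rel {0, 1} (mat 1) {0..1} {g. block_supported (block j) g \<and> det g \<noteq> 0} \<phi> ?\<psi>"
  proof (rule homotopic_relI[where H = "\<lambda>z. \<phi> (snd z) ** diag_at r (exp (- (of_real (fst z) * l (snd z))))"])
    show "continuous_on ({0..1} \<times> {0..1}) (\<lambda>z. \<phi> (snd z) ** diag_at r (exp (- (of_real (fst z) * l (snd z)))))"
      by (intro continuous_intros continuous_on_compose2[OF c] continuous_on_compose2[OF l(1)]) auto
    show "\<phi> (snd (u, t)) ** diag_at r (exp (- (of_real (fst (u, t)) * l (snd (u, t)))))
        \<in> {g. block_supported (block j) g \<and> det g \<noteq> 0}" if "u \<in> {0..1}" "t \<in> {0..1}" for u t
      using supp[OF that(2)] l(2) that by (simp add: det_mul)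
  qed (use l ends in auto)
  moreover have "homotopic_rel {0, 1} (mat 1) {0..1} (block_SL (block j)) ?\<psi> (\<lambda>_. mat 1)"
  proof (rule block_SL_nullhomotopic)
    show "continuous_on {0..1} ?\<psi>" by (intro continuous_intros c l(1))
    show "?\<psi> t \<in> block_SL (block j)" if "t \<in> {0..1}" for t
      using supp[OF that] l(2) that by (simp add: block_SL_def det_mul flip: exp_add)
  qed (use l ends in auto)
  then have "homotopic_rel {0, 1} (mat 1) {0..1} {g. block_supported (block j) g \<and> det g \<noteq> 0} ?\<psi> (\<lambda>_. mat 1)"
    by (rule homotopic_rel_mono) (auto simp: block_SL_def)
  ultimately show ?thesis by (rule homotopic_with_trans)
qed

lemma stab_loop_nullhomotopic:
  fixes \<gamma> :: "real \<Rightarrow> complex^'n^'n"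
  assumes c: "continuous_on {0..1} \<gamma>" and st: "\<And>t. t \<in> {0..1} \<Longrightarrow> \<gamma> t \<in> stab"
    and det1: "\<And>t. t \<in> {0..1} \<Longrightarrow> det (\<gamma> t) = 1" and ends: "\<gamma> 0 = mat 1" "\<gamma> 1 = mat 1"
    and deg: "\<And>j. j < m \<Longrightarrow> has_degree (\<lambda>t. blockdet j (\<gamma> t)) 0"
  shows "homotopic_rel {0, 1} (mat 1) {0..1} stab \<gamma> (\<lambda>_. mat 1)"
proof -
  \<comment> \<open>The total determinant is 1 and each split-off block has degree 0, so the
    remaining determinant keeps degree 0. At \<open>j = m\<close> only the last block remains, whose
    degree is not among the hypotheses.\<close>
  have degtrunc: "has_degree (\<lambda>t. det (trunc j (\<gamma> t))) 0" if "j \<le> m" for j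
    using that
  proof (induction j)
    case 0
    have "det (trunc 0 (\<gamma> t)) = 1" if "t \<in> {0..1}" for t
      using det_shrink_stab[OF st[OF that], of 0] shrink_zero_stab[OF st[OF that]] det1[OF that] by simp
    moreover have "has_degree (\<lambda>t. 1) 0" using has_degree_exp[of 0] by simp
    ultimately show ?case by (auto intro: has_degree_cong)
  next
    case (Suc j)
    obtain e where e: "has_degree (\<lambda>t. det (trunc (Suc j) (\<gamma> t))) e"
      using has_degree_exists[of "\<lambda>t. det (trunc (Suc j) (\<gamma> t))"] det_trunc_nonzero[OF st] ends
      by (force intro: continuous_intros c)
    have "has_degree (\<lambda>t. blockdet j (\<gamma> t) * det (trunc (Suc j) (\<gamma> t))) (0 + e)"
      by (rule has_degree_mult) (use Suc deg e in auto)
    then have "0 + e = 0"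
      using Suc by (intro has_degree_unique) (auto simp flip: det_trunc_Suc)
    then show ?case using e by simp
  qed
  have "has_degree (\<lambda>t. blockdet j (\<gamma> t)) 0" if "j \<le> m" for j
  proof (cases "j = m")
    case True
    then show ?thesis
      using degtrunc[of m] unfolding det_trunc_Suc trunc_Suc_m by simp
  qed (use deg that in auto)
  then have "homotopic_rel {0, 1} (mat 1) {0..1} {g. block_supported (block j) g \<and> det g \<noteq> 0}
      (\<lambda>t. blockpart j (\<gamma> t)) (\<lambda>_. mat 1)" if "j \<le> m" for j
    using that ends by (intro blockpart_nullhomotopic continuous_intros c blockpart_supported)
      (auto simp: blockdet_def)
  then have step: "homotopic_rel {0, 1} (mat 1) {0..1} stab (\<lambda>t. blockpart j (\<gamma> t) ** trunc (Suc j) (\<gamma> t))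
      (\<lambda>t. mat 1 ** trunc (Suc j) (\<gamma> t))" if "j \<le> m" for j
  proof (rule homotopic_rel_mult_right[OF _ _ continuous_on_trunc[OF c]])
    show "z ** trunc (Suc j) (\<gamma> t) \<in> stab"
      if "z \<in> {g. block_supported (block j) g \<and> det g \<noteq> 0}" "t \<in> {0..1}" for z t
      using that by (intro stab_mult trunc_stab st block_supported_stab[of j]) auto
  qed (use that ends in auto)
  have "homotopic_rel {0, 1} (mat 1) {0..1} stab \<gamma> (\<lambda>t. trunc j (\<gamma> t))" if "j \<le> Suc m" for j
    using that
  proof (induction j)
    case 0
    show ?case
    proof (rule homotopic_relI[where H = "\<lambda>z. shrink T (complex_of_real (1 - fst z)) (\<gamma> (snd z))"])
      show "continuous_on ({0..1} \<times> {0..1}) (\<lambda>z. shrink T (complex_of_real (1 - fst z)) (\<gamma> (snd z)))"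
        by (intro continuous_intros continuous_on_compose2[OF c]) auto
      show "shrink T (complex_of_real (1 - fst (u, t))) (\<gamma> (snd (u, t))) \<in> stab" if "t \<in> {0..1}" for u t
        using det_shrink_stab[OF st[OF that]] st[OF that] by (auto simp: stab_def shrink_def)
    qed (use ends shrink_zero_stab st in auto)
  next
    case (Suc j)
    then have "homotopic_rel {0, 1} (mat 1) {0..1} stab \<gamma> (\<lambda>t. trunc j (\<gamma> t))" by simp
    moreover have "homotopic_rel {0, 1} (mat 1) {0..1} stab (\<lambda>t. trunc j (\<gamma> t)) (\<lambda>t. trunc (Suc j) (\<gamma> t))"
      using step[of j] Suc.prems by (simp flip: trunc_Suc)
    ultimately show ?case by (rule homotopic_with_trans)
  qed
  from this[of "Suc m"] show ?thesis by (simp add: trunc_Suc_m)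
qed

end

section \<open>The degree of a spheroid\<close>

context flag_blocks
begin

definition base :: "nat \<Rightarrow> (complex^'n) set" where "base = act (mat 1)"

text \<open>On the fourth side of the square a lift is a loop in the stabilizer, which represents the image
  of the spheroid under the connecting homomorphism to the fundamental group of the stabilizer.\<close>

definition lift_of :: "(real \<times> real \<Rightarrow> nat \<Rightarrow> (complex^'n) set) \<Rightarrow> (real \<times> real \<Rightarrow> complex^'n^'n) \<Rightarrow> bool"
  where "lift_of p g \<longleftrightarrow> continuous_on ({0..1} \<times> {0..1}) g \<and>
    (\<forall>s\<in>{0..1}. \<forall>t\<in>{0..1}. det (g (s, t)) = 1 \<and> act (g (s, t)) = p (s, t)) \<and>
    (\<forall>t\<in>{0..1}. g (0, t) = mat 1) \<and> (\<forall>s\<in>{0..1}. g (s, 0) = mat 1 \<and> g (s, 1) = mat 1)"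

lemma lift_ofD:
  assumes "lift_of p g"
  shows "continuous_on ({0..1} \<times> {0..1}) g"
    and "\<And>s t. s \<in> {0..1} \<Longrightarrow> t \<in> {0..1} \<Longrightarrow> det (g (s, t)) = 1"
    and "\<And>s t. s \<in> {0..1} \<Longrightarrow> t \<in> {0..1} \<Longrightarrow> act (g (s, t)) = p (s, t)"
    and "\<And>t. t \<in> {0..1} \<Longrightarrow> g (0, t) = mat 1"
    and "\<And>s. s \<in> {0..1} \<Longrightarrow> g (s, 0) = mat 1" and "\<And>s. s \<in> {0..1} \<Longrightarrow> g (s, 1) = mat 1"
  using assms unfolding lift_of_def by blast+

lemma lift_of_side:
  assumes g: "lift_of p g" and p: "p \<in> spheroids F base"
  shows "continuous_on {0..1} (\<lambda>t. g (1, t))" and "\<And>t. t \<in> {0..1} \<Longrightarrow> g (1, t) \<in> stab"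
proof -
  show "continuous_on {0..1} (\<lambda>t. g (1, t))"
    by (intro continuous_on_compose2[OF lift_ofD(1)[OF g]] continuous_intros) auto
  show "g (1, t) \<in> stab" if "t \<in> {0..1}" for t
  proof (rule stab_of_act_one)
    show "det (g (1, t)) \<noteq> 0" using lift_ofD(2)[OF g, of 1 t] that by simp
    have "p (1, t) = base" using p that by (auto simp: spheroids_def const_on_boundary_iff)
    then show "act (g (1, t)) = act (mat 1)" using lift_ofD(3)[OF g, of 1 t] that by (simp add: base_def)
  qed
qed

lemma lift_exists:
  assumes p: "p \<in> spheroids F base" shows "\<exists>g. lift_of p g"
proof -
  have bd: "p (0, t) = act (mat 1)" "p (s, 0) = act (mat 1)" "p (s, 1) = act (mat 1)"
    if "s \<in> {0..1}" "t \<in> {0..1}" for s t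
    using p that by (auto simp: spheroids_def const_on_boundary_iff base_def)
  have P0: "p (0, t) = act (mat 1)" if "t \<in> {0..1}" for t
    using bd(1)[of 0 t] that by simp
  have cp: "continuous_map unit_square F p" using p by (simp add: spheroids_def)
  obtain g where g: "continuous_on ({0..1} \<times> {0..1}) g"
    "\<forall>z\<in>{0..1} \<times> {0..1}. det (g z) = 1 \<and> act (g z) = p z" "\<forall>t\<in>{0..1}. g (0, t) = mat 1"
    "\<forall>t\<in>{0..1}. (\<forall>s\<in>{0..1}. p (s, t) = act (mat 1)) \<longrightarrow> (\<forall>s\<in>{0..1}. g (s, t) = mat 1)"
    using lift_configuration[OF compact_Icc[of 0 "1::real"] cp P0] by blast
  have "lift_of p g"
    unfolding lift_of_def using g bd by auto
  then show ?thesis by blast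
qed

text \<open>Two lifts differ by a map of the whole square into the stabilizer that is trivial on
  three sides. Sweeping from \<open>s = 0\<close> to \<open>s = 1\<close> is thus a homotopy of
  based loops from the block determinant of \<open>g (1, t)\<close> to that of
  \<open>g' (1, t)\<close>.\<close>

lemma degree_lift_indep:
  assumes p: "p \<in> spheroids F base" and g: "lift_of p g" and g': "lift_of p g'" and "j < h"
    and d: "has_degree (\<lambda>t. blockdet j (g (1, t))) d"
  shows "has_degree (\<lambda>t. blockdet j (g' (1, t))) d"
proof -
  let ?\<Phi> = "\<lambda>z. blockdet j (g (1, snd z)) * blockdet j (minv (g z) ** g' z)"
  have st: "minv (g (s, t)) ** g' (s, t) \<in> stab" if "s \<in> {0..1}" "t \<in> {0..1}" for s t
    using lift_ofD(2,3)[OF g that] lift_ofD(2,3)[OF g' that] by (intro stab_of_act_eq) auto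
  have "has_degree (\<lambda>t. ?\<Phi> (1, t)) d"
  proof (rule has_degree_homotopic)
    show "continuous_on ({0..1} \<times> {0..1}) ?\<Phi>"
      using lift_ofD(2)[OF g]
      by (intro continuous_intros lift_ofD(1)[OF g] lift_ofD(1)[OF g']
          continuous_on_compose2[OF lift_of_side(1)[OF g p]]) auto
    show "?\<Phi> (s, t) \<noteq> 0" if "s \<in> {0..1}" "t \<in> {0..1}" for s t
      using blockdet_nonzero[OF st[OF that]] blockdet_nonzero[OF lift_of_side(2)[OF g p that(2)]] by simp
    show "has_degree (\<lambda>t. ?\<Phi> (0, t)) d"
      by (rule has_degree_cong[OF d]) (simp add: lift_ofD(4)[OF g] lift_ofD(4)[OF g'])
  qed (simp_all add: lift_ofD(5,6)[OF g] lift_ofD(5,6)[OF g'])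
  then show ?thesis
  proof (rule has_degree_cong)
    fix t :: real assume t: "t \<in> {0..1}"
    have "det (g (1, t)) \<noteq> 0" using lift_ofD(2)[OF g, of 1 t] t by simp
    then have "g' (1, t) = g (1, t) ** (minv (g (1, t)) ** g' (1, t))"
      by (simp add: matrix_minv_cancel)
    then show "blockdet j (g' (1, t)) = ?\<Phi> (1, t)"
      using blockdet_mult[OF st[of 1 t] \<open>j < h\<close>, of "g (1, t)"] t by simp
  qed
qed

text \<open>The homotopy is lifted as a whole; on the side \<open>s = 1\<close> the lift is a
  homotopy of loops in the stabilizer. Independence of the lift relates its two ends to
  \<open>g\<close> and \<open>g'\<close>.\<close>

lemma degree_homotopy_invariant:
  assumes hom: "(p, p') \<in> spheroid_homotopic F base" and g: "lift_of p g" and g': "lift_of p' g'"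
    and "j < h" and d: "has_degree (\<lambda>t. blockdet j (g (1, t))) d"
  shows "has_degree (\<lambda>t. blockdet j (g' (1, t))) d"
proof -
  have pp: "p \<in> spheroids F base" "p' \<in> spheroids F base"
    using hom equivE[OF equiv_spheroid_homotopic[of F base]] by blast+
  obtain H where H: "continuous_map (top_of_set ({0..1} \<times> {0..1} \<times> {0..1})) F H"
    "\<forall>x. H (0, x) = p x" "\<forall>x. H (1, x) = p' x" "\<forall>u\<in>{0..1::real}. const_on_boundary base (\<lambda>x. H (u, x))"
    using hom unfolding spheroid_homotopic_def homotopic_with_def prod_interval_unit_square by blast
  \<comment> \<open>Lifting proceeds along the first coordinate and must start at the base point.
    The square coordinate \<open>s\<close> is therefore moved to the front, and the homotopy
    parameter \<open>u\<close> becomes part of the compact parameter space.\<close>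
  let ?\<pi> = "\<lambda>(s, u, t). (u, s, t) :: real \<times> real \<times> real"
  define P where "P = H \<circ> ?\<pi>"
  have "continuous_map (top_of_set ({0..1} \<times> {0..1} \<times> {0..1})) (top_of_set ({0..1} \<times> {0..1} \<times> {0..1})) ?\<pi>"
    unfolding case_prod_unfold by (auto simp: continuous_map_in_subtopology intro!: continuous_intros)
  from continuous_map_compose[OF this H(1)]
  have cP: "continuous_map (top_of_set ({0..1} \<times> {0..1} \<times> {0..1})) F P" by (simp only: P_def)
  have bd: "P (0, u, t) = act (mat 1)" "P (s, u, 0) = act (mat 1)" "P (s, u, 1) = act (mat 1)"
    "P (1, u, t) = act (mat 1)"
    if "s \<in> {0..1}" "t \<in> {0..1}" "u \<in> {0..1}" for s t u
    using H(4) that by (auto simp: P_def const_on_boundary_iff base_def)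
  have P0: "P (0, x) = act (mat 1)" if "x \<in> {0..1} \<times> {0..1}" for x
    using bd(1)[of 0 "snd x" "fst x"] that by (auto simp: mem_Times_iff)
  obtain G where G: "continuous_on ({0..1} \<times> {0..1} \<times> {0..1}) G"
    "\<forall>z\<in>{0..1} \<times> {0..1} \<times> {0..1}. det (G z) = 1 \<and> act (G z) = P z"
    "\<forall>x\<in>{0..1} \<times> {0..1}. G (0, x) = mat 1"
    "\<forall>x\<in>{0..1} \<times> {0..1}. (\<forall>s\<in>{0..1}. P (s, x) = act (mat 1)) \<longrightarrow> (\<forall>s\<in>{0..1}. G (s, x) = mat 1)"
    using lift_configuration[OF compact_Times[OF compact_Icc compact_Icc] cP P0] by blast
  have lift: "lift_of (\<lambda>(s, t). P (s, u, t)) (\<lambda>(s, t). G (s, u, t))" if u: "u \<in> {0..1}" for u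
    unfolding lift_of_def
  proof (intro conjI ballI)
    show "continuous_on ({0..1} \<times> {0..1}) (\<lambda>(s, t). G (s, u, t))"
      unfolding case_prod_unfold using u
      by (intro continuous_on_compose2[OF G(1)] continuous_intros) auto
  qed (use u G(2-4) bd in auto)
  have st: "G (1, u, t) \<in> stab" if "u \<in> {0..1}" "t \<in> {0..1}" for u t
    using G(2) bd(4)[of 1 t u] that by (intro stab_of_act_one) auto
  have G01: "lift_of p (\<lambda>(s, t). G (s, 0, t))" "lift_of p' (\<lambda>(s, t). G (s, 1, t))"
    using lift[of 0] lift[of 1] H(2,3) by (auto simp: P_def)
  have "has_degree (\<lambda>t. blockdet j (G (1, 0, t))) d"
    using degree_lift_indep[OF pp(1) g G01(1) \<open>j < h\<close> d] by simp
  have "has_degree (\<lambda>t. (\<lambda>z. blockdet j (G (1, z))) (1, t)) d"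
  proof (rule has_degree_homotopic)
    show "continuous_on ({0..1} \<times> {0..1}) (\<lambda>z. blockdet j (G (1, z)))"
      by (intro continuous_intros continuous_on_compose2[OF G(1)]) auto
    show "blockdet j (G (1, u, t)) \<noteq> 0" if "u \<in> {0..1}" "t \<in> {0..1}" for u t
      by (rule blockdet_nonzero[OF st[OF that]])
    show "blockdet j (G (1, u, 0)) = 1" "blockdet j (G (1, u, 1)) = 1" if "u \<in> {0..1}" for u
      using lift_ofD(5,6)[OF lift[OF that], of 1] by auto
  qed fact
  then show ?thesis
    using degree_lift_indep[OF pp(2) G01(2) g' \<open>j < h\<close>, of d] by simp
qed

text \<open>Only the first \<open>m\<close> of the \<open>m + 1\<close> blocks are recorded.
  Extensionality makes the vector an element of \<open>product_group\<close> and hence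
  unique.\<close>

definition spheroid_degree :: "(real \<times> real \<Rightarrow> nat \<Rightarrow> (complex^'n) set) \<Rightarrow> (nat \<Rightarrow> int) \<Rightarrow> bool"
  where "spheroid_degree p d \<longleftrightarrow> d \<in> extensional {..<m} \<and>
    (\<exists>g. lift_of p g \<and> (\<forall>j<m. has_degree (\<lambda>t. blockdet j (g (1, t))) (d j)))"

lemma m_le_h: "j < m \<Longrightarrow> j < h"
  using hm by auto

lemma spheroid_degree_exists:
  assumes p: "p \<in> spheroids F base" shows "\<exists>d. spheroid_degree p d"
proof -
  obtain g where g: "lift_of p g" using lift_exists[OF p] by blast
  have "\<exists>d. has_degree (\<lambda>t. blockdet j (g (1, t))) d" for j
    using blockdet_nonzero[OF lift_of_side(2)[OF g p]] lift_ofD(5,6)[OF g]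
    by (intro has_degree_exists continuous_intros lift_of_side(1)[OF g p]) auto
  then obtain d where "\<And>j. has_degree (\<lambda>t. blockdet j (g (1, t))) (d j)" by metis
  then have "spheroid_degree p (restrict d {..<m})"
    unfolding spheroid_degree_def using g by auto
  then show ?thesis by blast
qed

lemma spheroid_degree_unique:
  assumes "(p, p') \<in> spheroid_homotopic F base" "spheroid_degree p d" "spheroid_degree p' d'"
  shows "d = d'"
proof (rule extensionalityI[where A = "{..<m}"])
  fix j assume "j \<in> {..<m}"
  then have j: "j < m" by simp
  obtain g g' where "lift_of p g" "has_degree (\<lambda>t. blockdet j (g (1, t))) (d j)"
    "lift_of p' g'" "has_degree (\<lambda>t. blockdet j (g' (1, t))) (d' j)"
    using assms(2,3) j unfolding spheroid_degree_def by blast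
  then show "d j = d' j"
    using degree_homotopy_invariant[OF assms(1) _ _ m_le_h[OF j]] has_degree_unique by blast
qed (use assms in \<open>auto simp: spheroid_degree_def\<close>)

lemma spheroid_degree_concat:
  assumes p: "p \<in> spheroids F base" and q: "q \<in> spheroids F base"
    and d: "spheroid_degree p d" and e: "spheroid_degree q e"
  shows "spheroid_degree (spheroid_concat p q) (\<lambda>j\<in>{..<m}. d j + e j)"
proof -
  obtain g where g: "lift_of p g" and gd: "\<And>j. j < m \<Longrightarrow> has_degree (\<lambda>t. blockdet j (g (1, t))) (d j)"
    using d unfolding spheroid_degree_def by blast
  obtain g' where g': "lift_of q g'" and ge: "\<And>j. j < m \<Longrightarrow> has_degree (\<lambda>t. blockdet j (g' (1, t))) (e j)"
    using e unfolding spheroid_degree_def by blast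
  \<comment> \<open>The second lift starts at the identity while the first ends in the loop
    \<open>g (1, t)\<close>. Multiplying by this loop on the right joins them and, as it lies in the
    stabilizer, does not affect \<open>act\<close>.\<close>
  define G where "G = (\<lambda>z. if fst z \<le> 1/2 then g (2 * fst z, snd z)
    else g' (2 * fst z - 1, snd z) ** g (1, snd z))"
  have "lift_of (spheroid_concat p q) G"
    unfolding lift_of_def
  proof (intro conjI ballI)
    show "continuous_on ({0..1} \<times> {0..1}) G"
      unfolding G_def
    proof (rule continuous_on_cases_le)
      show "continuous_on {x \<in> {0..1} \<times> {0..1}. fst x \<le> 1 / 2} (\<lambda>z. g (2 * fst z, snd z))"
        by (intro continuous_on_compose2[OF lift_ofD(1)[OF g]] continuous_intros) auto
      show "continuous_on {x \<in> {0..1} \<times> {0..1}. 1 / 2 \<le> fst x} (\<lambda>z. g' (2 * fst z - 1, snd z) ** g (1, snd z))"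
        by (intro continuous_on_compose2[OF lift_ofD(1)[OF g]] continuous_on_compose2[OF lift_ofD(1)[OF g']]
            continuous_intros) auto
      fix z :: "real \<times> real" assume z: "z \<in> {0..1} \<times> {0..1}" "fst z = 1 / 2"
      then have "snd z \<in> {0..1}" "2 * fst z = 1" "2 * fst z - 1 = 0" by auto
      then show "g (2 * fst z, snd z) = g' (2 * fst z - 1, snd z) ** g (1, snd z)"
        using lift_ofD(4)[OF g', of "snd z"] by (simp only: matrix_mul_lid)
    qed (intro continuous_intros)
    fix s t :: real assume s: "s \<in> {0..1}" and t: "t \<in> {0..1}"
    show "det (G (s, t)) = 1"
      using lift_ofD(2)[OF g, of "2 * s" t] lift_ofD(2)[OF g, of 1 t] lift_ofD(2)[OF g', of "2 * s - 1" t] s t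
      by (auto simp: G_def det_mul)
    show "act (G (s, t)) = spheroid_concat p q (s, t)"
      using lift_ofD(3)[OF g, of "2 * s" t] lift_ofD(3)[OF g', of "2 * s - 1" t] s t
        act_stab[OF lift_of_side(2)[OF g p t]]
      by (auto simp: G_def spheroid_concat_def)
  next
    fix t :: real assume "t \<in> {0..1}"
    then show "G (0, t) = mat 1" using lift_ofD(4)[OF g] by (simp add: G_def)
  next
    fix s :: real assume s: "s \<in> {0..1}"
    show "G (s, 0) = mat 1"
      using lift_ofD(5)[OF g, of "2 * s"] lift_ofD(5)[OF g, of 1] lift_ofD(5)[OF g', of "2 * s - 1"] s
      by (auto simp: G_def)
    show "G (s, 1) = mat 1"
      using lift_ofD(6)[OF g, of "2 * s"] lift_ofD(6)[OF g, of 1] lift_ofD(6)[OF g', of "2 * s - 1"] s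
      by (auto simp: G_def)
  qed
  moreover have "has_degree (\<lambda>t. blockdet j (G (1, t))) (d j + e j)" if "j < m" for j
  proof (rule has_degree_cong[OF has_degree_mult[OF gd[OF that] ge[OF that]]])
    fix t :: real assume "t \<in> {0..1}"
    then show "blockdet j (G (1, t)) = blockdet j (g (1, t)) * blockdet j (g' (1, t))"
      using blockdet_mult[OF lift_of_side(2)[OF g p] m_le_h[OF that]] by (simp add: G_def)
  qed
  ultimately show ?thesis
    unfolding spheroid_degree_def by auto
qed

section \<open>Spheroids of degree zero and realization of all degrees\<close>

lemma continuous_map_act_SL: "continuous_map (top_of_set (block_SL UNIV)) F act"
  by (rule continuous_map_from_subtopology_mono[OF continuous_map_act]) (auto simp: block_SL_def)

lemma block_SL_UNIV: "block_SL UNIV = {g. det g = 1}"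
  by (auto simp: block_SL_def block_supported_def)

lemma base_in_topspace: "base \<in> topspace F"
  using continuous_map_funspace[OF continuous_map_act_SL] by (auto simp: base_def block_SL_UNIV)

text \<open>Dividing a lift by a null-homotopy of its side loop in the stabilizer gives a lift that
  is the identity on the whole boundary. As a map of the square into \<open>SL\<close> it contracts
  relative to the boundary, and \<open>act\<close> carries the contraction to
  \<open>F\<close>.\<close>

lemma spheroid_degree_zero:
  assumes p: "p \<in> spheroids F base" and d: "spheroid_degree p (\<lambda>j\<in>{..<m}. 0)"
  shows "(p, \<lambda>_. base) \<in> spheroid_homotopic F base"
proof -
  let ?Q = "{0..1::real} \<times> {0..1::real}"
  let ?B = "frontier ?Q"
  obtain g where g: "lift_of p g" and gd: "\<And>j. j < m \<Longrightarrow> has_degree (\<lambda>t. blockdet j (g (1, t))) 0"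
    using d unfolding spheroid_degree_def by auto
  have "homotopic_rel {0, 1} (mat 1) {0..1} stab (\<lambda>t. g (1, t)) (\<lambda>_. mat 1)"
    by (rule stab_loop_nullhomotopic[OF lift_of_side[OF g p]])
      (use gd lift_ofD(2,5,6)[OF g] in auto)
  from homotopic_relD[OF this] obtain H where H: "continuous_on ({0..1::real} \<times> {0..1::real}) H"
    "\<forall>u\<in>{0..1}. \<forall>t\<in>{0..1}. H (u, t) \<in> stab" "\<forall>t. H (0, t) = g (1, t)" "\<forall>t. H (1, t) = mat 1"
    "\<forall>u\<in>{0..1}. \<forall>t\<in>{0, 1}. H (u, t) = mat 1" by blast
  \<comment> \<open>The parameter is reversed so that the loop itself sits on the side
    \<open>s = 1\<close>, where it cancels \<open>g\<close>, and the identity on the side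
    \<open>s = 0\<close>.\<close>
  have cH: "continuous_on ?Q (\<lambda>z. H (1 - fst z, snd z))"
    by (intro continuous_on_compose2[OF H(1)] continuous_intros) auto
  have Hst: "H (1 - s, t) \<in> stab" if "s \<in> {0..1}" "t \<in> {0..1}" for s t
    using H(2) that by auto
  obtain r where r: "blk r = m" using blk_surj by blast
  define G0 where "G0 z = g z ** minv (H (1 - fst z, snd z))" for z
  have cG0: "continuous_on ?Q G0"
    unfolding G0_def using Hst by (intro continuous_intros lift_ofD(1)[OF g] cH) (auto simp: stab_def)
  have G0: "det (G0 (s, t)) \<noteq> 0" "act (G0 (s, t)) = p (s, t)" if "s \<in> {0..1}" "t \<in> {0..1}" for s t
    using lift_ofD(2,3)[OF g that] Hst[OF that] act_stab[OF stab_minv[OF Hst[OF that]]]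
    by (auto simp: G0_def det_mul det_minv stab_def)
  have G0B: "G0 z = mat 1" if "z \<in> ?B" for z
  proof -
    have "z \<in> {(s::real, t). s \<in> {0..1} \<and> t \<in> {0..1} \<and> (s \<in> {0, 1} \<or> t \<in> {0, 1::real})}"
      using that unfolding frontier_unit_square .
    then obtain s t where z: "z = (s, t)" "s \<in> {0..1}" "t \<in> {0..1}" "s = 0 \<or> s = 1 \<or> t = 0 \<or> t = 1" by blast
    from z(4) show ?thesis
    proof (elim disjE)
      assume "s = 0"
      then show ?thesis using z H(4) lift_ofD(4)[OF g, of t] by (simp add: G0_def)
    next
      assume "s = 1"
      then show ?thesis using z H(3) lift_ofD(2)[OF g, of 1 t] by (simp add: G0_def matrix_minv_right)
    next
      assume "t = 0"
      then show ?thesis using z H(5) lift_ofD(5)[OF g, of s] by (simp add: G0_def)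
    next
      assume "t = 1"
      then show ?thesis using z H(5) lift_ofD(6)[OF g, of s] by (simp add: G0_def)
    qed
  qed
  \<comment> \<open>The null-homotopy runs in \<open>stab\<close>, where the determinant is only
    known to be nonzero, so it has to be normalized again.\<close>
  define G where "G z = G0 z ** diag_at r (1 / det (G0 z))" for z
  have cG: "continuous_on ?Q G"
    unfolding G_def using G0(1) by (intro continuous_intros cG0) auto
  have G: "G (s, t) \<in> block_SL UNIV" "act (G (s, t)) = p (s, t)" if "s \<in> {0..1}" "t \<in> {0..1}" for s t
    using G0[OF that] act_stab[OF diag_at_stab[of "1 / det (G0 (s, t))" r], of "G0 (s, t)"]
    by (simp_all add: G_def block_SL_UNIV det_mul)
  have "homotopic_rel ?B (mat 1) ?Q (block_SL UNIV) G (\<lambda>_. mat 1)"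
  proof (rule block_SL_nullhomotopic)
    show "?B \<subseteq> ?Q" unfolding frontier_unit_square by auto
    show "compact ?Q" by (intro compact_Times compact_Icc)
    show "G x = mat 1" if "x \<in> ?B" for x
      using G0B[OF that] by (simp add: G_def)
  qed (use G(1) cG in auto)
  then have "homotopic_with (const_on_boundary base) unit_square F (act \<circ> G) (act \<circ> (\<lambda>_. mat 1))"
    by (rule homotopic_with_compose_continuous_map_left[OF _ continuous_map_act_SL])
      (simp add: const_on_boundary_def base_def)
  then have "(act \<circ> G, \<lambda>_. base) \<in> spheroid_homotopic F base"
    by (simp add: spheroid_homotopic_def o_def base_def)
  moreover have "(p, act \<circ> G) \<in> spheroid_homotopic F base"
  proof -
    have "homotopic_with (const_on_boundary base) unit_square F p (act \<circ> G)"
    proof (rule homotopic_with_equal)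
      show "p x = (act \<circ> G) x" if "x \<in> topspace unit_square" for x
        using that G(2) by auto
      show "const_on_boundary base (act \<circ> G)"
        using G0B by (simp add: const_on_boundary_def base_def G_def)
    qed (use p in \<open>auto simp: spheroids_def\<close>)
    then show ?thesis by (simp add: spheroid_homotopic_def)
  qed
  ultimately show ?thesis
    using equivE[OF equiv_spheroid_homotopic[of F base]] by (meson transD)
qed

text \<open>The loop of diagonal matrices with degrees d on the first m blocks and minus their sum on the
  last block has determinant 1, hence it bounds a disc in the special linear group.\<close>

lemma spheroid_degree_surj:
  assumes d: "d \<in> extensional {..<m}"
  shows "\<exists>p\<in>spheroids F base. spheroid_degree p d"
proof -
  define r where "r j = (SOME a. blk a = j)" for j
  have r: "blk (r j) = j" if "j \<le> m" for j
    unfolding r_def using someI_ex[OF blk_surj[OF that]] .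
  \<comment> \<open>The entry for block \<open>m\<close> is chosen to make the total degree
    zero.\<close>
  define e where "e j = (if j < m then d j else - (\<Sum>i<m. d i))" for j
  \<comment> \<open>Each block carries its degree on one representative index, so that its
    determinant is a single exponential.\<close>
  define c where "c a = (if a = r (blk a) then e (blk a) else 0)" for a
  define \<omega> where "\<omega> n t = exp (2 * pi * \<i> * of_int n * complex_of_real t)" for n t
  define \<gamma> :: "real \<Rightarrow> complex^'n^'n" where "\<gamma> t = (\<chi> a b. if a = b then \<omega> (c a) t else 0)" for t
  have c\<gamma>: "continuous_on {0..1} \<gamma>"
  proof -
    have "continuous_on {0..1} (\<lambda>t. if a = b then \<omega> (c a) t else 0)" for a b
      by (cases "a = b") (auto simp: \<omega>_def intro!: continuous_intros)
    then show ?thesis unfolding \<gamma>_def by (intro continuous_intros)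
  qed
  have \<omega>0: "\<omega> 0 t = 1" "\<omega> n 0 = 1" for t n by (simp_all add: \<omega>_def)
  have \<omega>1: "\<omega> n 1 = 1" for n
    using exp_eq_1_int[of "2 * pi * \<i> * of_int n"] by (auto simp: \<omega>_def)
  have \<gamma>01: "\<gamma> 0 = mat 1" "\<gamma> 1 = mat 1"
    by (auto simp: \<gamma>_def \<omega>0 \<omega>1 mat_def vec_eq_iff)
  have "(\<Sum>a\<in>UNIV. c a) = (\<Sum>a\<in>r ` {..m}. c a)"
    using blk_le by (intro sum.mono_neutral_right) (auto simp: c_def)
  also have "\<dots> = (\<Sum>j\<le>m. e j)"
    using r by (subst sum.reindex) (auto simp: c_def inj_on_def intro!: sum.cong, metis)
  also have "\<dots> = 0" by (simp add: e_def lessThan_Suc_atMost[symmetric])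
  finally have csum: "(\<Sum>a\<in>UNIV. c a) = 0" .
  have det\<gamma>: "det (\<gamma> t) = 1" for t
  proof -
    have "det (\<gamma> t) = (\<Prod>a\<in>UNIV. \<omega> (c a) t)"
      by (subst det_diagonal) (auto simp: \<gamma>_def)
    also have "\<dots> = exp (\<Sum>a\<in>UNIV. 2 * pi * \<i> * of_int (c a) * complex_of_real t)"
      by (simp add: \<omega>_def exp_sum)
    also have "(\<Sum>a\<in>UNIV. 2 * pi * \<i> * of_int (c a) * complex_of_real t)
        = 2 * pi * \<i> * of_int (\<Sum>a\<in>UNIV. c a) * complex_of_real t"
      by (simp add: sum_distrib_left sum_distrib_right)
    finally show ?thesis by (simp add: csum)
  qed
  have \<gamma>stab: "\<gamma> t \<in> stab" for t
    using det\<gamma>[of t] by (auto simp: stab_def \<gamma>_def)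
  have "homotopic_rel {0, 1} (mat 1) {0..1} (block_SL UNIV) \<gamma> (\<lambda>_. mat 1)"
    by (rule block_SL_nullhomotopic) (use c\<gamma> det\<gamma> \<gamma>01 in \<open>auto simp: block_SL_UNIV\<close>)
  from homotopic_relD[OF this] obtain H where H: "continuous_on ({0..1::real} \<times> {0..1::real}) H"
    "\<forall>u\<in>{0..1}. \<forall>t\<in>{0..1}. H (u, t) \<in> block_SL UNIV" "\<forall>t. H (0, t) = \<gamma> t" "\<forall>t. H (1, t) = mat 1"
    "\<forall>u\<in>{0..1}. \<forall>t\<in>{0, 1}. H (u, t) = mat 1" by blast
  \<comment> \<open>Read backwards, the contraction starts at the identity and ends in
    \<open>\<gamma>\<close>, as a lift must. Since \<open>\<gamma>\<close> lies in the stabilizer,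
    \<open>act\<close> maps the whole boundary to the base point.\<close>
  define g where "g z = H (1 - fst z, snd z)" for z
  have cg: "continuous_on ({0..1} \<times> {0..1}) g"
    unfolding g_def by (intro continuous_on_compose2[OF H(1)] continuous_intros) auto
  have gSL: "g (s, t) \<in> block_SL UNIV" if "s \<in> {0..1}" "t \<in> {0..1}" for s t
    using H(2) that by (auto simp: g_def)
  have g1: "g (1, t) = \<gamma> t" for t using H(3) by (simp add: g_def)
  have g0: "g (0, t) = mat 1" for t using H(4) by (simp add: g_def)
  have gs: "g (s, 0) = mat 1" "g (s, 1) = mat 1" if "s \<in> {0..1}" for s
    using H(5) that by (simp_all add: g_def)
  let ?p = "act \<circ> g"
  have "continuous_map unit_square (top_of_set (block_SL UNIV)) g"
    using cg gSL by (auto simp: continuous_map_in_subtopology)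
  from continuous_map_compose[OF this continuous_map_act_SL]
  have p: "?p \<in> spheroids F base"
    using act_stab[OF \<gamma>stab, where g = "mat 1"]
    by (auto simp: spheroids_def const_on_boundary_iff gs g0 g1 base_def)
  have "lift_of ?p g"
    using cg gSL gs g0 by (auto simp: lift_of_def block_SL_UNIV)
  moreover have "has_degree (\<lambda>t. blockdet j (g (1, t))) (d j)" if "j < m" for j
  proof (rule has_degree_cong[OF has_degree_exp])
    fix t :: real
    have rj: "blk (r j) = j" using r that by simp
    have "blockdet j (\<gamma> t) = (\<Prod>a\<in>UNIV. if blk a = j then \<omega> (c a) t else 1)"
      unfolding blockdet_def by (subst det_diagonal) (auto simp: blockpart_def \<gamma>_def intro!: prod.cong)
    also have "\<dots> = (\<Prod>a\<in>UNIV. if a = r j then \<omega> (d j) t else 1)"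
      using rj that by (intro prod.cong) (auto simp: c_def e_def \<omega>0)
    finally show "blockdet j (g (1, t)) = exp (2 * pi * \<i> * of_int (d j) * complex_of_real t)"
      by (simp add: g1 \<omega>_def)
  qed
  ultimately have "spheroid_degree ?p d"
    unfolding spheroid_degree_def using d by blast
  then show ?thesis using p by blast
qed

section \<open>The second homotopy group\<close>

theorem second_homotopy_group_iso:
  "second_homotopy_group F base \<cong> product_group {..<m} (\<lambda>_. integer_group)"
proof -
  let ?G = "second_homotopy_group F base" and ?P = "product_group {..<m} (\<lambda>_. integer_group)"
  let ?R = "spheroid_homotopic F base"
  let ?cl = "\<lambda>p. ?R `` {p}"
  note E = equiv_spheroid_homotopic[of F base]
  interpret G: group ?G by (rule group_second_homotopy_group[OF base_in_topspace])
  have car: "\<exists>p\<in>spheroids F base. A = ?cl p" if "A \<in> carrier ?G" for A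
    using that by (auto simp: second_homotopy_group_def quotient_def)
  have cl: "?cl p \<in> carrier ?G" if "p \<in> spheroids F base" for p
    using that by (auto simp: second_homotopy_group_def quotient_def)
  \<comment> \<open>Homotopic spheroids have the same degree vector, so the description is
    unambiguous on a class.\<close>
  define f where "f A = (THE d. \<exists>p\<in>A. spheroid_degree p d)" for A
  have f: "f (?cl p) = d" if p: "p \<in> spheroids F base" and d: "spheroid_degree p d" for p d
    unfolding f_def
  proof (rule the_equality)
    show "\<exists>q\<in>?cl p. spheroid_degree q d"
      using d equiv_class_self[OF E p] by blast
    show "e = d" if "\<exists>q\<in>?cl p. spheroid_degree q e" for e
      using that spheroid_degree_unique d by blast
  qed
  have hom: "f \<in> hom ?G ?P"
  proof (rule homI)
    fix A assume "A \<in> carrier ?G"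
    then obtain p where p: "p \<in> spheroids F base" "A = ?cl p" using car by blast
    obtain d where d: "spheroid_degree p d" using spheroid_degree_exists[OF p(1)] by blast
    then show "f A \<in> carrier ?P"
      using f[OF p(1) d] p(2) by (simp add: spheroid_degree_def PiE_iff)
  next
    fix A B assume "A \<in> carrier ?G" "B \<in> carrier ?G"
    then obtain p q where p: "p \<in> spheroids F base" "A = ?cl p" and q: "q \<in> spheroids F base" "B = ?cl q"
      using car by blast
    obtain d where d: "spheroid_degree p d" using spheroid_degree_exists[OF p(1)] by blast
    obtain e where e: "spheroid_degree q e" using spheroid_degree_exists[OF q(1)] by blast
    have "f (A \<otimes>\<^bsub>?G\<^esub> B) = f (?cl (spheroid_concat p q))"
      using p q by (simp only: mult_second_homotopy_group)
    also have "\<dots> = (\<lambda>j\<in>{..<m}. d j + e j)"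
      by (rule f[OF spheroid_concat_in[OF p(1) q(1)] spheroid_degree_concat[OF p(1) q(1) d e]])
    also have "\<dots> = f A \<otimes>\<^bsub>?P\<^esub> f B"
      using f[OF p(1) d] f[OF q(1) e] p q by simp
    finally show "f (A \<otimes>\<^bsub>?G\<^esub> B) = f A \<otimes>\<^bsub>?P\<^esub> f B" .
  qed
  have "f ` carrier ?G = carrier ?P"
  proof
    show "f ` carrier ?G \<subseteq> carrier ?P" using hom by (auto simp: hom_def)
    show "carrier ?P \<subseteq> f ` carrier ?G"
    proof
      fix d assume "d \<in> carrier ?P"
      then have "d \<in> extensional {..<m}" by (simp add: PiE_iff)
      then obtain p where p: "p \<in> spheroids F base" "spheroid_degree p d"
        using spheroid_degree_surj by blast
      then show "d \<in> f ` carrier ?G" using f[OF p] cl[OF p(1)] by blast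
    qed
  qed
  moreover have "inj_on f (carrier ?G)"
    unfolding inj_on_one_iff'[OF hom G.is_group product_group[OF group_integer_group]]
  proof (intro allI impI)
    fix A assume "A \<in> carrier ?G" and fA: "f A = \<one>\<^bsub>?P\<^esub>"
    then obtain p where p: "p \<in> spheroids F base" "A = ?cl p" using car by blast
    obtain d where d: "spheroid_degree p d" using spheroid_degree_exists[OF p(1)] by blast
    then have "d = (\<lambda>j\<in>{..<m}. 0)" using f[OF p(1) d] p(2) fA by simp
    then have "(p, \<lambda>_. base) \<in> ?R" using spheroid_degree_zero[OF p(1)] d by simp
    then have "?cl p = ?cl (\<lambda>_. base)" by (rule equiv_class_eq[OF E])
    then show "A = \<one>\<^bsub>?G\<^esub>" by (simp add: p(2) second_homotopy_group_def)
  qed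
  ultimately have "f \<in> iso ?G ?P" using hom by (simp add: iso_iff)
  then show ?thesis by (rule is_isoI)
qed

end

section \<open>Adapted bases\<close>

text \<open>Extending a frame and not just a set keeps the numbering, so that blocks of consecutive
  indices still span the given subspaces.\<close>

lemma frame_extends_to_basis:
  fixes f :: "nat \<Rightarrow> complex^'n"
  assumes f: "inj_on f {..<l}" "vec.independent (f ` {..<l})"
  obtains g where "g \<in> frames CARD('n)" "\<And>i. i < l \<Longrightarrow> g i = f i"
proof -
  let ?S = "f ` {..<l}" and ?n = "CARD('n)"
  define E where "E = vec.extend_basis ?S"
  have E: "?S \<subseteq> E" "vec.independent E" "vec.span E = UNIV"
    unfolding E_def using vec.extend_basis_superset[OF f(2)] vec.independent_extend_basis[OF f(2)]
      vec.span_extend_basis[OF f(2)] by auto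
  have finE: "finite E" by (rule vec.finiteI_independent[OF E(2)])
  have cardE: "card E = ?n"
    using vec.dim_span_eq_card_independent[OF E(2)] unfolding E(3) by (metis vec_dim_card)
  have cS: "card ?S = l" using card_image[OF f(1)] by simp
  then have l: "l \<le> ?n" using card_mono[OF finE E(1)] cardE by simp
  have "card {l..<?n} = card (E - ?S)"
    using cardE cS l card_Diff_subset[of ?S E] E(1) by simp
  then obtain \<beta> where \<beta>: "bij_betw \<beta> {l..<?n} (E - ?S)"
    using finite_same_card_bij[of "{l..<?n}" "E - ?S"] finE by auto
  define g where "g = (\<lambda>i\<in>{..<?n}. if i < l then f i else \<beta> i)"
  have "bij_betw g ({..<l} \<union> {l..<?n}) (?S \<union> (E - ?S))"
  proof (rule bij_betw_combine)
    show "bij_betw g {..<l} ?S"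
      using f(1) l by (auto simp: bij_betw_def g_def inj_on_def)
    show "bij_betw g {l..<?n} (E - ?S)"
      using \<beta> by (rule iffD1[OF bij_betw_cong, rotated]) (auto simp: g_def)
  qed auto
  moreover have "{..<l} \<union> {l..<?n} = {..<?n}" "?S \<union> (E - ?S) = E" using l E(1) by auto
  ultimately have "bij_betw g {..<?n} E" by simp
  then have "g \<in> frames ?n"
    using E(2) by (auto simp: frames_def bij_betw_def g_def)
  moreover have "g i = f i" if "i < l" for i using that l by (simp add: g_def)
  ultimately show ?thesis by (rule that)
qed

lemma div_eq_iff_block: "(k::nat) > 0 \<Longrightarrow> i div k = j \<longleftrightarrow> i \<in> {j * k..<j * k + k}"
proof
  assume "k > 0" "i div k = j"
  then show "i \<in> {j * k..<j * k + k}"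
    using dividend_less_div_times[of k i] div_times_less_eq_dividend[of i k] by (auto simp: add.commute)
qed (auto intro!: div_nat_eqI simp: mult.commute)

text \<open>This makes an arbitrary point of the configuration space the base point of the locale.
  One block fewer is needed when the subspaces fill the whole space, hence the case distinction in
  the parameter \<open>m\<close>.\<close>

lemma configuration_adapted_basis:
  fixes H :: "nat \<Rightarrow> (complex^'n) set"
  assumes k: "k > 0" and h: "h > 0" and n: "h * k \<le> CARD('n)"
    and H: "H \<in> topspace (subspace_configurations h (h * k) k)"
  obtains A :: "complex^'n^'n" and blk where
    "flag_blocks h k (if CARD('n) = h * k then h - 1 else h) A blk" "flag_blocks.base h A blk = H"
proof -
  let ?n = "CARD('n)"
  define m where "m = (if ?n = h * k then h - 1 else h)"
  have HGr: "H j \<in> grassmannian k" if "j < h" for j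
    using H that by (auto simp: topspace_subspace_configurations)
  have Hdim: "vec.dim (\<Sum>j<h. H j) = h * k" and Hext: "H \<in> extensional {..<h}"
    using H by (auto simp: topspace_subspace_configurations PiE_iff)
  have "\<forall>j\<in>{..<h}. \<exists>f. f \<in> frames k \<and> vec.span (f ` {..<k}) = H j"
    using HGr unfolding grassmannian_eq_span_frames[symmetric] by blast
  from bchoice[OF this] obtain f where f: "\<And>j. j < h \<Longrightarrow> vec.span (f j ` {..<k}) = H j"
    by (metis lessThan_iff)
  \<comment> \<open>The frames are concatenated: position \<open>i\<close> holds vector
    \<open>i mod k\<close> of subspace \<open>i div k\<close>.\<close>
  define f' where "f' i = f (i div k) (i mod k)" for i
  have f'j: "f' ` {j * k..<j * k + k} = f j ` {..<k}" for j
  proof -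
    have "{j * k..<j * k + k} = (\<lambda>i. j * k + i) ` {..<k}"
      by (simp add: lessThan_atLeast0 add.commute)
    then show ?thesis using k by (auto simp: f'_def image_image)
  qed
  have UN: "{..<h * k} = (\<Union>j<h. {j * k..<j * k + k})"
  proof -
    have "i \<in> (\<Union>j<h. {j * k..<j * k + k}) \<longleftrightarrow> (\<exists>j<h. i div k = j)" for i
      unfolding div_eq_iff_block[OF k] by blast
    then have "i \<in> {..<h * k} \<longleftrightarrow> i \<in> (\<Union>j<h. {j * k..<j * k + k})" for i
      using div_less_iff_less_mult[OF k, of i h] by simp
    then show ?thesis by blast
  qed
  have blk_sub: "{j * k..<j * k + k} \<subseteq> {..<h * k}" if "j < h" for j
    unfolding UN using that by blast
  have blk_sub': "{j * k..<j * k + k} \<subseteq> {..<?n}" if "j < h" for j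
    using blk_sub[OF that] n by (meson lessThan_subset_iff subset_trans)
  have span: "vec.span (f' ` {..<h * k}) = (\<Sum>j<h. H j)"
  proof -
    have "(\<Sum>j<h. H j) = (\<Sum>j<h. vec.span (f j ` {..<k}))"
      using f by (intro sum.cong) auto
    also have "\<dots> = vec.span (\<Union>j<h. f j ` {..<k})" by (rule sum_span_eq_span_Union)
    finally show ?thesis unfolding UN image_UN f'j by simp
  qed
  have le: "card (f' ` {..<h * k}) \<le> h * k" using card_image_le[of "{..<h * k}" f'] by simp
  \<comment> \<open>The vectors span a space of dimension \<open>h * k\<close> and number at most
    \<open>h * k\<close>.\<close>
  have ind: "vec.independent (f' ` {..<h * k})"
    using le Hdim by (intro vec.card_le_dim_spanning[of _ "\<Sum>j<h. H j"])
      (auto simp flip: span intro: vec.span_base)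
  have "card (f' ` {..<h * k}) = h * k"
    using vec.dim_span_eq_card_independent[OF ind] Hdim unfolding span by simp
  then have inj: "inj_on f' {..<h * k}" by (simp add: eq_card_imp_inj_on)
  obtain g where g: "g \<in> frames ?n" "\<And>i. i < h * k \<Longrightarrow> g i = f' i"
    using frame_extends_to_basis[OF inj ind] by metis
  obtain e :: "nat \<Rightarrow> 'n" where e: "bij_betw e {..<?n} UNIV"
    using ex_bij_betw_nat_finite[of "UNIV :: 'n set"] by (auto simp: atLeast0LessThan)
  have e_inj: "inj_on e {..<?n}" and e_surj: "e ` {..<?n} = UNIV" using e by (auto simp: bij_betw_def)
  define A where "A = frame_matrix e ?n g"
  \<comment> \<open>The minimum collects all indices from \<open>h * k\<close> on in the single
    complementary block \<open>h\<close>.\<close>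
  define blk where "blk a = min (inv_into {..<?n} e a div k) h" for a
  have blk_e: "blk (e i) = min (i div k) h" if "i < ?n" for i
    using that inv_into_f_f[OF e_inj] by (simp add: blk_def)
  have block: "{a. blk a = j} = e ` {j * k..<j * k + k}" if "j < h" for j
  proof -
    note sub = blk_sub'[OF that]
    have "a \<in> {a. blk a = j} \<longleftrightarrow> a \<in> e ` {j * k..<j * k + k}" for a
    proof -
      obtain i where i: "i < ?n" "a = e i" using e_surj by blast
      have "blk a = j \<longleftrightarrow> i div k = j" using blk_e[OF i(1)] i(2) that by auto
      also have "\<dots> \<longleftrightarrow> i \<in> {j * k..<j * k + k}" by (rule div_eq_iff_block[OF k])
      also have "\<dots> \<longleftrightarrow> a \<in> e ` {j * k..<j * k + k}"
        using inj_on_image_mem_iff[OF e_inj _ sub, of i] i by simp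
      finally show ?thesis by simp
    qed
    then show ?thesis by blast
  qed
  have card_block: "card {a. blk a = j} = k" if "j < h" for j
    unfolding block[OF that] using card_image[OF inj_on_subset[OF e_inj blk_sub'[OF that]]] by simp
  have fb: "flag_blocks h k m A blk"
  proof
    show "k > 0" by fact
    show "det A \<noteq> 0"
      unfolding det_nonzero_iff_inj A_def
      using frame_matrix_inj[OF e_inj g(1)] by (simp add: e_surj coord_def)
    show "blk a \<le> m" for a
    proof -
      obtain i where i: "i < ?n" "a = e i" using e_surj by blast
      show ?thesis
      proof (cases "?n = h * k")
        case True
        then have "i div k < h" using i(1) by (simp add: less_mult_imp_div_less)
        then show ?thesis using True blk_e[OF i(1)] i(2) by (simp add: m_def)
      qed (simp add: m_def blk_def)
    qed
    show "h = m \<or> h = Suc m" using h by (auto simp: m_def)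
    show "card {a. blk a = j} = k" if "j < h" for j by (rule card_block[OF that])
    show "\<exists>a. blk a = j" if "j \<le> m" for j
    proof (cases "j < h")
      case True
      then have "{a. blk a = j} \<noteq> {}" using card_block[OF True] k by (metis card.empty less_irrefl)
      then show ?thesis by blast
    next
      \<comment> \<open>Only possible when a complement exists; its first index is
        \<open>h * k\<close>.\<close>
      case False
      then have "j = h" "h * k < ?n" using that n h by (auto simp: m_def split: if_splits)
      then have "blk (e (h * k)) = j" using blk_e k by simp
      then show ?thesis by blast
    qed
  qed
  moreover have "flag_blocks.base h A blk = H"
  proof -
    interpret flag_blocks h k m A blk by (rule fb)
    have "(*v) A ` coord {a. blk a = j} = H j" if "j < h" for j
    proof -
      note sub = blk_sub[OF that]
      have "(*v) A ` coord {a. blk a = j} = vec.span ((*v) A ` (\<lambda>a. axis a 1) ` e ` {j * k..<j * k + k})"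
        by (simp only: coord_eq_span vec.span_image block[OF that])
      also have "(*v) A ` (\<lambda>a. axis a 1) ` e ` {j * k..<j * k + k} = (\<lambda>i. A *v axis (e i) 1) ` {j * k..<j * k + k}"
        by (simp only: image_image)
      also have "\<dots> = f' ` {j * k..<j * k + k}"
      proof (rule image_cong[OF refl])
        fix i assume "i \<in> {j * k..<j * k + k}"
        then have i: "i < h * k" using sub by blast
        show "A *v axis (e i) 1 = f' i"
          unfolding A_def using frame_matrix_column(2)[OF e_inj] g(2)[OF i] i n by simp
      qed
      finally show ?thesis by (simp add: f'j f[OF that])
    qed
    then have "base j = H j" for j
      using Hext by (cases "j < h") (simp_all add: base_def act_def extensional_def)
    then show ?thesis by blast
  qed
  ultimately show ?thesis unfolding m_def by (rule that)
qed

text \<open>In both cases the rank is the number of blocks minus one: there are \<open>h\<close>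
  blocks if the subspaces fill the space, and \<open>h + 1\<close> if a complementary block is
  present.\<close>

theorem mainTheorem3:
  fixes h k :: nat
  assumes "h > 1" "k > 1" "CARD('n::finite) \<ge> h * k"
  shows "(CARD('n) = h * k \<longrightarrow>
      (\<forall>H \<in> topspace (subspace_configurations h (h * k) k :: (nat \<Rightarrow> (complex ^ 'n) set) topology).
        second_homotopy_group (subspace_configurations h (h * k) k) H
          \<cong> product_group {..<h - 1} (\<lambda>_. integer_group))) \<and>
    (h * k < CARD('n) \<longrightarrow>
      (\<forall>H \<in> topspace (subspace_configurations h (h * k) k :: (nat \<Rightarrow> (complex ^ 'n) set) topology).
        second_homotopy_group (subspace_configurations h (h * k) k) H
          \<cong> product_group {..<h} (\<lambda>_. integer_group)))"
proof -
  let ?m = "if CARD('n) = h * k then h - 1 else h"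
  have "second_homotopy_group (subspace_configurations h (h * k) k) H
      \<cong> product_group {..<?m} (\<lambda>_. integer_group)"
    if H: "H \<in> topspace (subspace_configurations h (h * k) k)" for H :: "nat \<Rightarrow> (complex ^ 'n) set"
  proof -
    have kh: "k > 0" "h > 0" using assms by auto
    show ?thesis
    proof (rule configuration_adapted_basis[OF kh assms(3) H])
      fix A :: "complex^'n^'n" and blk
      assume fb: "flag_blocks h k ?m A blk" and base: "flag_blocks.base h A blk = H"
      show ?thesis
        using flag_blocks.second_homotopy_group_iso[OF fb] unfolding base .
    qed
  qed
  then show ?thesis by auto
qed

end
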